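(* In addition to the standing assumptions listed in the context, let one of the following be satisfied. (a) $\pi_\star(V_\star)<\infty$, and $V_0\in\mathcal{V}(\kappa)$ for some $\kappa\in\mathbb{R}$, where $\mathcal{V}(\kappa)=\{f\in\mathcal{L}(\mathbb{X})\cap\mathcal{O}(V_\star): f\ge V_\star-\kappa,\ \pi_\star(f)\le\kappa+1\}$. (b) $\pi_\star(V_\star)<\infty$, $V_\star$ is bounded, and $V_0\in\mathcal{L}(\mathbb{X})$ is bounded. (c) There exist constants $\theta_1>0$ (without loss of generality $\theta_1\in(0,1)$) and $\theta_2$ such that $\min_{u\in\mathcal{U}(x)}c(x,u)\ge\theta_1V_\star(x)-\theta_2$ for all $x\in\mathbb{X}$, and $V_0\in\mathcal{L}(\mathbb{X})\cap\mathcal{O}(V_\star)$. With $\mathcal{S}f(x)=\inf_{u\in\mathcal{U}(x)}[c(x,u)+\int f(y)P(dy\,|\,x,u)]$, define three relative value iterations, all started from the initial condition $V_0=\check V_0=\widetilde V_0$, by $$V_n=\mathcal{S}V_{n-1}-\nu(V_{n-1}),\qquad \check V_n=\mathcal{S}\check V_{n-1}-\min_{\mathbb{X}}\check V_{n-1},\qquad \widetilde V_n=\mathcal{S}\widetilde V_{n-1}-\widetilde V_{n-1}(\hat x),\qquad n\ge1,$$ where $\hat x\in\mathcal{B}$ is some point that is kept fixed. Then the value iteration functions $V_n$, $\check V_n$ and $\widetilde V_n$ converge $\pi_\star$-a.e. to $V_\star$ as $n\to\infty$. In addition, if (c) holds, then the convergence is pointwise for all $x\in\mathbb{X}$.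
   Context: Notation. For a Polish space $\mathbb{Y}$, $\mathfrak{B}(\mathbb{Y})$ is its Borel $\sigma$-algebra, $\mathfrak{P}(\mathbb{Y})$ the Borel probability measures, $\mathcal{M}(\mathbb{Y})$ the real-valued Borel functions, $\mathcal{M}_b(\mathbb{Y})$ the bounded ones, and $\mathcal{L}(\mathbb{Y})$ the real-valued lower semicontinuous functions bounded from below. For a probability measure $\mu$, $\mu(f)=\int f\,d\mu$. For $f\in\mathcal{M}(\mathbb{X})$, $\|g\|_f=\sup_x\frac{|g(x)|}{1+|f(x)|}$ and $\mathcal{O}(f)=\{g\in\mathcal{M}(\mathbb{X}):\|g\|_f<\infty\}$. Model. A Markov decision process $(\mathbb{X},\mathbb{U},\mathcal{U},P,c)$: the state space $\mathbb{X}$ and the action space $\mathbb{U}$ are Polish; $\mathcal{U}:\mathbb{X}\to\mathfrak{B}(\mathbb{U})$ is a strict (nonempty-valued) measurable multifunction; $\mathbb{K}=\{(x,u):x\in\mathbb{X},\,u\in\mathcal{U}(x)\}$ has the relative topology of $\mathbb{X}\times\mathbb{U}$; $P(\cdot\,|\,x,u)$ is a stochastic kernel on $\mathbb{K}\times\mathfrak{B}(\mathbb{X})$; $c:\mathbb{K}\to[1,\infty]$ is the measurable running cost. Admissible strategies $\xi=\{\xi_t\}\in\mathfrak{U}$ are sequences of stochastic kernels on $\mathbb{U}$ given the history $h_t=(x_0,u_0,\dots,u_{t-1},x_t)$ with $\xi_t(\mathcal{U}(x_t)\,|\,h_t)=1$; $\mathbb{P}^\xi_\mu$, $\mathbb{E}^\xi_\mu$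 are the induced law and expectation of $(X_t,U_t)_{t\ge0}$ with $X_0\sim\mu$ (subscript $x$ for the Dirac mass at $x$). $\mathfrak{U}_{\mathrm{sm}}$ is the set of stationary Markov randomized strategies, i.e. stochastic kernels $v(du\,|\,x)$ with $v(\mathcal{U}(x)\,|\,x)=1$ (a measurable selector $v:\mathbb{X}\to\mathbb{U}$ of $\mathcal{U}$ is identified with the kernel of Dirac masses). For $v\in\mathfrak{U}_{\mathrm{sm}}$, $P_v(A\,|\,x)=\int P(A\,|\,x,u)v(du\,|\,x)$ and $c_v(x)=\int c(x,u)v(du\,|\,x)$. Average cost. $\mathcal{E}(\mu,\xi)=\limsup_{N}\frac1N\mathbb{E}^\xi_\mu[\sum_{n=0}^{N-1}c(X_n,U_n)]$, $J(\mu)=\inf_{\xi\in\mathfrak{U}}\mathcal{E}(\mu,\xi)$ ($J(x)$ for the Dirac mass at $x$), $\beta=\inf_{\mu}J(\mu)$. A strategy $\xi$ is optimal if $\mathcal{E}(\mu,\xi)=J(\mu)$ for all $\mu\in\mathfrak{P}(\mathbb{X})$. Standing assumptions. Basic: $P$ is strongly continuous, i.e. $(x,u)\mapsto\int f(y)P(dy\,|\,x,u)$ is continuous on $\mathbb{K}$ for every $f\in\mathcal{M}_b(\mathbb{X})$; $\mathcal{U}$ is upper semicontinuous and closed-valued; $c$ is lower semicontinuous. (A0): there are a bounded (Borel) set $\mathcal{B}\subset\mathbb{X}$ with $\inf_{(x,u)\in(\mathcal{B}^c\times\mathbb{U})\cap\mathbb{K}}c(x,u)>\beta$, a measure $\nu\in\mathfrak{P}(\mathbb{X})$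 with $\nu(\mathcal{B})=1$ and a constant $\delta>0$ with $P(A\,|\,x,u)\ge\delta\nu(A)\mathbf{1}_{\mathcal{B}}(x)$ for all $A\in\mathfrak{B}(\mathbb{X})$, $(x,u)\in\mathbb{K}$, and $\sum_{n\ge1}\mathbb{P}^v_x(X_n\in\mathcal{B})>0$ for all $v\in\mathfrak{U}_{\mathrm{sm}}$, $x\in\mathbb{X}$. Here $\delta$ is chosen so that $\inf_{(x,u)\in(\mathcal{B}\times\mathbb{U})\cap\mathbb{K}}P(\mathcal{B}\,|\,x,u)>\delta$. (A1): either (i) $J(x)<\infty$ for some $x$ and $c$ is inf-compact on $\mathbb{K}$ (all sets $\{c\le\kappa\}$, $\kappa\in\mathbb{R}$, are compact); or (ii) $c$ is $\mathcal{K}$-inf-compact (inf-compact on $(K\times\mathbb{U})\cap\mathbb{K}$ for each compact $K\subset\mathbb{X}$) and (C) holds. Condition (C): there is a continuous one-one embedding of $\mathbb{K}$ into a Polish space whose image has compact closure $\mathbb{K}^*$ ($\mathbb{K}$ being identified with its image), where $\mathbb{K}^*$ is taken to be the closure of $\mathbb{K}$ in $\mathbb{X}^*\times\mathbb{U}^*$ with $\mathbb{X}^*,\mathbb{U}^*$ compact dense embeddings of $\mathbb{X},\mathbb{U}$ into suitable Polish spaces, assumed to exist; and there are a compact $\widetilde K\subset\mathbb{K}$ and $\varepsilon_0>0$ with $c\ge\beta+\varepsilon_0$ on $\mathbb{K}\setminus\widetilde K$. (A2): there exists a $c$-stable $v\in\mathfrak{U}_{\mathrm{sm}}$ (defined below).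 Split chain. Let $\mathcal{X}=(\mathbb{X}\times\{0\})\cup(\mathcal{B}\times\{1\})$. For $\mu\in\mathfrak{P}(\mathbb{X})$ (and by linearity for finite measures) define $\breve\mu$ on $\mathcal{X}$ by $\breve\mu(A\times\{0\})=(1-\delta)\mu(A\cap\mathcal{B})+\mu(A\cap\mathcal{B}^c)$, $A\in\mathfrak{B}(\mathbb{X})$, and $\breve\mu(A\times\{1\})=\delta\mu(A)$, $A\in\mathfrak{B}(\mathcal{B})$; $\breve P(\cdot\,|\,x,u)$ is obtained from $P(\cdot\,|\,x,u)$ in this way. The split chain $\breve X_n=(X_n,i_n)$ on $\mathcal{X}$ has kernel $Q(\cdot\,|\,(x,i),u)$ equal to $\breve P(\cdot\,|\,x,u)$ if $i=0$, $x\notin\mathcal{B}$; to $\frac{1}{1-\delta}(\breve P(\cdot\,|\,x,u)-\delta\breve\nu)$ if $i=0$, $x\in\mathcal{B}$; and to $\breve\nu$ if $i=1$, $x\in\mathcal{B}$. Its cost is $\breve c((x,0),u)=c(x,u)$ for $x\in\mathcal{B}^c$, $\breve c((x,0),u)=\frac{c(x,u)}{1-\delta}$ for $x\in\mathcal{B}$, and $\breve c((x,1),u)=0$. A $v\in\mathfrak{U}_{\mathrm{sm}}$ controls the split chain by applying $v(\cdot\,|\,x)$ at $(x,i)$; $\breve c_v(x,i)=\int\breve c((x,i),u)v(du\,|\,x)$ and $\breve{\mathbb{E}}^v_{(x,i)}$ is the expectation started at $(x,i)$. Let $\breve\tau=\min\{n\ge1:\breve X_n\in\mathcal{B}\times\{1\}\}$.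 A $v\in\mathfrak{U}_{\mathrm{sm}}$ is $c$-stable if $x\mapsto\breve{\mathbb{E}}^v_{(x,0)}[\sum_{k=0}^{\breve\tau-1}\breve c_v(\breve X_k)]$ is bounded on every bounded subset of $\mathbb{X}$. Definition of $V_\star$. $\breve V^{(0)}_\star(x)=\inf_{v\in\mathfrak{U}_{\mathrm{sm}}}\breve{\mathbb{E}}^v_{(x,0)}\bigl[\sum_{k=0}^{\breve\tau-1}(\breve c_v(\breve X_k)-\beta)\bigr]$, and $V_\star(x)=(1-\delta)\breve V^{(0)}_\star(x)$ for $x\in\mathcal{B}$, $V_\star(x)=\breve V^{(0)}_\star(x)$ for $x\notin\mathcal{B}$. The function $V_\star\in\mathcal{L}(\mathbb{X})$ solves $V_\star(x)=\min_{u\in\mathcal{U}(x)}[c(x,u)-\beta+\int V_\star(y)P(dy\,|\,x,u)]$. Fixed optimal strategy. $v_\star$ is a fixed optimal stationary Markov strategy which is a measurable selector of the minimizer in this equation, so $V_\star=c_{v_\star}-\beta+P_{v_\star}V_\star$ on $\mathbb{X}$; $\pi_\star$ is the invariant probability measure of the chain controlled by $v_\star$.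
   Formalization: The limits of the second and third iterations are corrected to V⋆ + β − inf V⋆ and V⋆ + β − V⋆(x̂), since as stated they need not converge to V⋆ (only V_n does); the minimum over X is read as an infimum. *)

theory Defs
  imports "HOL-Probability.Probability"
begin

section \<open>Markov decision processes\<close>

text \<open>
  Polish spaces are types of class \<^class>\<open>polish_space\<close>; ``bounded'' refers to the complete metric
  carried by the type. The kernel and the running cost are meaningful on the graph of the action
  multifunction only, and all hypotheses on them are imposed there; their values elsewhere are junk.
\<close>

record ('x, 'u) mdp =
  actions :: "'x \<Rightarrow> 'u set"
  ker :: "'x \<times> 'u \<Rightarrow> 'x measure"
  cost :: "'x \<times> 'u \<Rightarrow> ennreal"

definition graph :: "('x, 'u) mdp \<Rightarrow> ('x \<times> 'u) set" where
  "graph M = {(x, u). u \<in> actions M x}"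

definition bounded_borel :: "('x::polish_space \<Rightarrow> real) set" where
  "bounded_borel = {f \<in> borel_measurable borel. bounded (range f)}"

definition lsc_bdd_below :: "('x::polish_space \<Rightarrow> real) set" where
  "lsc_bdd_below = {f. (\<forall>a. closed {x. f x \<le> a}) \<and> bdd_below (range f)}"

definition weighted_norm :: "('x \<Rightarrow> real) \<Rightarrow> ('x \<Rightarrow> real) \<Rightarrow> ereal" where
  "weighted_norm f g = (SUP x. ereal (\<bar>g x\<bar> / (1 + \<bar>f x\<bar>)))"

definition big_O :: "('x::polish_space \<Rightarrow> real) \<Rightarrow> ('x \<Rightarrow> real) set" where
  "big_O f = {g \<in> borel_measurable borel. weighted_norm f g < \<infinity>}"

text \<open>
  Integral with values in the extended reals. It is used only for functions that are bounded below,
  under probability measures, so that the negative part has a finite integral.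
\<close>

definition eint :: "'a measure \<Rightarrow> ('a \<Rightarrow> ereal) \<Rightarrow> ereal" where
  "eint N f = enn2ereal (\<integral>\<^sup>+x. e2ennreal (f x) \<partial>N) - enn2ereal (\<integral>\<^sup>+x. e2ennreal (- f x) \<partial>N)"

definition basic_mdp :: "('x::polish_space, 'u::polish_space) mdp \<Rightarrow> bool" where
  "basic_mdp M \<longleftrightarrow>
     (\<forall>x. actions M x \<noteq> {} \<and> actions M x \<in> sets borel) \<and>
     (\<forall>G. open G \<longrightarrow> {x. actions M x \<inter> G \<noteq> {}} \<in> sets borel) \<and>
     ker M \<in> restrict_space borel (graph M) \<rightarrow>\<^sub>M prob_algebra borel \<and>
     cost M \<in> borel_measurable (restrict_space borel (graph M)) \<and>
     (\<forall>p\<in>graph M. 1 \<le> cost M p)"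

definition basic_assumptions :: "('x::polish_space, 'u::polish_space) mdp \<Rightarrow> bool" where
  "basic_assumptions M \<longleftrightarrow>
     (\<forall>f\<in>bounded_borel. continuous_on (graph M) (\<lambda>p. \<integral>y. f y \<partial>ker M p)) \<and>
     (\<forall>F. closed F \<longrightarrow> closed {x. actions M x \<inter> F \<noteq> {}}) \<and>
     (\<forall>x. closed (actions M x)) \<and>
     (\<forall>a. closedin (top_of_set (graph M)) {p \<in> graph M. cost M p \<le> a})"


section \<open>Strategies and the controlled process\<close>

text \<open>
  A history at time \<open>t\<close> consists of the pairs \<open>(x\<^sub>i, u\<^sub>i)\<close>, \<open>i < t\<close>, and of the current state.
\<close>

type_synonym ('x, 'u) strategy = "nat \<Rightarrow> (nat \<Rightarrow> 'x \<times> 'u) \<Rightarrow> 'x \<Rightarrow> 'u measure"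

definition admissible :: "('x::polish_space, 'u::polish_space) mdp \<Rightarrow> ('x, 'u) strategy set" where
  "admissible M = {\<xi>. \<forall>t.
     (\<lambda>(h, x). \<xi> t h x) \<in> (PiM {0..<t} (\<lambda>_. borel)) \<Otimes>\<^sub>M borel \<rightarrow>\<^sub>M prob_algebra borel \<and>
     (\<forall>h\<in>space (PiM {0..<t} (\<lambda>_. borel)). \<forall>x. emeasure (\<xi> t h x) (actions M x) = 1)}"

definition stationary_policies ::
    "('x::polish_space, 'u::polish_space) mdp \<Rightarrow> ('x \<Rightarrow> 'u measure) set" where
  "stationary_policies M =
     {v \<in> borel \<rightarrow>\<^sub>M prob_algebra borel. \<forall>x. emeasure (v x) (actions M x) = 1}"

definition stationary :: "('x \<Rightarrow> 'u measure) \<Rightarrow> ('x, 'u) strategy" where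
  "stationary v = (\<lambda>t h x. v x)"

definition dirac_policy :: "('x \<Rightarrow> 'u::polish_space) \<Rightarrow> 'x \<Rightarrow> 'u measure" where
  "dirac_policy f = (\<lambda>x. return borel (f x))"

text \<open>
  The law on path space (Ionescu-Tulcea) of the process on \<open>S\<close> whose \<open>n\<close>-th coordinate has the
  conditional law \<open>\<kappa> n h\<close> given the restriction \<open>h\<close> of the path to \<open>{0..<n}\<close>.
\<close>

definition path_law :: "(nat \<Rightarrow> (nat \<Rightarrow> 'a) \<Rightarrow> 'a measure) \<Rightarrow> 'a measure \<Rightarrow> (nat \<Rightarrow> 'a) measure" where
  "path_law \<kappa> S = projective_family.lim UNIV (Ionescu_Tulcea.CI \<kappa> (\<lambda>_. S)) (\<lambda>_. S)"

text \<open>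
  The kernel is given on the graph only, whereas the construction of the path law takes total
  kernels. The extension chosen here has no effect, since controlled paths stay in the graph almost
  surely.
\<close>

definition total_ker :: "('x::polish_space, 'u) mdp \<Rightarrow> 'x \<times> 'u \<Rightarrow> 'x measure" where
  "total_ker M p = (if p \<in> graph M then ker M p else return borel (fst p))"

definition step_kernel :: "('x::polish_space, 'u::polish_space) mdp \<Rightarrow> 'x measure \<Rightarrow> ('x, 'u) strategy \<Rightarrow>
    nat \<Rightarrow> (nat \<Rightarrow> 'x \<times> 'u) \<Rightarrow> ('x \<times> 'u) measure" where
  "step_kernel M \<mu> \<xi> n h =
     (case n of 0 \<Rightarrow> \<mu> | Suc m \<Rightarrow> total_ker M (h m)) \<bind> (\<lambda>x. distr (\<xi> n h x) borel (\<lambda>u. (x, u)))"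

definition mdp_law :: "('x::polish_space, 'u::polish_space) mdp \<Rightarrow> 'x measure \<Rightarrow> ('x, 'u) strategy \<Rightarrow>
    (nat \<Rightarrow> 'x \<times> 'u) measure" where
  "mdp_law M \<mu> \<xi> = path_law (step_kernel M \<mu> \<xi>) borel"

definition avg_cost :: "('x::polish_space, 'u::polish_space) mdp \<Rightarrow> 'x measure \<Rightarrow> ('x, 'u) strategy \<Rightarrow>
    ennreal" where
  "avg_cost M \<mu> \<xi> =
     limsup (\<lambda>N. (\<integral>\<^sup>+\<omega>. (\<Sum>n<N. cost M (\<omega> n)) \<partial>mdp_law M \<mu> \<xi>) / of_nat N)"

definition opt_avg_cost :: "('x::polish_space, 'u::polish_space) mdp \<Rightarrow> 'x measure \<Rightarrow> ennreal" where
  "opt_avg_cost M \<mu> = (INF \<xi>\<in>admissible M. avg_cost M \<mu> \<xi>)"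

definition beta :: "('x::polish_space, 'u::polish_space) mdp \<Rightarrow> ennreal" where
  "beta M = (INF \<mu>\<in>space (prob_algebra borel). opt_avg_cost M \<mu>)"

definition optimal :: "('x::polish_space, 'u::polish_space) mdp \<Rightarrow> ('x, 'u) strategy \<Rightarrow> bool" where
  "optimal M \<xi> \<longleftrightarrow> \<xi> \<in> admissible M \<and>
     (\<forall>\<mu>\<in>space (prob_algebra borel). avg_cost M \<mu> \<xi> = opt_avg_cost M \<mu>)"

definition induced_kernel :: "('x::polish_space, 'u::polish_space) mdp \<Rightarrow> ('x \<Rightarrow> 'u measure) \<Rightarrow>
    'x \<Rightarrow> 'x measure" where
  "induced_kernel M v x =
     measure_of UNIV (sets borel) (\<lambda>A. \<integral>\<^sup>+u. emeasure (ker M (x, u)) A \<partial>v x)"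

definition invariant_prob :: "('x::polish_space, 'u::polish_space) mdp \<Rightarrow> ('x \<Rightarrow> 'u measure) \<Rightarrow>
    'x measure \<Rightarrow> bool" where
  "invariant_prob M v \<pi> \<longleftrightarrow> \<pi> \<in> space (prob_algebra borel) \<and>
     (\<forall>A\<in>sets borel. emeasure \<pi> A = (\<integral>\<^sup>+x. emeasure (induced_kernel M v x) A \<partial>\<pi>))"


section \<open>The split chain\<close>

text \<open>The second component of a state of the split chain is \<^const>\<open>False\<close> for 0 and \<^const>\<open>True\<close> for 1.\<close>

definition split_states :: "'x set \<Rightarrow> ('x \<times> bool) set" where
  "split_states B = UNIV \<times> {False} \<union> B \<times> {True}"

definition split_space :: "'x::polish_space set \<Rightarrow> ('x \<times> bool) measure" where
  "split_space B = restrict_space (borel \<Otimes>\<^sub>M count_space UNIV) (split_states B)"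

definition split_measure :: "'x::polish_space set \<Rightarrow> real \<Rightarrow> 'x measure \<Rightarrow> ('x \<times> bool) measure" where
  "split_measure B \<delta> \<mu> = measure_of (split_states B) (sets (split_space B))
     (\<lambda>A. ennreal (1 - \<delta>) * emeasure \<mu> ({x. (x, False) \<in> A} \<inter> B)
        + emeasure \<mu> ({x. (x, False) \<in> A} \<inter> - B)
        + ennreal \<delta> * emeasure \<mu> {x. (x, True) \<in> A})"

text \<open>
  In the second case the subtraction of extended nonnegative reals is not truncated, because of the
  minorization condition.
\<close>

definition split_kernel :: "('x::polish_space, 'u::polish_space) mdp \<Rightarrow> 'x set \<Rightarrow> real \<Rightarrow> 'x measure \<Rightarrow>
    'x \<times> bool \<Rightarrow> 'u \<Rightarrow> ('x \<times> bool) measure" where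
  "split_kernel M B \<delta> \<nu> s u =
     (let x = fst s; P' = split_measure B \<delta> (ker M (x, u)); \<nu>' = split_measure B \<delta> \<nu> in
      if snd s then \<nu>'
      else if x \<in> B then measure_of (split_states B) (sets (split_space B))
        (\<lambda>A. (emeasure P' A - ennreal \<delta> * emeasure \<nu>' A) / ennreal (1 - \<delta>))
      else P')"

definition split_kernel_policy :: "('x::polish_space, 'u::polish_space) mdp \<Rightarrow> 'x set \<Rightarrow> real \<Rightarrow> 'x measure \<Rightarrow>
    ('x \<Rightarrow> 'u measure) \<Rightarrow> 'x \<times> bool \<Rightarrow> ('x \<times> bool) measure" where
  "split_kernel_policy M B \<delta> \<nu> v s = measure_of (split_states B) (sets (split_space B))
     (\<lambda>A. \<integral>\<^sup>+u. emeasure (split_kernel M B \<delta> \<nu> s u) A \<partial>v (fst s))"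

definition split_cost :: "('x, 'u) mdp \<Rightarrow> 'x set \<Rightarrow> real \<Rightarrow> 'x \<times> bool \<Rightarrow> 'u \<Rightarrow> ennreal" where
  "split_cost M B \<delta> s u =
     (if snd s then 0
      else if fst s \<in> B then cost M (fst s, u) / ennreal (1 - \<delta>)
      else cost M (fst s, u))"

definition split_cost_policy :: "('x, 'u) mdp \<Rightarrow> 'x set \<Rightarrow> real \<Rightarrow> ('x \<Rightarrow> 'u measure) \<Rightarrow>
    'x \<times> bool \<Rightarrow> ennreal" where
  "split_cost_policy M B \<delta> v s = (\<integral>\<^sup>+u. split_cost M B \<delta> s u \<partial>v (fst s))"

definition split_law :: "('x::polish_space, 'u::polish_space) mdp \<Rightarrow> 'x set \<Rightarrow> real \<Rightarrow> 'x measure \<Rightarrow>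
    ('x \<Rightarrow> 'u measure) \<Rightarrow> 'x \<times> bool \<Rightarrow> (nat \<Rightarrow> 'x \<times> bool) measure" where
  "split_law M B \<delta> \<nu> v s = path_law
     (\<lambda>n h. case n of 0 \<Rightarrow> return (split_space B) s
                     | Suc m \<Rightarrow> split_kernel_policy M B \<delta> \<nu> v (h m))
     (split_space B)"

definition hit_time :: "'x set \<Rightarrow> (nat \<Rightarrow> 'x \<times> bool) \<Rightarrow> enat" where
  "hit_time B \<omega> = Inf {enat n | n. 1 \<le> n \<and> \<omega> n \<in> B \<times> {True}}"

definition cycle_mean :: "('x::polish_space, 'u::polish_space) mdp \<Rightarrow> 'x set \<Rightarrow> real \<Rightarrow> 'x measure \<Rightarrow>
    ('x \<Rightarrow> 'u measure) \<Rightarrow> 'x \<times> bool \<Rightarrow> ('x \<times> bool \<Rightarrow> ennreal) \<Rightarrow> ennreal" where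
  "cycle_mean M B \<delta> \<nu> v s g =
     (\<integral>\<^sup>+\<omega>. (\<Sum>k. if enat k < hit_time B \<omega> then g (\<omega> k) else 0) \<partial>split_law M B \<delta> \<nu> v s)"

definition c_stable :: "('x::polish_space, 'u::polish_space) mdp \<Rightarrow> 'x set \<Rightarrow> real \<Rightarrow> 'x measure \<Rightarrow>
    ('x \<Rightarrow> 'u measure) \<Rightarrow> bool" where
  "c_stable M B \<delta> \<nu> v \<longleftrightarrow> v \<in> stationary_policies M \<and>
     (\<forall>D. bounded D \<longrightarrow> (\<exists>C::real. \<forall>x\<in>D.
        cycle_mean M B \<delta> \<nu> v (x, False) (split_cost_policy M B \<delta> v) \<le> ennreal C))"

text \<open>
  Subtraction on \<^typ>\<open>ennreal\<close> is truncated, so the two terms are the means of the sums of the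
  positive and of the negative parts of the split cost minus \<^const>\<open>beta\<close>. The second one is finite
  under the standing assumptions: the split cost is below \<^const>\<open>beta\<close> at most on \<open>B\<close>, from where
  the atom is reached in one step with a probability bounded away from 0.
\<close>

definition V_star_split :: "('x::polish_space, 'u::polish_space) mdp \<Rightarrow> 'x set \<Rightarrow> real \<Rightarrow> 'x measure \<Rightarrow>
    'x \<Rightarrow> ereal" where
  "V_star_split M B \<delta> \<nu> x = (INF v\<in>stationary_policies M.
       enn2ereal (cycle_mean M B \<delta> \<nu> v (x, False) (\<lambda>s. split_cost_policy M B \<delta> v s - beta M))
     - enn2ereal (cycle_mean M B \<delta> \<nu> v (x, False) (\<lambda>s. beta M - split_cost_policy M B \<delta> v s)))"

definition V_star :: "('x::polish_space, 'u::polish_space) mdp \<Rightarrow> 'x set \<Rightarrow> real \<Rightarrow> 'x measure \<Rightarrow>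
    'x \<Rightarrow> ereal" where
  "V_star M B \<delta> \<nu> x =
     (if x \<in> B then ereal (1 - \<delta>) * V_star_split M B \<delta> \<nu> x else V_star_split M B \<delta> \<nu> x)"


section \<open>Standing assumptions\<close>

definition A0 :: "('x::polish_space, 'u::polish_space) mdp \<Rightarrow> 'x set \<Rightarrow> real \<Rightarrow> 'x measure \<Rightarrow> bool" where
  "A0 M B \<delta> \<nu> \<longleftrightarrow>
     bounded B \<and> B \<in> sets borel \<and>
     (INF p\<in>{p \<in> graph M. fst p \<notin> B}. cost M p) > beta M \<and>
     \<nu> \<in> space (prob_algebra borel) \<and> emeasure \<nu> B = 1 \<and> \<delta> > 0 \<and>
     (\<forall>A\<in>sets borel. \<forall>(x, u)\<in>graph M.
        emeasure (ker M (x, u)) A \<ge> ennreal \<delta> * emeasure \<nu> A * indicator B x) \<and>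
     (\<forall>v\<in>stationary_policies M. \<forall>x.
        (\<Sum>n. emeasure (mdp_law M (return borel x) (stationary v))
                {\<omega>. fst (\<omega> (Suc n)) \<in> B}) > 0) \<and>
     (INF p\<in>{p \<in> graph M. fst p \<in> B}. emeasure (ker M p) B) > ennreal \<delta>"

definition inf_compact_cost :: "('x::polish_space, 'u::polish_space) mdp \<Rightarrow> bool" where
  "inf_compact_cost M \<longleftrightarrow> (\<forall>\<kappa>::real. compact {p \<in> graph M. cost M p \<le> ennreal \<kappa>})"

definition K_inf_compact_cost :: "('x::polish_space, 'u::polish_space) mdp \<Rightarrow> bool" where
  "K_inf_compact_cost M \<longleftrightarrow> (\<forall>C. compact C \<longrightarrow>
     (\<forall>\<kappa>::real. compact {p \<in> graph M. fst p \<in> C \<and> cost M p \<le> ennreal \<kappa>}))"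

text \<open>
  The embeddings are arguments, because a definition cannot quantify existentially over the types of
  their target spaces; a theorem that assumes the condition for arbitrary \<open>eX\<close> and \<open>eU\<close> covers the
  existential reading. The compact spaces in which the images are dense are the closures of the
  images.
\<close>

definition condC :: "('x::polish_space, 'u::polish_space) mdp \<Rightarrow>
    ('x \<Rightarrow> 'xs::polish_space) \<Rightarrow> ('u \<Rightarrow> 'us::polish_space) \<Rightarrow> bool" where
  "condC M eX eU \<longleftrightarrow>
     embedding_map euclidean euclidean eX \<and> compact (closure (range eX)) \<and>
     embedding_map euclidean euclidean eU \<and> compact (closure (range eU)) \<and>
     embedding_map (top_of_set (graph M)) euclidean (map_prod eX eU) \<and>
     compact (closure (map_prod eX eU ` graph M)) \<and>
     (\<exists>C \<epsilon>. compact C \<and> C \<subseteq> graph M \<and> \<epsilon> > (0::real) \<and>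
        (\<forall>p\<in>graph M - C. cost M p \<ge> beta M + ennreal \<epsilon>))"

definition A1 :: "('x::polish_space, 'u::polish_space) mdp \<Rightarrow>
    ('x \<Rightarrow> 'xs::polish_space) \<Rightarrow> ('u \<Rightarrow> 'us::polish_space) \<Rightarrow> bool" where
  "A1 M eX eU \<longleftrightarrow>
     (\<exists>x. opt_avg_cost M (return borel x) < \<infinity>) \<and> inf_compact_cost M \<or>
     K_inf_compact_cost M \<and> condC M eX eU"

definition A2 :: "('x::polish_space, 'u::polish_space) mdp \<Rightarrow> 'x set \<Rightarrow> real \<Rightarrow> 'x measure \<Rightarrow> bool" where
  "A2 M B \<delta> \<nu> \<longleftrightarrow> (\<exists>v\<in>stationary_policies M. c_stable M B \<delta> \<nu> v)"


section \<open>Optimality equation and relative value iteration\<close>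

definition acoe_rhs :: "('x::polish_space, 'u::polish_space) mdp \<Rightarrow> ('x \<Rightarrow> real) \<Rightarrow> 'x \<Rightarrow> 'u \<Rightarrow> ereal" where
  "acoe_rhs M V x u =
     enn2ereal (cost M (x, u)) - enn2ereal (beta M) + eint (ker M (x, u)) (\<lambda>y. ereal (V y))"

definition solves_acoe :: "('x::polish_space, 'u::polish_space) mdp \<Rightarrow> ('x \<Rightarrow> real) \<Rightarrow> bool" where
  "solves_acoe M V \<longleftrightarrow> (\<forall>x. \<exists>u\<in>actions M x. ereal (V x) = acoe_rhs M V x u \<and>
     (\<forall>u'\<in>actions M x. acoe_rhs M V x u \<le> acoe_rhs M V x u'))"

definition minimizing_selector :: "('x::polish_space, 'u::polish_space) mdp \<Rightarrow> ('x \<Rightarrow> real) \<Rightarrow>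
    ('x \<Rightarrow> 'u) \<Rightarrow> bool" where
  "minimizing_selector M V f \<longleftrightarrow> f \<in> borel \<rightarrow>\<^sub>M borel \<and>
     (\<forall>x. f x \<in> actions M x \<and> (\<forall>u\<in>actions M x. acoe_rhs M V x (f x) \<le> acoe_rhs M V x u))"

definition bellman :: "('x::polish_space, 'u::polish_space) mdp \<Rightarrow> ('x \<Rightarrow> ereal) \<Rightarrow> 'x \<Rightarrow> ereal" where
  "bellman M f x = (INF u\<in>actions M x. enn2ereal (cost M (x, u)) + eint (ker M (x, u)) f)"

text \<open>
  Relative value iteration with normalizing functional \<open>\<rho>\<close>. The iterates are extended real valued
  because the cost, and the integrals of functions that are merely bounded below, may be infinite.
\<close>

primrec rvi :: "('x::polish_space, 'u::polish_space) mdp \<Rightarrow> (('x \<Rightarrow> ereal) \<Rightarrow> ereal) \<Rightarrow>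
    ('x \<Rightarrow> real) \<Rightarrow> nat \<Rightarrow> 'x \<Rightarrow> ereal" where
  "rvi M \<rho> V\<^sub>0 0 = (\<lambda>x. ereal (V\<^sub>0 x))"
| "rvi M \<rho> V\<^sub>0 (Suc n) = (\<lambda>x. bellman M (rvi M \<rho> V\<^sub>0 n) x - \<rho> (rvi M \<rho> V\<^sub>0 n))"

definition V_class :: "('x::polish_space \<Rightarrow> real) \<Rightarrow> 'x measure \<Rightarrow> real \<Rightarrow> ('x \<Rightarrow> real) set" where
  "V_class V \<pi> \<kappa> = {f \<in> lsc_bdd_below \<inter> big_O V.
     (\<forall>x. f x \<ge> V x - \<kappa>) \<and> eint \<pi> (\<lambda>x. ereal (f x)) \<le> ereal (\<kappa> + 1)}"

definition case_a :: "('x::polish_space \<Rightarrow> real) \<Rightarrow> 'x measure \<Rightarrow> ('x \<Rightarrow> real) \<Rightarrow> bool" where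
  "case_a V \<pi> V\<^sub>0 \<longleftrightarrow> eint \<pi> (\<lambda>x. ereal (V x)) < \<infinity> \<and> (\<exists>\<kappa>. V\<^sub>0 \<in> V_class V \<pi> \<kappa>)"

definition case_b :: "('x::polish_space \<Rightarrow> real) \<Rightarrow> 'x measure \<Rightarrow> ('x \<Rightarrow> real) \<Rightarrow> bool" where
  "case_b V \<pi> V\<^sub>0 \<longleftrightarrow> eint \<pi> (\<lambda>x. ereal (V x)) < \<infinity> \<and> bounded (range V) \<and>
     V\<^sub>0 \<in> lsc_bdd_below \<and> bounded (range V\<^sub>0)"

definition case_c :: "('x::polish_space, 'u::polish_space) mdp \<Rightarrow> ('x \<Rightarrow> real) \<Rightarrow> ('x \<Rightarrow> real) \<Rightarrow> bool" where
  "case_c M V V\<^sub>0 \<longleftrightarrow>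
     (\<exists>\<theta>\<^sub>1 \<theta>\<^sub>2. \<theta>\<^sub>1 > 0 \<and>
        (\<forall>x. (INF u\<in>actions M x. enn2ereal (cost M (x, u))) \<ge> ereal (\<theta>\<^sub>1 * V x - \<theta>\<^sub>2))) \<and>
     V\<^sub>0 \<in> lsc_bdd_below \<inter> big_O V"

text \<open>
  Adding a constant to \<open>f\<close> adds it to \<open>\<rho> f\<close> for each of the three normalizing functionals, and a
  fixed point of the iteration is a solution of the optimality equation with \<open>\<rho> f = \<beta>\<close>. The limit
  is therefore the translate of \<^const>\<open>V_star\<close> with this property. It is \<^const>\<open>V_star\<close> itself
  if \<open>\<rho> f = \<nu>(f)\<close>, since \<^const>\<open>V_star\<close> has \<open>\<nu>\<close>-integral \<open>\<beta>\<close>.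
\<close>

definition normalized_at :: "('x::polish_space, 'u::polish_space) mdp \<Rightarrow> (('x \<Rightarrow> ereal) \<Rightarrow> ereal) \<Rightarrow>
    ('x \<Rightarrow> real) \<Rightarrow> 'x \<Rightarrow> ereal" where
  "normalized_at M \<rho> V x = ereal (V x) + (enn2ereal (beta M) - \<rho> (\<lambda>y. ereal (V y)))"

end

theory Submission
  imports Defs
begin

text \<open>
  Up to additive constants all three iterations are the value iteration \<open>F\<^sub>n\<^sub>+\<^sub>1 = S F\<^sub>n - \<beta>\<close>. Replacing a
  kernel \<open>P\<close> by the taboo kernel \<open>T = P - \<delta> 1\<^sub>B \<otimes> \<nu>\<close> expresses cycle costs of the split chain as
  \<open>\<Sum>k. T\<^sup>k (c - \<beta> (1 - \<delta> 1\<^sub>B))\<close>. Comparing these sums, for all policies and for the optimal one, with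
  the iterated optimality equation gives \<open>\<nu>(V) = \<beta>\<close> and \<open>T\<^sup>n V \<rightarrow> 0\<close> along the optimal policy.

  Let \<open>D\<^sub>n = F\<^sub>n - V\<close> and \<open>d\<^sub>n = \<nu>(D\<^sub>n)\<close>. The optimal policy yields \<open>D\<^sub>n\<^sub>+\<^sub>1 \<le> P D\<^sub>n\<close>, hence
  \<open>D\<^sub>n \<le> T\<^sup>n D\<^sub>0 + \<Sum>i<n. T\<^sup>i(\<delta> 1\<^sub>B) d\<^sub>n\<^sub>-\<^sub>1\<^sub>-\<^sub>i\<close>. Integrating with respect to \<open>\<nu>\<close> gives a renewal
  inequality, which already forces \<open>d\<^sub>n\<close> to converge to some \<open>r\<close>, and then
  \<open>limsup D\<^sub>n \<le> r\<close> at every point. In the other direction, if \<open>F\<^sub>n \<ge> (1 - a) V + q\<close> with \<open>a > 0\<close>, then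
  the part \<open>a c\<close> of the running cost which is not needed to reproduce \<open>V\<close> exceeds \<open>a \<beta>\<close> off \<open>B\<close>,
  and on \<open>B\<close> the minorization feeds in \<open>d\<^sub>n\<close>; so \<open>q\<close> grows by a fixed amount in each step until it is
  close to \<open>r\<close>. This makes the lower bound uniform, which is what the normalization by the minimum
  needs. The convergence is pointwise in all three cases.
\<close>

section \<open>Series and the renewal inequality\<close>

text \<open>The comparison behind \<open>\<nu>(V) = \<beta>\<close> would be circular if made at
  once: iterating the optimality inequality leaves a boundary term in \<open>T^n V\<close>, and
  nothing says beforehand that it vanishes. Being an infimum, \<open>V\<close> is at most the cycle
  cost of each policy; this crude bound kills the boundary term whenever that cost is finite, and a
  second iteration gives the bound with a constant determined by \<open>\<nu>(V)\<close>. The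
  infimum and the optimal policy then force the two constants to agree.

  Costs and integrals may be infinite. Hence \<open>V\<close> is shifted by a constant
  \<open>C\<close> to become nonnegative, the positive and negative parts of the cost sit on
  opposite sides, and identities stay in additive form. Signed integrals serve only to compare the
  iterates with \<open>V\<close>.

  No ergodic theorem enters. The renewal argument needs that a cycle can have length one, and
  \<open>\<nu>(B) = 1\<close> makes that probability equal to \<delta>. Apart from the growth of the
  initial function, the three cases enter in two ways: through summability of the \<nu>-integrals of
  \<open>T^k\<close> applied to the shifted \<open>V\<close>, and through a lower bound of the
  iterates by \<open>(1 - a) V\<close> plus a constant, for each \<open>a\<close> in (0,1).\<close>

lemma sums_enn2real:
  fixes f :: "nat \<Rightarrow> ennreal"
  assumes fin: "suminf f < \<infinity>"
  shows "(\<lambda>k. enn2real (f k)) sums enn2real (suminf f)"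
proof -
  have f: "ennreal (enn2real (f k)) = f k" for k
    using ennreal_suminf_lessD[OF fin, of k] by simp
  have "(\<lambda>k. ennreal (enn2real (f k))) sums ennreal (enn2real (suminf f))"
    using fin by (simp add: f summable_sums)
  then show ?thesis by (subst (asm) sums_ennreal) simp_all
qed

lemma ennreal_suminf_tendsto_0:
  fixes f :: "nat \<Rightarrow> ennreal"
  assumes fin: "suminf f < \<infinity>"
  shows "f \<longlonglongrightarrow> 0"
proof -
  have "ennreal (enn2real (f k)) = f k" for k
    using ennreal_suminf_lessD[OF fin, of k] by simp
  then show ?thesis
    using tendsto_ennrealI[OF summable_LIMSEQ_zero[OF sums_summable[OF sums_enn2real[OF fin]]]] by simp
qed

lemma tendsto_suminf_dominated:
  fixes a :: "nat \<Rightarrow> nat \<Rightarrow> real"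
  assumes "\<And>i. (\<lambda>n. a n i) \<longlonglongrightarrow> b i" "\<And>i n. \<bar>a n i\<bar> \<le> m i" "summable m"
  shows "(\<lambda>n. \<Sum>i. a n i) \<longlonglongrightarrow> suminf b"
proof -
  have "\<forall>\<^sub>F (i, n) in at_top \<times>\<^sub>F sequentially. norm (a n i) \<le> m i"
    using assms(2) by (intro always_eventually) auto
  from tannerys_theorem[OF assms(1) this assms(3)] show ?thesis by simp
qed

text \<open>For fixed \<open>i\<close> the argument \<open>n - 1 - i\<close> tends to infinity and
  the terms are dominated by \<open>q i * K\<close>, so dominated convergence for series applies
  after padding with zeros. The index \<open>n - 1 - i\<close> is the time left after a renewal at
  step \<open>i + 1\<close>.\<close>

lemma convolution_tendsto:
  fixes q a :: "nat \<Rightarrow> real"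
  assumes q: "\<And>i. 0 \<le> q i" and sq: "summable q" and a: "a \<longlonglongrightarrow> L"
  shows "(\<lambda>n. \<Sum>i<n. q i * a (n - 1 - i)) \<longlonglongrightarrow> suminf q * L"
proof -
  obtain K where K: "\<And>n. \<bar>a n\<bar> \<le> K"
    using convergent_imp_Bseq[of a] a by (auto simp: convergent_def Bseq_def)
  have "(\<lambda>n. \<Sum>i. (if i < n then q i * a (n - 1 - i) else 0)) \<longlonglongrightarrow> (\<Sum>i. q i * L)"
  proof (rule tendsto_suminf_dominated[of _ _ "\<lambda>i. q i * K"])
    fix i
    have "(\<lambda>n. a (n - 1 - i)) \<longlonglongrightarrow> L"
      using filterlim_compose[OF a filterlim_minus_const_nat_at_top[of "1 + i"]] by simp
    then have "(\<lambda>n. q i * a (n - 1 - i)) \<longlonglongrightarrow> q i * L"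
      by (intro tendsto_intros)
    then show "(\<lambda>n. if i < n then q i * a (n - 1 - i) else 0) \<longlonglongrightarrow> q i * L"
      by (rule Lim_transform_eventually) (rule eventually_mono[OF eventually_gt_at_top[of i]], simp)
  next
    have "0 \<le> K" using K[of 0] by linarith
    then show "\<bar>if i < n then q i * a (n - 1 - i) else 0\<bar> \<le> q i * K" for i n
      using q[of i] K[of "n - 1 - i"] by (auto simp: abs_mult intro!: mult_left_mono)
  qed (use sq in \<open>auto intro: summable_mult2\<close>)
  moreover have "(\<Sum>i. (if i < n then q i * a (n - 1 - i) else 0)) = (\<Sum>i<n. q i * a (n - 1 - i))" for n
    by (subst suminf_finite[of "{..<n}"]) auto
  ultimately show ?thesis
    using suminf_mult2[OF sq, of L] by simp
qed

text \<open>\<open>L\<close> is the upper limit of \<open>d\<close>, expressed by real limits only: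
  it is reached along a subsequence, and convergence of \<open>max (d n) L\<close> to
  \<open>L\<close> says that nothing exceeds it asymptotically.\<close>

lemma bounded_ex_limsup:
  fixes d :: "nat \<Rightarrow> real"
  assumes K: "\<And>n. \<bar>d n\<bar> \<le> K"
  obtains L \<sigma> where "strict_mono \<sigma>" "(\<lambda>k. d (\<sigma> k)) \<longlonglongrightarrow> L" "(\<lambda>n. max (d n) L) \<longlonglongrightarrow> L"
proof -
  obtain r where r: "strict_mono r" "((\<lambda>n. ereal (d n)) \<circ> r) \<longlonglongrightarrow> limsup (\<lambda>n. ereal (d n))"
    using limsup_subseq_lim by blast
  have "limsup (\<lambda>n. ereal (d n)) \<le> limsup (\<lambda>n. ereal K)"
    using K by (intro Limsup_mono always_eventually) (auto simp: abs_le_iff)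
  then have 1: "limsup (\<lambda>n. ereal (d n)) \<le> ereal K" by (simp add: Limsup_const)
  have "ereal (- K) \<le> limsup (\<lambda>n. ereal (d n))"
  proof (rule LIMSEQ_le_const[OF r(2)], intro exI allI impI)
    fix n show "ereal (- K) \<le> ((\<lambda>n. ereal (d n)) \<circ> r) n" using K[of "r n"] by (auto simp: abs_le_iff)
  qed
  with 1 obtain L where L: "limsup (\<lambda>n. ereal (d n)) = ereal L"
    by (cases "limsup (\<lambda>n. ereal (d n))") auto
  have "(\<lambda>k. d (r k)) \<longlonglongrightarrow> L" using r(2) L by (simp add: o_def)
  moreover have "(\<lambda>n. max (d n) L) \<longlonglongrightarrow> L"
  proof (rule LIMSEQ_I)
    fix e :: real assume "0 < e"
    then have "limsup (\<lambda>n. ereal (d n)) < ereal (L + e)" using L by simp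
    then have "\<forall>\<^sub>F n in sequentially. ereal (d n) < ereal (L + e)"
      by (rule Limsup_lessD)
    then obtain n0 where "\<And>n. n \<ge> n0 \<Longrightarrow> d n < L + e" by (auto simp: eventually_sequentially)
    then have "\<forall>n\<ge>n0. norm (max (d n) L - L) < e"
      using \<open>0 < e\<close> by (fastforce simp: max_def)
    then show "\<exists>n0. \<forall>n\<ge>n0. norm (max (d n) L - L) < e" ..
  qed
  ultimately show ?thesis using that r(1) by blast
qed

text \<open>
  A subsequence along which \<open>d\<close> tends to its upper limit drags all its shifts along, since
  \<open>p 0 > 0\<close>. The almost decreasing quantity \<open>\<Sum>i\<le>n. t i * d (n - i)\<close> then forces the lower limit
  up to the upper one.
\<close>

lemma subrenewal_converges:
  fixes d p b t :: "nat \<Rightarrow> real"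
  assumes p: "\<And>i. 0 \<le> p i" "p sums 1" "0 < p 0"
    and t: "t 0 = 1" "\<And>i. t (Suc i) = t i - p i" "\<And>i. 0 \<le> t i" "summable t"
    and b: "\<And>i. 0 \<le> b i" "summable b"
    and K: "\<And>n. \<bar>d n\<bar> \<le> K"
    and d: "\<And>n. d n \<le> b n + (\<Sum>i<n. p i * d (n - 1 - i))"
  shows "convergent d"
proof -
  obtain L \<sigma> where \<sigma>: "strict_mono \<sigma>" "(\<lambda>k. d (\<sigma> k)) \<longlonglongrightarrow> L"
    and m: "(\<lambda>n. max (d n) L) \<longlonglongrightarrow> L"
    by (rule bounded_ex_limsup[OF K])
  \<comment> \<open>The deficit of \<open>d\<close> below its upper limit. It has to be shown to
    vanish, since \<open>max (d n) L\<close> already tends to \<open>L\<close>.\<close>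
  define h where "h n = max (d n) L - d n" for n
  have h0: "0 \<le> h n" for n by (simp add: h_def)
  have absL: "\<bar>L\<bar> \<le> K"
    by (rule LIMSEQ_le_const2[OF tendsto_rabs[OF \<sigma>(2)]]) (use K in auto)
  have hK: "h n \<le> 2 * K" for n
    using K[of n] absL by (auto simp: h_def max_def abs_le_iff)
  have sp: "summable p" "suminf p = 1" using p(2) by (auto simp: sums_iff)
  \<comment> \<open>The error made when \<open>d\<close> is replaced by \<open>max (d n) L\<close>
    throughout the renewal inequality. It vanishes because \<open>b\<close> is summable and the
    weights \<open>p\<close> sum to 1.\<close>
  define \<eta> where "\<eta> n = b n + (\<Sum>i<n. p i * max (d (n - 1 - i)) L) - max (d n) L" for n
  have \<eta>: "\<eta> \<longlonglongrightarrow> 0"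
  proof -
    have "\<eta> \<longlonglongrightarrow> 0 + suminf p * L - L"
      unfolding \<eta>_def
      by (intro tendsto_intros summable_LIMSEQ_zero[OF b(2)] convolution_tendsto[OF p(1) sp(1) m] m)
    then show ?thesis using sp by simp
  qed
  \<comment> \<open>Only the term \<open>i = 0\<close> of the convolution is kept: a small deficit
    at time \<open>n + 1\<close> then makes the deficit at time \<open>n\<close> small.\<close>
  have step: "p 0 * h n \<le> h (Suc n) + \<eta> (Suc n)" for n
  proof -
    have "(\<Sum>i<Suc n. p i * h (n - i)) \<le> h (Suc n) + \<eta> (Suc n)"
      using d[of "Suc n"] by (simp add: h_def \<eta>_def sum_subtractf right_diff_distrib)
    moreover have "p 0 * h n \<le> (\<Sum>i<Suc n. p i * h (n - i))"
      using member_le_sum[of 0 "{..<Suc n}" "\<lambda>i. p i * h (n - i)"] p(1) h0 by simp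
    ultimately show ?thesis by simp
  qed
  have \<sigma>_top: "filterlim \<sigma> at_top sequentially" by (rule filterlim_subseq[OF \<sigma>(1)])
  have hs: "(\<lambda>k. h (\<sigma> k - j)) \<longlonglongrightarrow> 0" for j
  proof (induction j)
    case 0
    have "(\<lambda>k. max (d (\<sigma> k)) L - d (\<sigma> k)) \<longlonglongrightarrow> L - L"
      by (intro tendsto_diff filterlim_compose[OF m \<sigma>_top] \<sigma>(2))
    then show ?case by (simp add: h_def)
  next
    case (Suc j)
    have "filterlim (\<lambda>k. \<sigma> k - j) at_top sequentially"
      by (rule filterlim_compose[OF filterlim_minus_const_nat_at_top \<sigma>_top])
    then have "(\<lambda>k. \<eta> (\<sigma> k - j)) \<longlonglongrightarrow> 0"
      by (rule filterlim_compose[OF \<eta>])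
    then have lim: "(\<lambda>k. (h (\<sigma> k - j) + \<eta> (\<sigma> k - j)) / p 0) \<longlonglongrightarrow> (0 + 0) / p 0"
      using Suc p(3) by (intro tendsto_intros) auto
    have "\<forall>\<^sub>F k in sequentially. j < \<sigma> k"
      by (rule eventually_compose_filterlim[OF eventually_gt_at_top \<sigma>_top])
    then have "\<forall>\<^sub>F k in sequentially. h (\<sigma> k - Suc j) \<le> (h (\<sigma> k - j) + \<eta> (\<sigma> k - j)) / p 0"
    proof eventually_elim
      case (elim k)
      then have "Suc (\<sigma> k - Suc j) = \<sigma> k - j" by simp
      with step[of "\<sigma> k - Suc j"] show ?case using p(3) by (simp add: field_simps)
    qed
    then show ?case
      using tendsto_sandwich[OF _ _ tendsto_const lim] h0 by simp
  qed
  \<comment> \<open>Summable weights \<open>t\<close> allow dominated convergence along \<sigma>,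
    and \<open>t 0 = 1\<close> makes \<open>H n\<close> an upper bound of
    \<open>h n\<close>.\<close>
  define H where "H n = (\<Sum>i<Suc n. t i * h (n - i))" for n
  have Hs: "(\<lambda>k. H (\<sigma> k)) \<longlonglongrightarrow> 0"
  proof -
    have "(\<lambda>k. \<Sum>i. (if i < Suc (\<sigma> k) then t i * h (\<sigma> k - i) else 0)) \<longlonglongrightarrow> (\<Sum>i. 0)"
    proof (rule tendsto_suminf_dominated[of _ _ "\<lambda>i. t i * (2 * K)"])
      fix i
      have "(\<lambda>k. t i * h (\<sigma> k - i)) \<longlonglongrightarrow> 0"
        by (rule tendsto_mult_right_zero) (rule hs)
      moreover have "\<forall>\<^sub>F k in sequentially. i < \<sigma> k"
        by (rule eventually_compose_filterlim[OF eventually_gt_at_top \<sigma>_top])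
      then have "\<forall>\<^sub>F k in sequentially.
          t i * h (\<sigma> k - i) = (if i < Suc (\<sigma> k) then t i * h (\<sigma> k - i) else 0)"
        by (rule eventually_mono) simp
      ultimately show "(\<lambda>k. if i < Suc (\<sigma> k) then t i * h (\<sigma> k - i) else 0) \<longlonglongrightarrow> 0"
        by (rule Lim_transform_eventually)
    next
      have "0 \<le> K" using K[of 0] by linarith
      then show "\<bar>if i < Suc (\<sigma> k) then t i * h (\<sigma> k - i) else 0\<bar> \<le> t i * (2 * K)" for i k
        using t(3)[of i] h0 hK by (auto simp: abs_mult intro!: mult_left_mono)
    qed (use t in \<open>auto intro: summable_mult2\<close>)
    moreover have "(\<Sum>i. (if i < Suc n then t i * h (n - i) else 0)) = H n" for n
      by (subst suminf_finite[of "{..<Suc n}"]) (auto simp: H_def)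
    ultimately show ?thesis by simp
  qed
  \<comment> \<open>Summation by parts: \<open>t (Suc i) = t i - p i\<close> brings in the renewal
    inequality, so \<open>D\<close> grows by at most \<open>b (Suc n)\<close> in a step. Minus the
    partial sums of \<open>b\<close> it is decreasing and bounded, hence convergent.\<close>
  define D where "D n = (\<Sum>i<Suc n. t i * d (n - i))" for n
  have D_step: "D (Suc n) \<le> D n + b (Suc n)" for n
  proof -
    have "D (Suc n) = d (Suc n) + (\<Sum>i<Suc n. t (Suc i) * d (n - i))"
      unfolding D_def by (subst sum.lessThan_Suc_shift) (simp add: t(1))
    also have "\<dots> = d (Suc n) + D n - (\<Sum>i<Suc n. p i * d (n - i))"
      by (simp add: D_def t(2) left_diff_distrib sum_subtractf algebra_simps)
    also have "\<dots> \<le> D n + b (Suc n)" using d[of "Suc n"] by simp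
    finally show ?thesis .
  qed
  have D_bd: "\<bar>D n\<bar> \<le> suminf t * K" for n
  proof -
    have "\<bar>D n\<bar> \<le> (\<Sum>i<Suc n. t i * K)"
      unfolding D_def using t(3) K
      by (intro order.trans[OF sum_abs] sum_mono) (auto simp: abs_mult intro!: mult_left_mono)
    also have "\<dots> = (\<Sum>i<Suc n. t i) * K" by (rule sum_distrib_right[symmetric])
    also have "\<dots> \<le> suminf t * K"
      using K[of 0] t by (intro mult_right_mono sum_le_suminf) auto
    finally show ?thesis .
  qed
  have "\<exists>T. D \<longlonglongrightarrow> T"
  proof -
    define X where "X n = D n - (\<Sum>i<Suc n. b i)" for n
    have "decseq X" unfolding decseq_Suc_iff
    proof
      fix n show "X (Suc n) \<le> X n" using D_step[of n] by (simp add: X_def)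
    qed
    moreover have "- (suminf t * K) - suminf b \<le> X n" for n
      using D_bd[of n] sum_le_suminf[OF b(2), of "{..<Suc n}"] b(1) by (simp add: X_def abs_le_iff)
    ultimately obtain l where "X \<longlonglongrightarrow> l" using decseq_convergent by blast
    moreover have "(\<lambda>n. \<Sum>i<Suc n. b i) \<longlonglongrightarrow> suminf b"
      using b(2) by (intro LIMSEQ_Suc) (rule summable_LIMSEQ)
    ultimately have "(\<lambda>n. X n + (\<Sum>i<Suc n. b i)) \<longlonglongrightarrow> l + suminf b" by (rule tendsto_add)
    then show ?thesis by (auto simp: X_def)
  qed
  then obtain T where T: "D \<longlonglongrightarrow> T" by blast
  have "(\<lambda>n. \<Sum>i<Suc n. t i * max (d (n - i)) L) \<longlonglongrightarrow> suminf t * L"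
    using LIMSEQ_Suc[OF convolution_tendsto[OF t(3,4) m]] by simp
  moreover have "H = (\<lambda>n. (\<Sum>i<Suc n. t i * max (d (n - i)) L) - D n)"
    by (simp only: fun_eq_iff H_def D_def h_def right_diff_distrib sum_subtractf) simp
  ultimately have H_lim: "H \<longlonglongrightarrow> suminf t * L - T"
    by (simp only:) (rule tendsto_diff[OF _ T])
  \<comment> \<open>\<open>H\<close> converges, and its limit is identified along the subsequence
    \<sigma>.\<close>
  from LIMSEQ_unique[OF filterlim_compose[OF H_lim \<sigma>_top] Hs] H_lim have "H \<longlonglongrightarrow> 0" by simp
  moreover have "h n \<le> H n" for n
    using member_le_sum[of 0 "{..<Suc n}" "\<lambda>i. t i * h (n - i)"] t(1,3) h0 by (simp add: H_def)
  ultimately have "h \<longlonglongrightarrow> 0" using tendsto_sandwich[of "\<lambda>_. 0" h sequentially H 0] h0 by simp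
  from tendsto_diff[OF m this] show ?thesis by (auto simp: h_def convergent_def)
qed

section \<open>Killed Markov chains on path space\<close>

text \<open>On an initial segment of the time axis nothing is projected away, so the marginal of the
  path measure is the iterated kernel itself and can be computed by recursion.\<close>

lemma (in Ionescu_Tulcea) CI_lessThan: "CI {0..<n} = C 0 n (\<lambda>_. undefined)"
proof (rule measure_eqI)
  show "sets (CI {0..<n}) = sets (C 0 n (\<lambda>_. undefined))"
    by (simp add: CI_def sets_C)
  fix X assume "X \<in> sets (CI {0..<n})"
  then have X: "X \<in> sets (PiM {0..<n} M)" by (simp add: CI_def)
  then show "emeasure (CI {0..<n}) X = emeasure (C 0 n (\<lambda>_. undefined)) X"
    using sets.sets_into_space[OF X]
    by (subst emeasure_CI[OF subset_refl X]) (simp add: space_PiM prod_emb_id)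
qed

lemma (in Ionescu_Tulcea) nn_integral_lim:
  assumes f: "f \<in> borel_measurable (PiM {0..<n} M)"
  shows "(\<integral>\<^sup>+\<omega>. f (restrict \<omega> {0..<n}) \<partial>PF.lim) = (\<integral>\<^sup>+h. f h \<partial>C 0 n (\<lambda>_. undefined))"
proof -
  have "(\<lambda>\<omega>. restrict \<omega> {0..<n}) \<in> PF.lim \<rightarrow>\<^sub>M PiM {0..<n} M"
    by (subst measurable_cong_sets[OF PF.sets_lim refl]) (rule measurable_restrict_subset, simp)
  then have "(\<integral>\<^sup>+\<omega>. f (restrict \<omega> {0..<n}) \<partial>PF.lim)
      = (\<integral>\<^sup>+h. f h \<partial>distr PF.lim (PiM {0..<n} M) (\<lambda>\<omega>. restrict \<omega> {0..<n}))"
    using f by (subst nn_integral_distr) simp_all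
  then show ?thesis by (simp add: distr_lim CI_lessThan)
qed

context
  fixes S :: "'a measure" and K :: "'a \<Rightarrow> 'a measure" and s :: 'a and D :: "'a set"
  assumes K[measurable]: "K \<in> S \<rightarrow>\<^sub>M subprob_algebra S"
    and prob_K: "\<And>x. x \<in> space S \<Longrightarrow> prob_space (K x)"
    and s: "s \<in> space S" and D[measurable]: "D \<in> sets S"
begin

text \<open>The same case distinction as in \<open>split_law\<close>, so that its path law is the
  one occurring in the cycle means.\<close>

private definition kern :: "nat \<Rightarrow> (nat \<Rightarrow> 'a) \<Rightarrow> 'a measure" where
  "kern n h = (case n of 0 \<Rightarrow> return S s | Suc m \<Rightarrow> K (h m))"

private lemma Ionescu_Tulcea_kern: "Ionescu_Tulcea kern (\<lambda>_. S)"
proof (rule Ionescu_Tulcea.intro)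
  fix n
  show "kern n \<in> PiM {0..<n} (\<lambda>_. S) \<rightarrow>\<^sub>M subprob_algebra S"
  proof (cases n)
    case 0
    then show ?thesis using s by (simp add: kern_def[abs_def] return_measurable[THEN measurable_space])
  next
    case (Suc m)
    then have "(\<lambda>h. K (h m)) \<in> PiM {0..<n} (\<lambda>_. S) \<rightarrow>\<^sub>M subprob_algebra S"
      by (intro measurable_compose[OF _ K] measurable_component_singleton) auto
    then show ?thesis using Suc by (simp add: kern_def[abs_def])
  qed
next
  fix n h
  show "prob_space (kern n h)" if "h \<in> space (PiM {0..<n} (\<lambda>_. S))"
    using that s by (cases n) (auto simp: kern_def space_PiM PiE_iff intro!: prob_space_return prob_K)
qed

interpretation IT: Ionescu_Tulcea kern "\<lambda>_. S" by (rule Ionescu_Tulcea_kern)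

private lemma sets_path_law: "sets (path_law kern S) = sets (PiM UNIV (\<lambda>_. S))"
  unfolding path_law_def by (rule IT.PF.sets_lim)

text \<open>The last coordinate is integrated out, which replaces \<open>g\<close> by its killed
  one-step mean, and the induction hypothesis is applied to that function. The factors start at time
  1, hence the starting point itself may lie outside \<open>D\<close>.\<close>

private lemma nn_integral_kill:
  assumes g: "g \<in> borel_measurable S"
  shows "(\<integral>\<^sup>+h. (\<Prod>i\<in>{1..n}. indicator D (h i)) * g (h n) \<partial>IT.C 0 (Suc n) (\<lambda>_. undefined))
    = ((\<lambda>g x. \<integral>\<^sup>+y. indicator D y * g y \<partial>K x) ^^ n) g s"
  using g
proof (induction n arbitrary: g)
  case 0
  note [measurable] = 0
  have u: "(\<lambda>_. undefined) \<in> space (PiM {0..<0::nat} (\<lambda>_. S))"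
    by (simp add: space_PiM)
  have "(\<integral>\<^sup>+h. g (h 0) \<partial>IT.C 0 (Suc 0) (\<lambda>_. undefined)) = (\<integral>\<^sup>+h. g (h 0) \<partial>IT.eP 0 (\<lambda>_. undefined))"
    using bind_return[OF IT.measurable_eP[of 0] u] by simp
  also have "\<dots> = (\<integral>\<^sup>+y. g y \<partial>return S s)"
    by (subst IT.nn_integral_eP[OF u]) (auto simp: kern_def)
  also have "\<dots> = g s" using s 0 by (simp add: nn_integral_return)
  finally show ?case by simp
next
  case (Suc n)
  note [measurable] = Suc.prems
  have g': "(\<lambda>x. \<integral>\<^sup>+y. indicator D y * g y \<partial>K x) \<in> borel_measurable S"
    by (rule nn_integral_measurable_subprob_algebra2[OF _ K]) simp
  have u: "(\<lambda>_. undefined) \<in> space (PiM {0..<0::nat} (\<lambda>_. S))"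
    by (simp add: space_PiM)
  have meas: "(\<lambda>h. (\<Prod>i\<in>{1..Suc n}. indicator D (h i)) * g (h (Suc n)))
      \<in> borel_measurable (PiM {0..<Suc (Suc n)} (\<lambda>_. S))"
    by measurable
  have "(\<integral>\<^sup>+h. (\<Prod>i\<in>{1..Suc n}. indicator D (h i)) * g (h (Suc n)) \<partial>IT.C 0 (Suc (Suc n)) (\<lambda>_. undefined))
      = (\<integral>\<^sup>+h. \<integral>\<^sup>+h'. (\<Prod>i\<in>{1..Suc n}. indicator D (h' i)) * g (h' (Suc n)) \<partial>IT.eP (Suc n) h
          \<partial>IT.C 0 (Suc n) (\<lambda>_. undefined))"
    by (subst IT.C.simps(2), subst nn_integral_bind[OF meas])
       (simp_all only: add_0 measurable_cong_sets[OF IT.sets_C[OF u] refl] IT.measurable_eP)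
  also have "\<dots> = (\<integral>\<^sup>+h. (\<Prod>i\<in>{1..n}. indicator D (h i)) * (\<integral>\<^sup>+y. indicator D y * g y \<partial>K (h n))
          \<partial>IT.C 0 (Suc n) (\<lambda>_. undefined))"
  proof (rule nn_integral_cong)
    fix h assume "h \<in> space (IT.C 0 (Suc n) (\<lambda>_. undefined))"
    then have h: "h \<in> space (PiM {0..<Suc n} (\<lambda>_. S))" by (simp only: IT.space_C[OF u] add_0)
    then have hn: "h n \<in> space S" by (auto simp: space_PiM)
    have KS: "sets (K (h n)) = sets S" using subprob_measurableD(2)[OF K hn] .
    have "(\<integral>\<^sup>+h'. (\<Prod>i\<in>{1..Suc n}. indicator D (h' i)) * g (h' (Suc n)) \<partial>IT.eP (Suc n) h)
        = (\<integral>\<^sup>+y. (\<Prod>i\<in>{1..n}. indicator D (h i)) * (indicator D y * g y) \<partial>K (h n))"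
      by (subst IT.nn_integral_eP[OF h meas])
         (auto simp: kern_def atLeastAtMostSuc_conv mult_ac intro!: nn_integral_cong)
    also have "\<dots> = (\<Prod>i\<in>{1..n}. indicator D (h i)) * (\<integral>\<^sup>+y. indicator D y * g y \<partial>K (h n))"
      by (subst nn_integral_cmult) (auto simp: measurable_cong_sets[OF KS refl])
    finally show "(\<integral>\<^sup>+h'. (\<Prod>i\<in>{1..Suc n}. indicator D (h' i)) * g (h' (Suc n)) \<partial>IT.eP (Suc n) h)
        = (\<Prod>i\<in>{1..n}. indicator D (h i)) * (\<integral>\<^sup>+y. indicator D y * g y \<partial>K (h n))" .
  qed
  also have "\<dots> = ((\<lambda>g x. \<integral>\<^sup>+y. indicator D y * g y \<partial>K x) ^^ n)
      (\<lambda>x. \<integral>\<^sup>+y. indicator D y * g y \<partial>K x) s"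
    by (rule Suc.IH[OF g'])
  also have "\<dots> = ((\<lambda>g x. \<integral>\<^sup>+y. indicator D y * g y \<partial>K x) ^^ Suc n) g s"
    by (simp only: funpow_Suc_right o_apply)
  finally show ?case .
qed

text \<open>Survival up to time \<open>k\<close> is a product of indicators, so each term of the
  series depends on finitely many coordinates and reduces to an iterate of the killed
  kernel.\<close>

lemma nn_integral_path_law_killed:
  assumes g: "g \<in> borel_measurable S" and A: "space S - A = D"
  shows "(\<integral>\<^sup>+\<omega>. (\<Sum>k. if \<forall>i\<in>{1..k}. \<omega> i \<notin> A then g (\<omega> k) else 0)
        \<partial>path_law (\<lambda>n h. case n of 0 \<Rightarrow> return S s | Suc m \<Rightarrow> K (h m)) S)
    = (\<Sum>k. ((\<lambda>g x. \<integral>\<^sup>+y. indicator D y * g y \<partial>K x) ^^ k) g s)"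
proof -
  note [measurable] = g
  have eq: "(if \<forall>i\<in>{1..k}. \<omega> i \<notin> A then g (\<omega> k) else 0) = (\<Prod>i\<in>{1..k}. indicator D (\<omega> i)) * g (\<omega> k)"
    if "\<omega> \<in> space (path_law kern S)" for \<omega> :: "nat \<Rightarrow> 'a" and k
  proof -
    have "\<omega> i \<in> space S" for i
      using that sets_eq_imp_space_eq[OF sets_path_law] by (auto simp: space_PiM)
    then have "(\<forall>i\<in>{1..k}. \<omega> i \<notin> A) \<longleftrightarrow> (\<forall>i\<in>{1..k}. \<omega> i \<in> D)" using A by auto
    moreover have "(if \<forall>i\<in>{1..k}. \<omega> i \<in> D then g (\<omega> k) else 0) = (\<Prod>i\<in>{1..k}. indicator D (\<omega> i)) * g (\<omega> k)"
  proof (cases "\<forall>i\<in>{1..k}. \<omega> i \<in> D")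
    case False
    then have "(\<Prod>i\<in>{1..k}. indicator D (\<omega> i) :: ennreal) = 0"
      by (intro prod_zero[OF finite_atLeastAtMost]) (auto simp: indicator_def)
    with False show ?thesis by simp
  qed auto
    ultimately show ?thesis by (simp only:)
  qed
  have "(\<integral>\<^sup>+\<omega>. (\<Sum>k. if \<forall>i\<in>{1..k}. \<omega> i \<notin> A then g (\<omega> k) else 0) \<partial>path_law kern S)
      = (\<integral>\<^sup>+\<omega>. (\<Sum>k. (\<Prod>i\<in>{1..k}. indicator D (\<omega> i)) * g (\<omega> k)) \<partial>path_law kern S)"
    by (rule nn_integral_cong) (simp only: eq)
  also have "\<dots> = (\<Sum>k. \<integral>\<^sup>+\<omega>. (\<Prod>i\<in>{1..k}. indicator D (\<omega> i)) * g (\<omega> k) \<partial>path_law kern S)"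
    by (rule nn_integral_suminf) (subst measurable_cong_sets[OF sets_path_law refl], measurable)
  also have "\<dots> = (\<Sum>k. ((\<lambda>g x. \<integral>\<^sup>+y. indicator D y * g y \<partial>K x) ^^ k) g s)"
  proof (rule arg_cong[where f=suminf], rule ext)
    fix k
    have "(\<integral>\<^sup>+\<omega>. (\<Prod>i\<in>{1..k}. indicator D (\<omega> i)) * g (\<omega> k) \<partial>path_law kern S)
        = (\<integral>\<^sup>+\<omega>. (\<lambda>h. (\<Prod>i\<in>{1..k}. indicator D (h i)) * g (h k)) (restrict \<omega> {0..<Suc k}) \<partial>path_law kern S)"
      by (intro nn_integral_cong arg_cong2[where f=times] prod.cong) auto
    also have "\<dots> = (\<integral>\<^sup>+h. (\<Prod>i\<in>{1..k}. indicator D (h i)) * g (h k) \<partial>IT.C 0 (Suc k) (\<lambda>_. undefined))"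
      unfolding path_law_def by (rule IT.nn_integral_lim) measurable
    finally show "(\<integral>\<^sup>+\<omega>. (\<Prod>i\<in>{1..k}. indicator D (\<omega> i)) * g (\<omega> k) \<partial>path_law kern S)
        = ((\<lambda>g x. \<integral>\<^sup>+y. indicator D y * g y \<partial>K x) ^^ k) g s"
      by (simp only: nn_integral_kill[OF g])
  qed
  finally show ?thesis unfolding kern_def[abs_def] .
qed

end

section \<open>The taboo kernel\<close>

lemma ennreal_affine_finite: "s < \<infinity> \<Longrightarrow> ennreal a * s + ennreal b < \<infinity>"
  by (cases s) (simp_all add: ennreal_mult_less_top)

text \<open>Used for the chain of a stationary policy and also, with a constant kernel, for a single
  state-action pair.\<close>

locale taboo_kernel =
  fixes P :: "'x::polish_space \<Rightarrow> 'x measure" and B :: "'x set" and \<delta> :: real and \<nu> :: "'x measure"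
  assumes P: "P \<in> borel \<rightarrow>\<^sub>M prob_algebra borel"
    and B[measurable]: "B \<in> sets borel"
    and \<nu>: "\<nu> \<in> space (prob_algebra borel)" "emeasure \<nu> B = 1"
    and \<delta>: "0 < \<delta>" "\<delta> < 1"
    and minorization: "\<And>x A. x \<in> B \<Longrightarrow> A \<in> sets borel \<Longrightarrow> ennreal \<delta> * emeasure \<nu> A \<le> emeasure (P x) A"
begin

lemma prob_P: "prob_space (P x)" and sets_P[measurable_cong, simp]: "sets (P x) = sets borel"
  using measurable_space[OF P, of x] by (auto simp: space_prob_algebra)

lemma space_P[simp]: "space (P x) = UNIV"
  using sets_eq_imp_space_eq[OF sets_P[of x]] by simp

lemma prob_\<nu>: "prob_space \<nu>" and sets_\<nu>[measurable_cong, simp]: "sets \<nu> = sets borel"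
  using \<nu>(1) by (auto simp: space_prob_algebra)

lemma space_\<nu>[simp]: "space \<nu> = UNIV"
  using sets_eq_imp_space_eq[OF sets_\<nu>] by simp

lemma P_measurable[measurable]: "P \<in> borel \<rightarrow>\<^sub>M subprob_algebra borel"
  using P by (rule measurable_prob_algebraD)

definition regen :: "'x \<Rightarrow> ennreal" where
  "regen x = ennreal \<delta> * indicator B x"

text \<open>The chain killed at regeneration: the mass \<delta> that the minorization hands to \<nu>
  is removed on \<open>B\<close>, and nothing elsewhere.\<close>

definition taboo :: "'x \<Rightarrow> 'x measure" where
  "taboo x = diff_measure (P x) (scale_measure (regen x) \<nu>)"

lemma regen_measurable[measurable]: "regen \<in> borel_measurable borel"
  unfolding regen_def by measurable

lemma regen_le_1: "regen x \<le> 1"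
  using \<delta> by (auto simp: regen_def indicator_def)

lemma sets_taboo[measurable_cong, simp]: "sets (taboo x) = sets borel"
  by (simp add: taboo_def)

lemma space_taboo[simp]: "space (taboo x) = UNIV"
  by (simp add: taboo_def)

lemma emeasure_taboo:
  assumes A: "A \<in> sets borel"
  shows "emeasure (taboo x) A = emeasure (P x) A - regen x * emeasure \<nu> A"
proof -
  interpret P: prob_space "P x" by (rule prob_P)
  interpret N: prob_space \<nu> by (rule prob_\<nu>)
  have "finite_measure (scale_measure (regen x) \<nu>)"
    using regen_le_1[of x]
    by (intro finite_measureI) (auto simp: ennreal_mult_eq_top_iff N.emeasure_space_1[simplified] top_unique)
  moreover have "regen x * emeasure \<nu> A \<le> emeasure (P x) A" if "A \<in> sets borel" for A
    using minorization[OF _ that, of x] by (cases "x \<in> B") (auto simp: regen_def)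
  ultimately show ?thesis
    unfolding taboo_def using A
    by (subst emeasure_diff_measure) (auto simp: P.finite_measure_axioms)
qed

lemma emeasure_P_taboo:
  assumes A: "A \<in> sets borel"
  shows "emeasure (P x) A = emeasure (taboo x) A + regen x * emeasure \<nu> A"
proof -
  interpret N: prob_space \<nu> by (rule prob_\<nu>)
  have "regen x * emeasure \<nu> A \<le> emeasure (P x) A"
    using minorization[OF _ A, of x] by (cases "x \<in> B") (auto simp: regen_def)
  moreover have "regen x * emeasure \<nu> A < \<top>"
    using regen_le_1[of x] by (intro ennreal_mult_less_top[THEN iffD2] disjI2 conjI)
      (auto simp: N.emeasure_finite less_top[symmetric] top_unique)
  ultimately show ?thesis
    by (simp add: emeasure_taboo[OF A] diff_add_cancel_ennreal)
qed

lemma subprob_taboo: "subprob_space (taboo x)"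
proof
  interpret P: prob_space "P x" by (rule prob_P)
  show "emeasure (taboo x) (space (taboo x)) \<le> 1"
    using P.emeasure_space_1 by (simp add: emeasure_taboo diff_le_self_ennreal)
qed simp

lemma taboo_measurable[measurable]: "taboo \<in> borel \<rightarrow>\<^sub>M subprob_algebra borel"
proof (rule measurable_subprob_algebra)
  fix A :: "'x set" assume [measurable]: "A \<in> sets borel"
  have "(\<lambda>x. emeasure (P x) A - regen x * emeasure \<nu> A) \<in> borel_measurable borel"
    by (intro borel_measurable_minus_ennreal measurable_emeasure_kernel[OF P_measurable] borel_measurable_times_ennreal) auto
  then show "(\<lambda>x. emeasure (taboo x) A) \<in> borel_measurable borel"
    by (simp add: emeasure_taboo)
qed (auto simp: subprob_taboo)

text \<open>Stated additively and proved by induction on \<open>f\<close>, because integrals against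
  the two parts of a difference of measures cannot be subtracted once they are infinite.\<close>

lemma nn_integral_P:
  assumes f: "f \<in> borel_measurable borel"
  shows "(\<integral>\<^sup>+y. f y \<partial>P x) = (\<integral>\<^sup>+y. f y \<partial>taboo x) + regen x * (\<integral>\<^sup>+y. f y \<partial>\<nu>)"
  using f
proof (induction rule: borel_measurable_induct)
  case (cong f g)
  then show ?case by (simp cong: nn_integral_cong)
next
  case (set A)
  then show ?case by (simp add: emeasure_P_taboo)
next
  case (mult u c)
  note [measurable] = mult(2)
  show ?case by (simp add: nn_integral_cmult mult(4) distrib_left mult_ac)
next
  case (add u v)
  note [measurable] = add(1,3)
  show ?case by (simp add: nn_integral_add add distrib_left add_ac)
next
  case (seq U)
  note [measurable] = seq(1)
  have mc: "(\<integral>\<^sup>+y. (SUP i. U i) y \<partial>M) = (SUP i. \<integral>\<^sup>+y. U i y \<partial>M)" if "sets M = sets borel" for M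
    using seq that by (simp add: SUP_apply image_comp nn_integral_monotone_convergence_SUP measurable_cong_sets[OF that refl])
  have inc: "incseq (\<lambda>i. \<integral>\<^sup>+y. U i y \<partial>M)" for M :: "'x measure"
    using \<open>incseq U\<close> by (auto simp: incseq_def le_fun_def intro!: nn_integral_mono)
  have inc': "incseq (\<lambda>i. regen x * (\<integral>\<^sup>+y. U i y \<partial>\<nu>))"
    using inc[of \<nu>] by (auto simp: incseq_def intro!: mult_left_mono)
  show ?case
    by (simp only: mc sets_P sets_taboo sets_\<nu> SUP_mult_left_ennreal
        ennreal_SUP_add[OF inc inc', symmetric]) (intro SUP_cong refl seq.IH)
qed

definition T :: "('x \<Rightarrow> ennreal) \<Rightarrow> 'x \<Rightarrow> ennreal" where
  "T f x = (\<integral>\<^sup>+y. f y \<partial>taboo x)"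

lemma T_measurable: "f \<in> borel_measurable borel \<Longrightarrow> T f \<in> borel_measurable borel"
  unfolding T_def by (rule nn_integral_measurable_subprob_algebra2[OF _ taboo_measurable]) simp

lemma Tn_measurable[measurable (raw)]: "f \<in> borel_measurable borel \<Longrightarrow> (T ^^ n) f \<in> borel_measurable borel"
  by (induction n) (auto intro: T_measurable)

lemma Tn_measurable'[measurable (raw)]:
  "f \<in> borel_measurable borel \<Longrightarrow> (\<lambda>x. (T ^^ n) f x) \<in> borel_measurable borel"
  by (rule Tn_measurable)

lemma nn_integral_P_T:
  "f \<in> borel_measurable borel \<Longrightarrow> (\<integral>\<^sup>+y. f y \<partial>P x) = T f x + regen x * (\<integral>\<^sup>+y. f y \<partial>\<nu>)"
  unfolding T_def by (rule nn_integral_P)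

lemma T_1: "T (\<lambda>_. 1) x + regen x = 1"
  using nn_integral_P_T[of "\<lambda>_. 1" x] prob_space.emeasure_space_1[OF prob_P, of x]
    prob_space.emeasure_space_1[OF prob_\<nu>] by simp

lemma T_mono: "(\<And>y. f y \<le> g y) \<Longrightarrow> T f x \<le> T g x"
  unfolding T_def by (rule nn_integral_mono) simp

lemma Tn_mono: "(\<And>y. f y \<le> g y) \<Longrightarrow> (T ^^ n) f x \<le> (T ^^ n) g x"
  by (induction n arbitrary: x) (auto intro: T_mono)

lemma Tn_add:
  assumes [measurable]: "f \<in> borel_measurable borel" "g \<in> borel_measurable borel"
  shows "(T ^^ n) (\<lambda>x. f x + g x) = (\<lambda>x. (T ^^ n) f x + (T ^^ n) g x)"
proof (induction n)
  case (Suc n)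
  have "T (\<lambda>x. (T ^^ n) f x + (T ^^ n) g x) x = T ((T ^^ n) f) x + T ((T ^^ n) g) x" for x
    unfolding T_def[of _ x] by (rule nn_integral_add) auto
  then show ?case by (intro ext) (simp add: Suc)
qed simp

lemma Tn_cmult:
  assumes [measurable]: "f \<in> borel_measurable borel"
  shows "(T ^^ n) (\<lambda>x. a * f x) = (\<lambda>x. a * (T ^^ n) f x)"
proof (induction n)
  case (Suc n)
  have "T (\<lambda>x. a * (T ^^ n) f x) x = a * T ((T ^^ n) f) x" for x
    unfolding T_def[of _ x] by (rule nn_integral_cmult) auto
  then show ?case by (intro ext) (simp add: Suc)
qed simp

lemma Tn_suminf:
  assumes [measurable]: "\<And>k. f k \<in> borel_measurable borel"
  shows "(T ^^ n) (\<lambda>x. \<Sum>k. f k x) = (\<lambda>x. \<Sum>k. (T ^^ n) (f k) x)"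
proof (induction n)
  case (Suc n)
  have "T (\<lambda>x. \<Sum>k. (T ^^ n) (f k) x) x = (\<Sum>k. T ((T ^^ n) (f k)) x)" for x
    unfolding T_def[of _ x] by (rule nn_integral_suminf) auto
  then show ?case by (intro ext) (simp add: Suc)
qed simp

lemma Tn_Suc: "(T ^^ Suc n) f = (T ^^ n) (T f)"
  by (simp add: funpow_swap1)

text \<open>The Poisson equation of the killed chain, iterated. No term changes sides, so infinite
  values do no harm; \<open>a\<close> and \<open>b\<close> are meant as the negative and the
  positive part of one signed cost.\<close>

lemma iterate_eq:
  assumes [measurable]: "f \<in> borel_measurable borel" "a \<in> borel_measurable borel" "b \<in> borel_measurable borel"
    and eq: "\<And>x. f x + a x = b x + T f x"
  shows "f x + (\<Sum>k<n. (T ^^ k) a x) = (\<Sum>k<n. (T ^^ k) b x) + (T ^^ n) f x"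
proof (induction n)
  case (Suc n)
  have Tf: "T f \<in> borel_measurable borel" by (rule T_measurable) simp
  have "(T ^^ n) f x + (T ^^ n) a x = (T ^^ n) (\<lambda>x. f x + a x) x"
    by (simp add: Tn_add)
  also have "(\<lambda>x. f x + a x) = (\<lambda>x. b x + T f x)" using eq by auto
  also have "(T ^^ n) (\<lambda>x. b x + T f x) x = (T ^^ n) b x + (T ^^ Suc n) f x"
    using Tf by (simp only: Tn_add assms(3) Tn_Suc)
  finally have *: "(T ^^ n) f x + (T ^^ n) a x = (T ^^ n) b x + (T ^^ Suc n) f x" .
  have "f x + (\<Sum>k<Suc n. (T ^^ k) a x) = (\<Sum>k<n. (T ^^ k) b x) + ((T ^^ n) f x + (T ^^ n) a x)"
    using Suc by (simp add: add_ac)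
  then show ?case unfolding * by (simp add: add_ac)
qed simp

lemma iterate_le:
  assumes [measurable]: "f \<in> borel_measurable borel" "a \<in> borel_measurable borel" "b \<in> borel_measurable borel"
    and le: "\<And>x. f x + a x \<le> b x + T f x"
  shows "f x + (\<Sum>k<n. (T ^^ k) a x) \<le> (\<Sum>k<n. (T ^^ k) b x) + (T ^^ n) f x"
proof (induction n)
  case (Suc n)
  have Tf: "T f \<in> borel_measurable borel" by (rule T_measurable) simp
  have "(T ^^ n) f x + (T ^^ n) a x = (T ^^ n) (\<lambda>x. f x + a x) x"
    by (simp add: Tn_add)
  also have "\<dots> \<le> (T ^^ n) (\<lambda>x. b x + T f x) x" using le by (rule Tn_mono)
  also have "\<dots> = (T ^^ n) b x + (T ^^ Suc n) f x"
    using Tf by (simp only: Tn_add assms(3) Tn_Suc)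
  finally have *: "(T ^^ n) f x + (T ^^ n) a x \<le> (T ^^ n) b x + (T ^^ Suc n) f x" .
  have "f x + (\<Sum>k<Suc n. (T ^^ k) a x) = (f x + (\<Sum>k<n. (T ^^ k) a x)) + (T ^^ n) a x"
    by (simp add: add_ac)
  also have "\<dots> \<le> (\<Sum>k<n. (T ^^ k) b x) + ((T ^^ n) f x + (T ^^ n) a x)"
    using add_right_mono[OF Suc] by (simp add: add_ac)
  also have "\<dots> \<le> (\<Sum>k<n. (T ^^ k) b x) + ((T ^^ n) b x + (T ^^ Suc n) f x)"
    using * by (rule add_left_mono)
  finally show ?case by (simp add: add_ac)
qed simp

text \<open>\<open>(T ^^ k) regen x\<close> is the probability that the first regeneration happens
  at step \<open>k + 1\<close>, and \<open>(T ^^ n) (\<lambda>_. 1) x\<close> that of none within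
  \<open>n\<close> steps.\<close>

lemma regen_sum: "(\<Sum>k<n. (T ^^ k) regen x) + (T ^^ n) (\<lambda>_. 1) x = 1"
  using iterate_eq[of "\<lambda>_. 1" "\<lambda>_. 0" regen x n] T_1 Tn_cmult[of "\<lambda>_. 0" _ 0]
  by (simp add: add.commute)

lemma regen_suminf_le: "(\<Sum>k. (T ^^ k) regen x) \<le> 1"
proof (rule suminf_le_const)
  fix n show "(\<Sum>k<n. (T ^^ k) regen x) \<le> 1"
    using regen_sum[of x n] by (metis le_iff_add)
qed simp

lemma regen_suminf_eq:
  assumes "(\<lambda>n. (T ^^ n) (\<lambda>_. 1) x) \<longlonglongrightarrow> 0"
  shows "(\<Sum>k. (T ^^ k) regen x) = 1"
proof -
  have "(\<lambda>n. (\<Sum>k<n. (T ^^ k) regen x) + (T ^^ n) (\<lambda>_. 1) x) \<longlonglongrightarrow> (\<Sum>k. (T ^^ k) regen x) + 0"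
    by (intro tendsto_add summable_LIMSEQ assms) simp
  then show ?thesis by (simp add: regen_sum LIMSEQ_const_iff)
qed

lemma suminf_Tn_cmult_regen: "(\<Sum>k. (T ^^ k) (\<lambda>x. a * regen x) x) \<le> a"
  using mult_left_mono[OF regen_suminf_le[of x], of a] by (simp add: Tn_cmult)

text \<open>Applying \<open>T ^^ n\<close> to a potential shifts its series by \<open>n\<close>,
  which leaves the tail of a convergent series.\<close>

lemma Tn_suminf_tail:
  assumes [measurable]: "f \<in> borel_measurable borel" and fin: "(\<Sum>k. (T ^^ k) f x) < \<infinity>"
  shows "(\<lambda>n. (T ^^ n) (\<lambda>x. \<Sum>k. (T ^^ k) f x) x) \<longlonglongrightarrow> 0"
proof -
  have eq: "(\<Sum>k. (T ^^ k) f x) = (\<Sum>k<n. (T ^^ k) f x) + (T ^^ n) (\<lambda>x. \<Sum>k. (T ^^ k) f x) x" for n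
  proof -
    have "(T ^^ n) (\<lambda>x. \<Sum>k. (T ^^ k) f x) x = (\<Sum>k. (T ^^ (k + n)) f x)"
      by (simp add: Tn_suminf funpow_add add.commute[of _ n])
    then show ?thesis
      using suminf_offset[of "\<lambda>k. (T ^^ k) f x" n] by (simp add: add.commute)
  qed
  have "(T ^^ n) (\<lambda>x. \<Sum>k. (T ^^ k) f x) x = (\<Sum>k. (T ^^ k) f x) - (\<Sum>k<n. (T ^^ k) f x)" for n
  proof -
    have "(\<Sum>k<n. (T ^^ k) f x) \<le> (\<Sum>k. (T ^^ k) f x)" by (rule sum_le_suminf) auto
    from le_less_trans[OF this fin] have "(\<Sum>k<n. (T ^^ k) f x) \<noteq> \<top>"
      by (simp only: less_top infinity_ennreal_def)
    with eq[of n] show ?thesis by (metis ennreal_add_diff_cancel_left)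
  qed
  moreover have "(\<lambda>n. (\<Sum>k. (T ^^ k) f x) - (\<Sum>k<n. (T ^^ k) f x))
      \<longlonglongrightarrow> (\<Sum>k. (T ^^ k) f x) - (\<Sum>k. (T ^^ k) f x)"
    using fin by (intro tendsto_diff_ennreal tendsto_const summable_LIMSEQ) auto
  ultimately show ?thesis using fin by (simp add: ennreal_minus_cancel_iff diff_eq_0_iff_ennreal)
qed

text \<open>
  Below, \<open>a\<close> and \<open>b\<close> stand for the negative and the positive part of the cost
  relative to the optimal value, and \<open>f\<close> for a relative value function made nonnegative by adding a
  constant. The constant \<open>\<kappa>\<close> records the value at the atom of the split chain.
\<close>

lemma value_le_cycle_cost:
  assumes [measurable]: "f \<in> borel_measurable borel" "a \<in> borel_measurable borel" "b \<in> borel_measurable borel"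
    and le: "\<And>x. f x + a x \<le> b x + \<kappa> * regen x + T f x"
    and f0: "(\<lambda>n. (T ^^ n) f x) \<longlonglongrightarrow> 0"
  shows "f x + (\<Sum>k. (T ^^ k) a x) \<le> (\<Sum>k. (T ^^ k) b x) + \<kappa>"
proof -
  have bk: "f x + (\<Sum>k<n. (T ^^ k) a x) \<le> (\<Sum>k. (T ^^ k) b x) + \<kappa> + (T ^^ n) f x" for n
  proof -
    have "f x + (\<Sum>k<n. (T ^^ k) a x) \<le> (\<Sum>k<n. (T ^^ k) (\<lambda>x. b x + \<kappa> * regen x) x) + (T ^^ n) f x"
      by (rule iterate_le) (use le in auto)
    also have "(\<Sum>k<n. (T ^^ k) (\<lambda>x. b x + \<kappa> * regen x) x)
        = (\<Sum>k<n. (T ^^ k) b x) + \<kappa> * (\<Sum>k<n. (T ^^ k) regen x)"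
      by (simp add: Tn_add Tn_cmult sum.distrib sum_distrib_left)
    \<comment> \<open>A cycle ends with its first regeneration, so \<kappa> is charged at most
      once.\<close>
    also have "\<dots> \<le> (\<Sum>k. (T ^^ k) b x) + \<kappa> * 1"
      by (intro add_mono mult_left_mono sum_le_suminf order.trans[OF sum_le_suminf regen_suminf_le]) auto
    finally show ?thesis by (simp add: add_right_mono)
  qed
  have "(\<lambda>n. f x + (\<Sum>k<n. (T ^^ k) a x)) \<longlonglongrightarrow> f x + (\<Sum>k. (T ^^ k) a x)"
    by (intro tendsto_add tendsto_const summable_LIMSEQ) simp
  moreover have "(\<lambda>n. (\<Sum>k. (T ^^ k) b x) + \<kappa> + (T ^^ n) f x) \<longlonglongrightarrow> (\<Sum>k. (T ^^ k) b x) + \<kappa> + 0"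
    by (intro tendsto_add tendsto_const f0)
  ultimately show ?thesis
    using bk by (auto intro: LIMSEQ_le)
qed

text \<open>Off \<open>B\<close> each step is paid for by the cost \<epsilon>; on \<open>B\<close>
  it is paid for by the regeneration probability, whose sum over a cycle is at most 1. A finite
  cycle cost thus implies a finite mean cycle length.\<close>

lemma cycle_length_finite:
  assumes [measurable]: "b \<in> borel_measurable borel"
    and \<epsilon>: "0 < \<epsilon>" "\<And>x. x \<notin> B \<Longrightarrow> ennreal \<epsilon> \<le> b x"
  shows "(\<Sum>k. (T ^^ k) (\<lambda>_. 1) x) \<le> ennreal (1 / \<epsilon>) * (\<Sum>k. (T ^^ k) b x) + ennreal (1 / \<delta>)"
proof -
  have "1 \<le> b y * ennreal (1 / \<epsilon>) + ennreal (1 / \<delta>) * regen y" for y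
  proof (cases "y \<in> B")
    case True
    then have "ennreal (1 / \<delta>) * regen y = 1"
      using \<delta> by (simp add: regen_def ennreal_mult[symmetric])
    then show ?thesis by simp
  next
    case False
    have "1 = ennreal \<epsilon> * ennreal (1 / \<epsilon>)"
      using \<epsilon>(1) by (simp add: ennreal_mult[symmetric])
    also have "\<dots> \<le> b y * ennreal (1 / \<epsilon>)" using \<epsilon>(2)[OF False] by (rule mult_right_mono) simp
    finally show ?thesis by (simp add: add_increasing2)
  qed
  then have "(T ^^ k) (\<lambda>_. 1) x \<le> (T ^^ k) (\<lambda>y. ennreal (1 / \<epsilon>) * b y + ennreal (1 / \<delta>) * regen y) x" for k
    by (intro Tn_mono) (simp add: mult.commute)
  then have "(\<Sum>k. (T ^^ k) (\<lambda>_. 1) x) \<le> (\<Sum>k. (T ^^ k) (\<lambda>y. ennreal (1 / \<epsilon>) * b y + ennreal (1 / \<delta>) * regen y) x)"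
    by (intro suminf_le) auto
  also have "\<dots> = ennreal (1 / \<epsilon>) * (\<Sum>k. (T ^^ k) b x) + (\<Sum>k. (T ^^ k) (\<lambda>y. ennreal (1 / \<delta>) * regen y) x)"
    by (simp add: Tn_add Tn_cmult[of b] suminf_add[symmetric])
  also have "\<dots> \<le> ennreal (1 / \<epsilon>) * (\<Sum>k. (T ^^ k) b x) + ennreal (1 / \<delta>)"
    by (intro add_left_mono suminf_Tn_cmult_regen)
  finally show ?thesis .
qed

text \<open>The bounding function is a potential plus a constant: the first vanishes as a series
  tail, the second because the mean cycle length is finite.\<close>

lemma Tn_tendsto_0_of_cycle_cost:
  assumes [measurable]: "f \<in> borel_measurable borel" "b \<in> borel_measurable borel"
    and \<epsilon>: "0 < \<epsilon>" "\<And>x. x \<notin> B \<Longrightarrow> ennreal \<epsilon> \<le> b x"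
    and fin: "(\<Sum>k. (T ^^ k) b x) < \<infinity>"
    and le: "\<And>x. f x \<le> (\<Sum>k. (T ^^ k) b x) + ennreal C"
  shows "(\<lambda>n. (T ^^ n) f x) \<longlonglongrightarrow> 0"
proof -
  have "(\<Sum>k. (T ^^ k) (\<lambda>_. 1) x) < \<infinity>"
    using fin by (intro le_less_trans[OF cycle_length_finite[OF assms(2) \<epsilon>]] ennreal_affine_finite)
  then have "(\<lambda>n. ennreal C * (T ^^ n) (\<lambda>_. 1) x) \<longlonglongrightarrow> ennreal C * 0"
    by (intro ennreal_tendsto_cmult ennreal_suminf_tendsto_0) auto
  from tendsto_add[OF Tn_suminf_tail[OF assms(2) fin] this]
  have lim: "(\<lambda>n. (T ^^ n) (\<lambda>x. \<Sum>k. (T ^^ k) b x) x + ennreal C * (T ^^ n) (\<lambda>_. 1) x) \<longlonglongrightarrow> 0"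
    by simp
  have bound: "(T ^^ n) f x \<le> (T ^^ n) (\<lambda>x. \<Sum>k. (T ^^ k) b x) x + ennreal C * (T ^^ n) (\<lambda>_. 1) x" for n
  proof -
    have "(T ^^ n) f x \<le> (T ^^ n) (\<lambda>x. (\<Sum>k. (T ^^ k) b x) + ennreal C * 1) x"
      using le by (intro Tn_mono) simp
    also have "\<dots> = (T ^^ n) (\<lambda>x. \<Sum>k. (T ^^ k) b x) x + (T ^^ n) (\<lambda>x. ennreal C * 1) x"
      by (rule fun_cong[OF Tn_add]) measurable
    also have "(T ^^ n) (\<lambda>x. ennreal C * 1) x = ennreal C * (T ^^ n) (\<lambda>_. 1) x"
      by (rule fun_cong[OF Tn_cmult]) measurable
    finally show ?thesis .
  qed
  show ?thesis
    by (rule tendsto_sandwich[OF always_eventually always_eventually tendsto_const lim]) (use bound in auto)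
qed

text \<open>The equation bounds the partial sums of \<open>b\<close> by
  \<open>f x + \<alpha>\<close>, so all limits are finite. The remainder \<open>(T ^^ n) f x\<close>
  is a difference of partial sums; its limit is nonnegative, which gives
  \<open>\<kappa> \<le> C\<close>, and for \<open>\<kappa> = C\<close> the assumed upper bound
  leaves no room for a positive limit.\<close>

lemma value_eq_cycle_cost:
  assumes [measurable]: "f \<in> borel_measurable borel" "a \<in> borel_measurable borel" "b \<in> borel_measurable borel"
    and eq: "\<And>x. f x + a x = b x + ennreal \<kappa> * regen x + T f x"
    and a: "\<And>x. a x \<le> ennreal \<alpha> * regen x"
    and \<epsilon>: "0 < \<epsilon>" "\<And>x. x \<notin> B \<Longrightarrow> ennreal \<epsilon> \<le> b x"
    and fx: "f x < \<infinity>"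
    and le: "f x + (\<Sum>k. (T ^^ k) a x) \<le> (\<Sum>k. (T ^^ k) b x) + ennreal C" and "0 \<le> C" "0 \<le> \<kappa>"
  shows "(\<Sum>k. (T ^^ k) b x) \<le> f x + ennreal \<alpha>"
    and "\<kappa> \<le> C" and "\<kappa> = C \<Longrightarrow> (\<lambda>n. (T ^^ n) f x) \<longlonglongrightarrow> 0"
proof -
  have it: "f x + (\<Sum>k<n. (T ^^ k) a x)
      = (\<Sum>k<n. (T ^^ k) b x) + ennreal \<kappa> * (\<Sum>k<n. (T ^^ k) regen x) + (T ^^ n) f x" for n
  proof -
    have "f x + (\<Sum>k<n. (T ^^ k) a x) = (\<Sum>k<n. (T ^^ k) (\<lambda>x. b x + ennreal \<kappa> * regen x) x) + (T ^^ n) f x"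
      by (rule iterate_eq) (use eq in auto)
    then show ?thesis by (simp add: Tn_add Tn_cmult sum.distrib sum_distrib_left)
  qed
  have suma: "(\<Sum>k. (T ^^ k) a x) \<le> ennreal \<alpha>"
    by (rule order.trans[OF suminf_le suminf_Tn_cmult_regen[of "ennreal \<alpha>" x]]) (intro Tn_mono a summableI)+
  show sumb: "(\<Sum>k. (T ^^ k) b x) \<le> f x + ennreal \<alpha>"
  proof (rule suminf_le_const)
    fix n
    have "(\<Sum>k<n. (T ^^ k) b x) \<le> f x + (\<Sum>k<n. (T ^^ k) a x)"
      unfolding it add.assoc by (rule le_iff_add[THEN iffD2, OF exI, OF refl])
    also have "\<dots> \<le> f x + ennreal \<alpha>"
      by (intro add_left_mono order.trans[OF sum_le_suminf suma]) auto
    finally show "(\<Sum>k<n. (T ^^ k) b x) \<le> f x + ennreal \<alpha>" .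
  qed simp
  have finb: "(\<Sum>k. (T ^^ k) b x) < \<infinity>"
    by (rule le_less_trans[OF sumb]) (use fx in auto)
  have "(\<Sum>k. (T ^^ k) (\<lambda>_. 1) x) < \<infinity>"
    using finb by (intro le_less_trans[OF cycle_length_finite[OF assms(3) \<epsilon>]] ennreal_affine_finite)
  \<comment> \<open>A finite mean cycle length makes regeneration certain, so \<kappa> is charged
    exactly once in the limit.\<close>
  then have reg: "(\<Sum>k. (T ^^ k) regen x) = 1"
    by (intro regen_suminf_eq ennreal_suminf_tendsto_0)
  let ?L = "f x + (\<Sum>k. (T ^^ k) a x)" and ?R = "(\<Sum>k. (T ^^ k) b x) + ennreal \<kappa>"
  have L: "(\<lambda>n. f x + (\<Sum>k<n. (T ^^ k) a x)) \<longlonglongrightarrow> ?L"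
    by (intro tendsto_add tendsto_const summable_LIMSEQ) simp
  have "(\<lambda>n. (\<Sum>k<n. (T ^^ k) b x) + ennreal \<kappa> * (\<Sum>k<n. (T ^^ k) regen x))
      \<longlonglongrightarrow> (\<Sum>k. (T ^^ k) b x) + ennreal \<kappa> * (\<Sum>k. (T ^^ k) regen x)"
    by (intro tendsto_add ennreal_tendsto_cmult summable_LIMSEQ) auto
  then have R: "(\<lambda>n. (\<Sum>k<n. (T ^^ k) b x) + ennreal \<kappa> * (\<Sum>k<n. (T ^^ k) regen x)) \<longlonglongrightarrow> ?R"
    by (simp add: reg)
  have Rfin: "?R \<noteq> \<top>" using finb by simp
  have Lfin: "?L \<noteq> \<top>"
  proof -
    have "?L \<le> f x + ennreal \<alpha>" by (rule add_left_mono[OF suma])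
    also have "f x + ennreal \<alpha> < \<top>" using fx by simp
    finally show ?thesis by (simp only: less_top)
  qed
  have RL: "?R \<le> ?L"
  proof (rule LIMSEQ_le[OF R L], intro exI allI impI)
    fix n
    show "(\<Sum>k<n. (T ^^ k) b x) + ennreal \<kappa> * (\<Sum>k<n. (T ^^ k) regen x) \<le> f x + (\<Sum>k<n. (T ^^ k) a x)"
      unfolding it by (rule le_iff_add[THEN iffD2, OF exI, OF refl])
  qed
  from RL le have "?R \<le> (\<Sum>k. (T ^^ k) b x) + ennreal C" by (rule order.trans)
  then have "ennreal \<kappa> \<le> ennreal C"
    using finb by (subst (asm) ennreal_add_left_cancel_le) auto
  then show "\<kappa> \<le> C" using \<open>0 \<le> C\<close> by simp
  assume "\<kappa> = C"
  with le RL have "?L = ?R" by (intro order.antisym) (simp only:)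
  have X: "(T ^^ n) f x = (f x + (\<Sum>k<n. (T ^^ k) a x))
      - ((\<Sum>k<n. (T ^^ k) b x) + ennreal \<kappa> * (\<Sum>k<n. (T ^^ k) regen x))" for n
  proof -
    have "(\<Sum>k<n. (T ^^ k) b x) < \<top>"
      by (rule le_less_trans[OF sum_le_suminf finb[unfolded infinity_ennreal_def]]) auto
    moreover have "(\<Sum>k<n. (T ^^ k) regen x) < \<top>"
      by (rule le_less_trans[OF sum_le_suminf]) (auto simp: reg)
    ultimately have "(\<Sum>k<n. (T ^^ k) b x) + ennreal \<kappa> * (\<Sum>k<n. (T ^^ k) regen x) \<noteq> \<top>"
      by (simp only: less_top[symmetric] ennreal_add_eq_top ennreal_mult_eq_top_iff ennreal_neq_top simp_thms)
    then show ?thesis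
      by (subst it) (rule ennreal_add_diff_cancel_left[symmetric])
  qed
  have LR0: "?L - ?R = 0"
  proof (rule diff_eq_0_iff_ennreal[THEN iffD2], intro conjI)
    show "?L < \<top>" using Lfin by (simp only: less_top)
    show "?L \<le> ?R" using \<open>?L = ?R\<close> by (rule eq_refl)
  qed
  have "(\<lambda>n. (T ^^ n) f x) \<longlonglongrightarrow> ?L - ?R"
    unfolding X by (intro tendsto_diff_ennreal L R Lfin Rfin)
  then show "(\<lambda>n. (T ^^ n) f x) \<longlonglongrightarrow> 0" by (simp only: LR0)
qed

end

section \<open>Signed integrals under a taboo kernel and the renewal inequality for the
  excess\<close>

lemma integral_enn2real:
  assumes [measurable]: "g \<in> borel_measurable N" and fin: "\<And>x. g x < \<infinity>" "(\<integral>\<^sup>+x. g x \<partial>N) < \<infinity>"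
  shows "integrable N (\<lambda>x. enn2real (g x))" "(\<integral>x. enn2real (g x) \<partial>N) = enn2real (\<integral>\<^sup>+x. g x \<partial>N)"
proof -
  have e: "(\<integral>\<^sup>+x. ennreal (enn2real (g x)) \<partial>N) = (\<integral>\<^sup>+x. g x \<partial>N)" using fin(1) by simp
  show "integrable N (\<lambda>x. enn2real (g x))"
    using fin(2) by (intro integrableI_nonneg) (auto simp: e enn2real_nonneg)
  show "(\<integral>x. enn2real (g x) \<partial>N) = enn2real (\<integral>\<^sup>+x. g x \<partial>N)"
    by (subst integral_eq_nn_integral) (auto simp: e enn2real_nonneg)
qed

context taboo_kernel
begin

lemma Tn_regen_finite: "(T ^^ k) regen y < \<infinity>"
  using le_less_trans[OF regen_suminf_le[of y], of \<infinity>] ennreal_suminf_lessD by auto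

lemma integrable_taboo:
  fixes f :: "'x \<Rightarrow> real"
  assumes "integrable (P x) f"
  shows "integrable (taboo x) f"
proof -
  have m: "f \<in> borel_measurable borel"
    using borel_measurable_integrable[OF assms] by (simp add: measurable_cong_sets[OF sets_P refl])
  have "(\<integral>\<^sup>+y. ennreal (norm (f y)) \<partial>taboo x) \<le> (\<integral>\<^sup>+y. ennreal (norm (f y)) \<partial>P x)"
    using m by (subst nn_integral_P) auto
  also have "\<dots> < \<infinity>" using assms by (simp add: integrable_iff_bounded)
  finally show ?thesis using m by (simp add: integrable_iff_bounded)
qed

text \<open>The nonnegative decomposition is applied to the positive and to the negative part;
  integrability passes from \<open>P x\<close> to the taboo kernel, which it dominates.\<close>

lemma integral_P:
  fixes f :: "'x \<Rightarrow> real"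
  assumes P: "integrable (P x) f" and N: "integrable \<nu> f"
  shows "(\<integral>y. f y \<partial>P x) = (\<integral>y. f y \<partial>taboo x) + enn2real (regen x) * (\<integral>y. f y \<partial>\<nu>)"
proof -
  have m[measurable]: "f \<in> borel_measurable borel"
    using borel_measurable_integrable[OF P] by (simp add: measurable_cong_sets[OF sets_P refl])
  have r: "regen x < \<top>" using regen_le_1[of x] by (auto intro: le_less_trans)
  have eq: "enn2real (\<integral>\<^sup>+y. ennreal (g y) \<partial>P x)
      = enn2real (\<integral>\<^sup>+y. ennreal (g y) \<partial>taboo x) + enn2real (regen x) * enn2real (\<integral>\<^sup>+y. ennreal (g y) \<partial>\<nu>)"
    if g: "integrable (P x) g" "integrable \<nu> g" for g :: "'x \<Rightarrow> real"
  proof -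
    have [measurable]: "g \<in> borel_measurable borel"
      using borel_measurable_integrable[OF g(1)] by (simp add: measurable_cong_sets[OF sets_P refl])
    have "(\<integral>\<^sup>+y. ennreal (g y) \<partial>taboo x) < \<top>" "(\<integral>\<^sup>+y. ennreal (g y) \<partial>\<nu>) < \<top>"
      using integrable_taboo[OF g(1)] g(2)
      by (auto simp: real_integrable_def less_top[symmetric])
    then show ?thesis
      using r by (subst nn_integral_P) (auto simp: enn2real_plus enn2real_mult ennreal_mult_less_top)
  qed
  show ?thesis
    using eq[OF assms] eq[OF integrable_minus[OF P] integrable_minus[OF N]] P N integrable_taboo[OF P]
    by (simp add: real_lebesgue_integral_def algebra_simps)
qed

end

text \<open>
  In the situation below \<open>D n\<close> is the excess of the value iterates over the limiting value function.
\<close>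

locale taboo_subinvariant = taboo_kernel +
  fixes D :: "nat \<Rightarrow> 'a \<Rightarrow> real" and Z :: "'a \<Rightarrow> ennreal"
  assumes D_int: "\<And>n x. integrable (P x) (D n)" "\<And>n. integrable \<nu> (D n)"
    and D_step: "\<And>n x. D (Suc n) x \<le> (\<integral>y. D n y \<partial>P x)"
    and Z[measurable]: "Z \<in> borel_measurable borel" and Z_fin: "\<And>n x. (T ^^ n) Z x < \<infinity>"
    and D_0: "\<And>x. ennreal (D 0 x) \<le> Z x"
begin

text \<open>Decomposition at the first regeneration: if it occurs at step \<open>i + 1\<close>, the
  chain restarts from \<nu> with \<open>n - 1 - i\<close> steps to go; if it does not occur within
  \<open>n\<close> steps, the killed chain sees the initial excess, bounded by
  \<open>Z\<close>.\<close>

lemma D_le: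
  "D n x \<le> enn2real ((T ^^ n) Z x)
    + (\<Sum>i<n. enn2real ((T ^^ i) regen x) * (\<integral>y. D (n - 1 - i) y \<partial>\<nu>))"
proof (induction n arbitrary: x)
  case 0
  have "ennreal (D 0 x) \<le> ennreal (enn2real (Z x))" using D_0[of x] Z_fin[of 0 x] by simp
  then show ?case by (simp add: enn2real_nonneg)
next
  case (Suc n)
  let ?d = "\<lambda>n. \<integral>y. D n y \<partial>\<nu>"
  have int: "integrable (taboo x) (\<lambda>y. enn2real ((T ^^ k) f y))"
      "(\<integral>y. enn2real ((T ^^ k) f y) \<partial>taboo x) = enn2real ((T ^^ Suc k) f x)"
    if "f \<in> borel_measurable borel" "\<And>k y. (T ^^ k) f y < \<infinity>" for k f
    using integral_enn2real[of "(T ^^ k) f" "taboo x"] that(1) that(2)[of k] that(2)[of "Suc k" x]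
    by (simp_all add: T_def)
  have "D (Suc n) x \<le> (\<integral>y. D n y \<partial>taboo x) + enn2real (regen x) * ?d n"
    using D_step[of n x] by (simp add: integral_P[OF D_int])
  also have "(\<integral>y. D n y \<partial>taboo x) \<le> (\<integral>y. enn2real ((T ^^ n) Z y)
      + (\<Sum>i<n. enn2real ((T ^^ i) regen y) * ?d (n - 1 - i)) \<partial>taboo x)"
    using int(1)[OF Z Z_fin] int(1)[OF regen_measurable Tn_regen_finite]
    by (intro integral_mono integrable_taboo[OF D_int(1)] Suc.IH Bochner_Integration.integrable_add
        Bochner_Integration.integrable_sum integrable_mult_left)
  also have "\<dots> = enn2real ((T ^^ Suc n) Z x)
      + (\<Sum>i<n. enn2real ((T ^^ Suc i) regen x) * ?d (n - 1 - i))"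
    using int[OF Z Z_fin] int[OF regen_measurable Tn_regen_finite]
    by (subst Bochner_Integration.integral_add)
       (auto simp del: funpow.simps intro!: Bochner_Integration.integrable_sum integrable_mult_left)
  finally show ?case
    by (subst sum.lessThan_Suc_shift) (simp add: algebra_simps)
qed

text \<open>Integrating \<open>D_le\<close> against \<nu> gives a renewal inequality:
  \<open>p n\<close> is the probability that a cycle started from \<nu> has length
  \<open>n + 1\<close>, \<open>t n\<close> is the corresponding tail, and summability of
  \<open>t\<close> is finiteness of the mean length.\<close>

lemma averages_converge:
  assumes Z_sum: "(\<Sum>k. \<integral>\<^sup>+x. (T ^^ k) Z x \<partial>\<nu>) < \<infinity>"
    and T1: "\<And>x. (\<lambda>n. (T ^^ n) (\<lambda>_. 1) x) \<longlonglongrightarrow> 0" "(\<Sum>k. \<integral>\<^sup>+x. (T ^^ k) (\<lambda>_. 1) x \<partial>\<nu>) < \<infinity>"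
    and bdd: "\<And>n. m \<le> (\<integral>x. D n x \<partial>\<nu>)"
  shows "convergent (\<lambda>n. \<integral>x. D n x \<partial>\<nu>)"
proof -
  interpret N: prob_space \<nu> by (rule prob_\<nu>)
  let ?d = "\<lambda>n. \<integral>y. D n y \<partial>\<nu>"
  define b p t where "b n = enn2real (\<integral>\<^sup>+x. (T ^^ n) Z x \<partial>\<nu>)" and "p n = enn2real (\<integral>\<^sup>+x. (T ^^ n) regen x \<partial>\<nu>)"
    and "t n = enn2real (\<integral>\<^sup>+x. (T ^^ n) (\<lambda>_. 1) x \<partial>\<nu>)" for n
  have nn: "0 \<le> b n" "0 \<le> p n" "0 \<le> t n" for n
    by (auto simp: b_def p_def t_def enn2real_nonneg)
  have sum_regen: "(\<Sum>k. \<integral>\<^sup>+x. (T ^^ k) regen x \<partial>\<nu>) = 1"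
    using regen_suminf_eq[OF T1(1)] N.emeasure_space_1
    by (subst nn_integral_suminf[symmetric]) (auto simp: measurable_cong_sets[OF sets_\<nu> refl])
  then have p_sums: "p sums 1"
    using sums_enn2real[of "\<lambda>k. \<integral>\<^sup>+x. (T ^^ k) regen x \<partial>\<nu>"] by (simp add: p_def[abs_def])
  have b_sum: "summable b"
    using sums_summable[OF sums_enn2real[OF Z_sum]] by (simp add: b_def[abs_def])
  have t_sum: "summable t"
    using sums_summable[OF sums_enn2real[OF T1(2)]] by (simp add: t_def[abs_def])
  have intZ: "integrable \<nu> (\<lambda>y. enn2real ((T ^^ k) Z y))" "(\<integral>y. enn2real ((T ^^ k) Z y) \<partial>\<nu>) = b k" for k
    using integral_enn2real[of "(T ^^ k) Z" \<nu>] Z_fin ennreal_suminf_lessD[OF Z_sum, of k]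
    by (simp_all add: b_def measurable_cong_sets[OF sets_\<nu> refl])
  have intr: "integrable \<nu> (\<lambda>y. enn2real ((T ^^ k) regen y))" "(\<integral>y. enn2real ((T ^^ k) regen y) \<partial>\<nu>) = p k" for k
    using integral_enn2real[of "(T ^^ k) regen" \<nu>] Tn_regen_finite
      ennreal_suminf_lessD[of "\<lambda>k. \<integral>\<^sup>+x. (T ^^ k) regen x \<partial>\<nu>" \<infinity> k] sum_regen
    by (simp_all add: p_def measurable_cong_sets[OF sets_\<nu> refl])
  have step: "?d n \<le> b n + (\<Sum>i<n. p i * ?d (n - 1 - i))" for n
  proof -
    have "?d n \<le> (\<integral>x. enn2real ((T ^^ n) Z x)
        + (\<Sum>i<n. enn2real ((T ^^ i) regen x) * ?d (n - 1 - i)) \<partial>\<nu>)"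
      by (intro integral_mono D_int D_le Bochner_Integration.integrable_add
          Bochner_Integration.integrable_sum integrable_mult_left intZ intr)
    also have "\<dots> = b n + (\<Sum>i<n. p i * ?d (n - 1 - i))"
      by (subst Bochner_Integration.integral_add)
         (auto simp: intZ intr intro!: Bochner_Integration.integrable_sum integrable_mult_left)
    finally show ?thesis .
  qed
  have sum_p: "(\<Sum>i<n. p i) \<le> 1" for n
    using sum_le_suminf[OF sums_summable[OF p_sums], of "{..<n}"] nn p_sums by (simp add: sums_iff)
  \<comment> \<open>The weights have total mass at most 1, so earlier bounds are not amplified and
    only the source term \<open>b n\<close> is added.\<close>
  have ub: "?d n \<le> (\<Sum>i\<le>n. b i)" for n
  proof (induction n rule: less_induct)
    case (less n)
    have "(\<Sum>i<n. p i * ?d (n - 1 - i)) \<le> (\<Sum>i<n. p i * (\<Sum>i<n. b i))"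
    proof (intro sum_mono mult_left_mono nn)
      fix i assume "i \<in> {..<n}"
      then have "?d (n - 1 - i) \<le> (\<Sum>i\<le>n - 1 - i. b i)" by (intro less) auto
      also have "\<dots> \<le> (\<Sum>i<n. b i)" using \<open>i \<in> {..<n}\<close> nn by (intro sum_mono2) auto
      finally show "?d (n - 1 - i) \<le> (\<Sum>i<n. b i)" .
    qed
    also have "\<dots> = (\<Sum>i<n. p i) * (\<Sum>i<n. b i)" by (rule sum_distrib_right[symmetric])
    also have "\<dots> \<le> 1 * (\<Sum>i<n. b i)" by (intro mult_right_mono sum_p sum_nonneg nn)
    finally show ?case using step[of n] by (simp add: lessThan_Suc_atMost[symmetric])
  qed
  have K: "\<bar>?d n\<bar> \<le> \<bar>m\<bar> + \<bar>suminf b\<bar>" for n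
  proof -
    have "?d n \<le> suminf b"
      by (rule order.trans[OF ub sum_le_suminf[OF b_sum]]) (use nn in auto)
    with bdd[of n] show ?thesis by (auto simp: abs_if)
  qed
  \<comment> \<open>Regeneration at the very first step has probability \<delta>, since \<nu> is
    carried by \<open>B\<close>; this excludes periodicity.\<close>
  have p0: "0 < p 0"
  proof -
    have "(\<integral>\<^sup>+x. regen x \<partial>\<nu>) = ennreal \<delta>"
      unfolding regen_def using \<nu>(2)
      by (subst nn_integral_cmult_indicator) (auto simp: measurable_cong_sets[OF sets_\<nu> refl])
    then show ?thesis using \<delta> by (simp add: p_def)
  qed
  have t_step: "t (Suc n) = t n - p n" for n
  proof -
    have T1_le: "(T ^^ k) (\<lambda>_. 1) x \<le> 1" for k x
      using regen_sum[of x k] by (metis add.commute le_iff_add)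
    have "(T ^^ Suc n) (\<lambda>_. 1) x + (T ^^ n) regen x = (T ^^ n) (\<lambda>_. 1) x" for x
    proof -
      have "(T ^^ n) (\<lambda>_. 1) x = (T ^^ n) (\<lambda>x. T (\<lambda>_. 1) x + regen x) x" by (simp add: T_1)
      also have "\<dots> = (T ^^ Suc n) (\<lambda>_. 1) x + (T ^^ n) regen x"
        unfolding Tn_Suc by (rule fun_cong[OF Tn_add]) (auto intro: T_measurable)
      finally show ?thesis ..
    qed
    then have "(\<integral>\<^sup>+x. (T ^^ n) (\<lambda>_. 1) x \<partial>\<nu>)
        = (\<integral>\<^sup>+x. (T ^^ Suc n) (\<lambda>_. 1) x \<partial>\<nu>) + (\<integral>\<^sup>+x. (T ^^ n) regen x \<partial>\<nu>)"
      by (subst nn_integral_add[symmetric])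
         (auto simp del: funpow.simps simp: measurable_cong_sets[OF sets_\<nu> refl])
    then have "t n = t (Suc n) + p n"
      using ennreal_suminf_lessD[OF T1(2)] ennreal_suminf_lessD[of "\<lambda>k. \<integral>\<^sup>+x. (T ^^ k) regen x \<partial>\<nu>" \<infinity> n] sum_regen
      by (simp add: t_def p_def enn2real_plus del: funpow.simps)
    then show ?thesis by simp
  qed
  have "t 0 = 1" using N.emeasure_space_1 by (simp add: t_def)
  then show ?thesis
    by (rule subrenewal_converges[OF nn(2) p_sums p0 _ t_step nn(3) t_sum nn(1) b_sum K step])
qed

text \<open>In \<open>D_le\<close> the term with \<open>Z\<close> vanishes, and the convolution
  tends to \<open>r\<close> because the law of the regeneration time from \<open>x\<close> has total
  mass 1.\<close>

lemma eventually_le_limit: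
  assumes lim: "(\<lambda>n. \<integral>y. D n y \<partial>\<nu>) \<longlonglongrightarrow> r"
    and Z0: "(\<lambda>n. (T ^^ n) Z x) \<longlonglongrightarrow> 0" and T1: "(\<lambda>n. (T ^^ n) (\<lambda>_. 1) x) \<longlonglongrightarrow> 0" and e: "0 < e"
  shows "\<forall>\<^sub>F n in sequentially. D n x \<le> r + e"
proof -
  have s: "(\<lambda>i. enn2real ((T ^^ i) regen x)) sums 1"
    using sums_enn2real[of "\<lambda>k. (T ^^ k) regen x"] regen_suminf_eq[OF T1] by simp
  have "(\<lambda>n. enn2real ((T ^^ n) Z x) + (\<Sum>i<n. enn2real ((T ^^ i) regen x) * (\<integral>y. D (n - 1 - i) y \<partial>\<nu>)))
      \<longlonglongrightarrow> 0 + suminf (\<lambda>i. enn2real ((T ^^ i) regen x)) * r"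
    using Z0 by (intro tendsto_add tendsto_enn2real convolution_tendsto lim sums_summable[OF s])
      (auto simp: enn2real_nonneg)
  then have "(\<lambda>n. enn2real ((T ^^ n) Z x) + (\<Sum>i<n. enn2real ((T ^^ i) regen x) * (\<integral>y. D (n - 1 - i) y \<partial>\<nu>)))
      \<longlonglongrightarrow> r"
    using s by (simp add: sums_iff)
  from order_tendstoD(2)[OF this, of "r + e"] e show ?thesis
    using D_le[of _ x] by (auto elim!: eventually_mono intro: order.trans less_imp_le)
qed

end

section \<open>The split chain\<close>

text \<open>The share of the mass at \<open>y\<close> that stays on level 0 when a measure is
  split.\<close>

definition atom_weight :: "'x set \<Rightarrow> real \<Rightarrow> 'x \<Rightarrow> ennreal" where
  "atom_weight B \<delta> y = ennreal (1 - \<delta> * indicator B y)"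

text \<open>Mean of \<open>f\<close> over the two levels above \<open>y\<close>; its integral is
  that of \<open>f\<close> against the split measure.\<close>

definition fold_split :: "'x set \<Rightarrow> real \<Rightarrow> ('x \<times> bool \<Rightarrow> ennreal) \<Rightarrow> 'x \<Rightarrow> ennreal" where
  "fold_split B \<delta> f y = atom_weight B \<delta> y * f (y, False) + ennreal \<delta> * indicator B y * f (y, True)"

text \<open>A common form for split measures and for the policy kernels of the split chain,
  \<open>r\<close> being the normalizing factor.\<close>

definition lift :: "'x::polish_space set \<Rightarrow> real \<Rightarrow> ennreal \<Rightarrow> 'x measure \<Rightarrow> ('x \<times> bool) measure" where
  "lift B \<delta> r m = measure_of (split_states B) (sets (split_space B))
     (\<lambda>A. r * (\<integral>\<^sup>+y. fold_split B \<delta> (indicator A) y \<partial>m))"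

context
  fixes B :: "'x::polish_space set" and \<delta> :: real
  assumes B[measurable]: "B \<in> sets borel" and \<delta>: "0 < \<delta>" "\<delta> < 1"
begin

lemma space_split_space: "space (split_space B) = split_states B"
  by (auto simp: split_space_def space_restrict_space space_pair_measure)

lemma split_states_measurable: "split_states B \<in> sets (borel \<Otimes>\<^sub>M count_space UNIV)"
  unfolding split_states_def by measurable

lemma sets_split_space:
  "A \<in> sets (split_space B) \<longleftrightarrow> A \<in> sets (borel \<Otimes>\<^sub>M count_space UNIV) \<and> A \<subseteq> split_states B"
  unfolding split_space_def using split_states_measurable by (auto simp: sets_restrict_space_iff)

lemma atom_weight_measurable[measurable]: "atom_weight B \<delta> \<in> borel_measurable borel"
  unfolding atom_weight_def by measurable

lemma measurable_fst_split: "fst \<in> split_space B \<rightarrow>\<^sub>M borel"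
  unfolding split_space_def by (rule measurable_restrict_space1) simp

lemma measurable_snd_split: "snd \<in> split_space B \<rightarrow>\<^sub>M count_space UNIV"
  unfolding split_space_def by (rule measurable_restrict_space1) simp

lemma nn_integral_fold_split_indicator_le:
  assumes "prob_space m"
  shows "(\<integral>\<^sup>+y. fold_split B \<delta> (indicator A) y \<partial>m) \<le> 1"
proof -
  have "fold_split B \<delta> (indicator A) y \<le> 1" for y
  proof -
    have "fold_split B \<delta> (indicator A) y \<le> atom_weight B \<delta> y * 1 + ennreal \<delta> * indicator B y * 1"
      unfolding fold_split_def by (intro add_mono mult_left_mono) (auto simp: indicator_def)
    also have "\<dots> = 1"
      using \<delta> by (auto simp: atom_weight_def indicator_def simp flip: ennreal_plus)
    finally show ?thesis .
  qed
  then have "(\<integral>\<^sup>+y. fold_split B \<delta> (indicator A) y \<partial>m) \<le> (\<integral>\<^sup>+y. 1 \<partial>m)"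
    by (intro nn_integral_mono)
  then show ?thesis using prob_space.emeasure_space_1[OF assms] by simp
qed

lemma fold_split_measurable:
  assumes f: "f \<in> borel_measurable (split_space B)"
  shows "fold_split B \<delta> f \<in> borel_measurable borel"
proof -
  define f' where "f' s = (if s \<in> split_states B then f s else 0)" for s
  have [measurable]: "f' \<in> borel_measurable (borel \<Otimes>\<^sub>M count_space UNIV)"
    using f split_states_measurable unfolding split_space_def f'_def
    by (subst (asm) measurable_restrict_space_iff[of _ _ 0]) auto
  have "fold_split B \<delta> f = (\<lambda>y. atom_weight B \<delta> y * f' (y, False) + ennreal \<delta> * indicator B y * f' (y, True))"
    by (auto simp: fun_eq_iff fold_split_def f'_def split_states_def indicator_def)
  then show ?thesis by simp
qed

lemma fold_split_indicator_measurable: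
  "A \<in> sets (split_space B) \<Longrightarrow> fold_split B \<delta> (indicator A) \<in> borel_measurable borel"
  by (rule fold_split_measurable) simp

lemma sets_lift[simp]: "sets (lift B \<delta> r m) = sets (split_space B)"
  unfolding lift_def using sets.space_closed[of "split_space B"]
  by (simp add: sets_measure_of sets.sigma_sets_eq space_split_space flip: space_split_space)

text \<open>\<open>measure_of\<close> accepts any set function, so countable additivity has to be
  supplied. Agreement on measurable sets suffices, which lets the set functions in the definitions
  of the split chain be used as they stand.\<close>

lemma emeasure_measure_of_lift:
  assumes m: "sets m = sets borel" and A: "A \<in> sets (split_space B)"
    and eq: "\<And>A. A \<in> sets (split_space B) \<Longrightarrow> \<mu> A = r * (\<integral>\<^sup>+y. fold_split B \<delta> (indicator A) y \<partial>m)"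
  shows "emeasure (measure_of (split_states B) (sets (split_space B)) \<mu>) A
    = r * (\<integral>\<^sup>+y. fold_split B \<delta> (indicator A) y \<partial>m)"
proof (subst emeasure_measure_of_sigma)
  show "sigma_algebra (split_states B) (sets (split_space B))"
    unfolding space_split_space[symmetric] by (rule sets.sigma_algebra_axioms)
  show "positive (sets (split_space B)) \<mu>"
    by (simp add: positive_def eq fold_split_def[abs_def])
  show "countably_additive (sets (split_space B)) \<mu>"
  proof (rule countably_additiveI)
    fix F :: "nat \<Rightarrow> _" assume F: "range F \<subseteq> sets (split_space B)" "disjoint_family F"
    have [measurable]: "fold_split B \<delta> (indicator (F i)) \<in> borel_measurable m" for i
      using F(1) fold_split_indicator_measurable[of "F i"] by (auto simp: measurable_cong_sets[OF m refl])
    have "(\<Sum>i. \<mu> (F i)) = r * (\<Sum>i. \<integral>\<^sup>+y. fold_split B \<delta> (indicator (F i)) y \<partial>m)"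
      using F(1) by (simp add: eq range_subsetD)
    also have "(\<Sum>i. \<integral>\<^sup>+y. fold_split B \<delta> (indicator (F i)) y \<partial>m)
        = (\<integral>\<^sup>+y. (\<Sum>i. fold_split B \<delta> (indicator (F i)) y) \<partial>m)"
      by (rule nn_integral_suminf[symmetric]) simp
    also have "\<dots> = (\<integral>\<^sup>+y. fold_split B \<delta> (indicator (\<Union>i. F i)) y \<partial>m)"
      by (simp add: fold_split_def suminf_add[symmetric] suminf_indicator[OF F(2)])
    finally show "(\<Sum>i. \<mu> (F i)) = \<mu> (\<Union>i. F i)"
      using F(1) by (simp add: eq sets.countable_UN)
  qed
qed (use A eq in auto)

lemmas emeasure_lift = emeasure_measure_of_lift[OF _ _ refl, folded lift_def]

lemma measure_of_eq_lift:
  assumes m: "sets m = sets borel"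
    and eq: "\<And>A. A \<in> sets (split_space B) \<Longrightarrow> \<mu> A = r * (\<integral>\<^sup>+y. fold_split B \<delta> (indicator A) y \<partial>m)"
  shows "measure_of (split_states B) (sets (split_space B)) \<mu> = lift B \<delta> r m"
  unfolding lift_def
proof (rule measure_of_eq)
  show "sets (split_space B) \<subseteq> Pow (split_states B)"
    using sets.space_closed[of "split_space B"] by (simp add: space_split_space)
  show "\<mu> a = r * (\<integral>\<^sup>+y. fold_split B \<delta> (indicator a) y \<partial>m)"
    if "a \<in> sigma_sets (split_states B) (sets (split_space B))" for a
    using that eq sets.sigma_sets_eq[of "split_space B"] by (simp add: space_split_space)
qed

lemma split_measure_eq_lift:
  assumes m: "sets m = sets borel"
  shows "split_measure B \<delta> m = lift B \<delta> 1 m"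
  unfolding split_measure_def
proof (rule measure_of_eq_lift[OF m])
  fix A assume A: "A \<in> sets (split_space B)"
  then have A': "A \<in> sets (borel \<Otimes>\<^sub>M count_space UNIV)" "A \<subseteq> split_states B"
    by (auto simp: sets_split_space)
  have [measurable]: "{x. (x, b) \<in> A} \<in> sets borel" for b
    using measurable_sets[of "\<lambda>y. (y, b)" borel "borel \<Otimes>\<^sub>M count_space UNIV" A] A'(1)
    by (simp add: vimage_def)
  have "fold_split B \<delta> (indicator A) y = ennreal (1 - \<delta>) * indicator ({x. (x, False) \<in> A} \<inter> B) y
      + indicator ({x. (x, False) \<in> A} \<inter> - B) y + ennreal \<delta> * indicator {x. (x, True) \<in> A} y" for y
    using A'(2) by (auto simp: fold_split_def atom_weight_def indicator_def split_states_def)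
  then show "ennreal (1 - \<delta>) * emeasure m ({x. (x, False) \<in> A} \<inter> B) + emeasure m ({x. (x, False) \<in> A} \<inter> - B)
      + ennreal \<delta> * emeasure m {x. (x, True) \<in> A} = 1 * (\<integral>\<^sup>+y. fold_split B \<delta> (indicator A) y \<partial>m)"
    by (simp add: nn_integral_add nn_integral_cmult m measurable_cong_sets[OF m refl])
qed

lemma nn_integral_lift:
  assumes m: "sets m = sets borel" and f: "f \<in> borel_measurable (split_space B)"
  shows "(\<integral>\<^sup>+s. f s \<partial>lift B \<delta> r m) = r * (\<integral>\<^sup>+y. fold_split B \<delta> f y \<partial>m)"
  using f
proof (induction rule: borel_measurable_induct)
  case (cong f g)
  have "fold_split B \<delta> f = fold_split B \<delta> g"
    using cong(3) by (auto simp: fun_eq_iff fold_split_def space_split_space split_states_def indicator_def)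
  moreover have "(\<integral>\<^sup>+s. f s \<partial>lift B \<delta> r m) = (\<integral>\<^sup>+s. g s \<partial>lift B \<delta> r m)"
    using cong(3) sets_eq_imp_space_eq[OF sets_lift] by (auto intro: nn_integral_cong)
  ultimately show ?case using cong by simp
next
  case (set A)
  then show ?case by (simp add: emeasure_lift[OF m])
next
  case (mult u c)
  note [measurable] = fold_split_measurable[OF mult(2)]
  have "fold_split B \<delta> (\<lambda>s. c * u s) = (\<lambda>y. c * fold_split B \<delta> u y)"
    by (simp add: fun_eq_iff fold_split_def algebra_simps)
  moreover have "u \<in> borel_measurable (lift B \<delta> r m)" using mult(2) by (simp add: measurable_cong_sets[OF sets_lift refl])
  ultimately show ?case
    by (simp add: nn_integral_cmult mult measurable_cong_sets[OF m refl] mult_ac)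
next
  case (add u v)
  note [measurable] = fold_split_measurable[OF \<open>u \<in> borel_measurable (split_space B)\<close>]
    fold_split_measurable[OF \<open>v \<in> borel_measurable (split_space B)\<close>]
  have "fold_split B \<delta> (\<lambda>s. v s + u s) = (\<lambda>y. fold_split B \<delta> v y + fold_split B \<delta> u y)"
    by (simp add: fun_eq_iff fold_split_def algebra_simps)
  moreover have "u \<in> borel_measurable (lift B \<delta> r m)" "v \<in> borel_measurable (lift B \<delta> r m)"
    using \<open>u \<in> _\<close> \<open>v \<in> _\<close> by (simp_all add: measurable_cong_sets[OF sets_lift refl])
  ultimately show ?case
    by (simp add: nn_integral_add add.IH measurable_cong_sets[OF m refl] distrib_left)
next
  case (seq U)
  have meas: "U i \<in> borel_measurable (lift B \<delta> r m)" for i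
    using seq(1) by (simp add: measurable_cong_sets[OF sets_lift refl])
  have mono: "incseq (\<lambda>i. fold_split B \<delta> (U i))"
    using \<open>incseq U\<close> by (auto simp: incseq_def le_fun_def fold_split_def intro!: add_mono mult_left_mono)
  have "fold_split B \<delta> (SUP i. U i) y = (SUP i. fold_split B \<delta> (U i) y)" for y
  proof -
    have inc: "incseq (\<lambda>i. a * U i s)" for a s
      by (rule monoI) (rule mult_left_mono[OF le_funD[OF incseqD[OF \<open>incseq U\<close>]]], simp_all)
    have "(SUP i. U i) s = (SUP i. U i s)" for s by (simp add: image_comp)
    then show ?thesis
      unfolding fold_split_def SUP_mult_left_ennreal
      by (simp only: SUP_mult_left_ennreal) (rule ennreal_SUP_add[OF inc inc, symmetric])
  qed
  then have "(\<integral>\<^sup>+y. fold_split B \<delta> (SUP i. U i) y \<partial>m) = (SUP i. \<integral>\<^sup>+y. fold_split B \<delta> (U i) y \<partial>m)"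
    using fold_split_measurable[OF seq(1)]
    by (simp add: nn_integral_monotone_convergence_SUP[OF mono] measurable_cong_sets[OF m refl])
  moreover have "(\<integral>\<^sup>+s. (SUP i. U i) s \<partial>lift B \<delta> r m) = (SUP i. \<integral>\<^sup>+s. U i s \<partial>lift B \<delta> r m)"
    using nn_integral_monotone_convergence_SUP[OF \<open>incseq U\<close> meas] by (simp add: image_comp)
  ultimately show ?case by (simp only: SUP_mult_left_ennreal seq.IH)
qed

lemma split_atom_measurable: "B \<times> {True} \<in> sets (split_space B)"
  by (auto simp: sets_split_space split_states_def)

text \<open>Passing from \<open>k < hit_time\<close> to \<open>Suc k \<le> hit_time\<close> makes
  the infimum accessible through its universal property; an infinite infimum of the empty set covers
  paths that never reach the atom.\<close>

lemma less_hit_time_iff: "enat k < hit_time B \<omega> \<longleftrightarrow> (\<forall>i\<in>{1..k}. \<omega> i \<notin> B \<times> {True})"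
proof -
  have *: "(\<forall>a\<in>{enat n |n. 1 \<le> n \<and> \<omega> n \<in> A}. enat (Suc k) \<le> a) \<longleftrightarrow> (\<forall>i\<in>{1..k}. \<omega> i \<notin> A)" for A
  proof -
    have "(\<forall>a\<in>{enat n |n. 1 \<le> n \<and> \<omega> n \<in> A}. enat (Suc k) \<le> a) \<longleftrightarrow> (\<forall>n. 1 \<le> n \<and> \<omega> n \<in> A \<longrightarrow> enat (Suc k) \<le> enat n)"
      by blast
    also have "\<dots> \<longleftrightarrow> (\<forall>i\<in>{1..k}. \<omega> i \<notin> A)"
      by (auto simp: not_less_eq_eq[symmetric])
    finally show ?thesis .
  qed
  have "enat k < hit_time B \<omega> \<longleftrightarrow> enat (Suc k) \<le> hit_time B \<omega>" by (rule Suc_ile_eq[symmetric])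
  also have "\<dots> \<longleftrightarrow> (\<forall>i\<in>{1..k}. \<omega> i \<notin> B \<times> {True})"
    unfolding hit_time_def le_Inf_iff by (rule *)
  finally show ?thesis .
qed

end

text \<open>If a limit of graph points left the graph, some closed ball about its second component
  would miss the value there, against upper semicontinuity applied to that ball. The purpose is
  Borel measurability of the graph.\<close>

lemma closed_graph_of_usc:
  fixes U :: "'x::metric_space \<Rightarrow> 'u::metric_space set"
  assumes usc: "\<And>F. closed F \<Longrightarrow> closed {x. U x \<inter> F \<noteq> {}}" and cl: "\<And>x. closed (U x)"
  shows "closed {(x, u). u \<in> U x}"
  unfolding closed_sequential_limits
proof (intro allI impI)
  fix p l assume "(\<forall>n. p n \<in> {(x, u). u \<in> U x}) \<and> p \<longlonglongrightarrow> l"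
  then have p: "\<And>n. snd (p n) \<in> U (fst (p n))" and lim: "p \<longlonglongrightarrow> l" by (auto simp: case_prod_beta)
  show "l \<in> {(x, u). u \<in> U x}"
  proof (rule ccontr)
    assume "l \<notin> {(x, u). u \<in> U x}"
    then have "snd l \<in> - U (fst l)" by (auto simp: case_prod_beta)
    then obtain e where e: "e > 0" "cball (snd l) e \<subseteq> - U (fst l)"
      using cl[of "fst l"] open_contains_cball[of "- U (fst l)"] by (auto simp: open_Compl)
    have "\<forall>\<^sub>F n in sequentially. dist (snd (p n)) (snd l) < e"
      using tendstoD[OF tendsto_snd[OF lim] e(1)] .
    then have "\<forall>\<^sub>F n in sequentially. fst (p n) \<in> {x. U x \<inter> cball (snd l) e \<noteq> {}}"
    proof eventually_elim
      case (elim n)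
      then have "snd (p n) \<in> U (fst (p n)) \<inter> cball (snd l) e"
        using p[of n] by (simp add: dist_commute less_imp_le)
      then show ?case by blast
    qed
    then have "fst l \<in> {x. U x \<inter> cball (snd l) e \<noteq> {}}"
      by (rule Lim_in_closed_set[OF usc[OF closed_cball] _ _ tendsto_fst[OF lim]]) simp
    with e(2) show False by auto
  qed
qed

section \<open>The controlled chain and its split version in taboo form\<close>

locale split_mdp =
  fixes M :: "('x::polish_space, 'u::polish_space) mdp" and B :: "'x set" and \<delta> :: real and \<nu> :: "'x measure"
  assumes basic: "basic_mdp M" and graph_measurable[measurable]: "graph M \<in> sets borel"
    and B[measurable]: "B \<in> sets borel"
    and \<nu>: "\<nu> \<in> space (prob_algebra borel)" "emeasure \<nu> B = 1"
    and \<delta>: "0 < \<delta>" "\<delta> < 1"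
    and minorization: "\<And>A x u. A \<in> sets borel \<Longrightarrow> x \<in> B \<Longrightarrow> (x, u) \<in> graph M \<Longrightarrow>
      ennreal \<delta> * emeasure \<nu> A \<le> emeasure (ker M (x, u)) A"
    and beta_finite: "beta M < \<infinity>"
begin

lemma actions: "actions M x \<noteq> {}" "actions M x \<in> sets borel"
  using basic by (auto simp: basic_mdp_def)

lemma graph_iff: "(x, u) \<in> graph M \<longleftrightarrow> u \<in> actions M x"
  by (simp add: graph_def)

lemma total_ker_measurable: "total_ker M \<in> borel \<rightarrow>\<^sub>M prob_algebra borel"
proof -
  have "ker M \<in> restrict_space borel (graph M) \<rightarrow>\<^sub>M prob_algebra borel"
    using basic by (simp add: basic_mdp_def)
  moreover have "(\<lambda>p. return borel (fst p)) \<in> borel \<rightarrow>\<^sub>M prob_algebra (borel :: 'x measure)"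
    by (rule measurable_compose[OF borel_measurable_continuous_onI measurable_return_prob_space])
      (intro continuous_intros)
  ultimately show ?thesis
    unfolding total_ker_def[abs_def]
    by (subst measurable_If_restrict_space_iff) (auto intro: measurable_restrict_space1)
qed

lemma total_ker_Pair: "(\<lambda>u. total_ker M (x, u)) \<in> borel \<rightarrow>\<^sub>M prob_algebra borel"
  by (rule measurable_compose[OF _ total_ker_measurable]) (simp add: borel_prod[symmetric])

text \<open>Extension by 0 makes the cost Borel on the whole product; stationary policies charge
  only the graph, so the added values do not affect their costs.\<close>

definition tcost :: "'x \<times> 'u \<Rightarrow> ennreal" where
  "tcost p = (if p \<in> graph M then cost M p else 0)"

lemma tcost_measurable[measurable]: "tcost \<in> borel_measurable borel"
proof -
  have "cost M \<in> borel_measurable (restrict_space borel (graph M))"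
    using basic by (simp add: basic_mdp_def)
  then show ?thesis
    unfolding tcost_def[abs_def] by (subst measurable_If_restrict_space_iff) auto
qed

lemma total_ker_graph: "(x, u) \<in> graph M \<Longrightarrow> total_ker M (x, u) = ker M (x, u)"
  and tcost_graph: "(x, u) \<in> graph M \<Longrightarrow> tcost (x, u) = cost M (x, u)"
  by (simp_all add: total_ker_def tcost_def)

lemma tcost_Pair: "(\<lambda>u. tcost (x, u)) \<in> borel_measurable borel"
  by (rule measurable_compose[OF _ tcost_measurable]) (simp add: borel_prod[symmetric])

text \<open>A single pair is viewed as a constant kernel, for which the lower bound is the same at
  all points of \<open>B\<close>. This makes the decomposition into taboo and regeneration parts
  available for one action at a time.\<close>

lemma taboo_constant:
  assumes "x \<in> B" "(x, u) \<in> graph M"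
  shows "taboo_kernel (\<lambda>_. total_ker M (x, u)) B \<delta> \<nu>"
  using \<nu> \<delta> minorization[OF _ assms] measurable_space[OF total_ker_measurable, of "(x, u)"]
  by unfold_locales (auto simp: total_ker_graph[OF assms(2)])

definition policy_kernel :: "('x \<Rightarrow> 'u measure) \<Rightarrow> 'x \<Rightarrow> 'x measure" where
  "policy_kernel v x = v x \<bind> (\<lambda>u. total_ker M (x, u))"

definition policy_cost :: "('x \<Rightarrow> 'u measure) \<Rightarrow> 'x \<Rightarrow> ennreal" where
  "policy_cost v x = (\<integral>\<^sup>+u. tcost (x, u) \<partial>v x)"

context
  fixes v :: "'x \<Rightarrow> 'u measure" assumes v: "v \<in> stationary_policies M"
begin

lemma policy_measurable: "v \<in> borel \<rightarrow>\<^sub>M prob_algebra borel" "v \<in> borel \<rightarrow>\<^sub>M subprob_algebra borel"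
  using v by (auto simp: stationary_policies_def intro: measurable_prob_algebraD)

lemma prob_policy: "prob_space (v x)" and sets_policy[simp]: "sets (v x) = sets borel"
  using measurable_space[OF policy_measurable(1), of x] by (auto simp: space_prob_algebra)

lemma AE_actions: "AE u in v x. u \<in> actions M x"
proof -
  interpret prob_space "v x" by (rule prob_policy)
  have "emeasure (v x) (actions M x) = 1" using v by (auto simp: stationary_policies_def)
  then show ?thesis
    using actions[of x] by (intro AE_prob_1) (simp add: measure_def)
qed

lemma AE_graph: "AE u in v x. (x, u) \<in> graph M"
  using AE_actions by (simp add: graph_iff)

lemma policy_kernel_measurable: "policy_kernel v \<in> borel \<rightarrow>\<^sub>M prob_algebra borel"
  unfolding policy_kernel_def[abs_def]
  by (rule measurable_bind_prob_space2[OF policy_measurable(1)])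
     (simp add: total_ker_measurable borel_prod)

lemma nn_integral_policy_kernel:
  assumes f: "f \<in> borel_measurable borel"
  shows "(\<integral>\<^sup>+y. f y \<partial>policy_kernel v x) = (\<integral>\<^sup>+u. \<integral>\<^sup>+y. f y \<partial>total_ker M (x, u) \<partial>v x)"
  unfolding policy_kernel_def
  by (rule nn_integral_bind[OF f]) (simp add: measurable_cong_sets[OF sets_policy refl] measurable_prob_algebraD total_ker_Pair)

lemma total_ker_integral_measurable:
  assumes f: "f \<in> borel_measurable borel"
  shows "(\<lambda>u. \<integral>\<^sup>+y. f y \<partial>total_ker M (x, u)) \<in> borel_measurable borel"
  using f by (intro nn_integral_measurable_subprob_algebra2[OF _ measurable_prob_algebraD[OF total_ker_Pair]]) simp

lemma taboo_policy: "taboo_kernel (policy_kernel v) B \<delta> \<nu>"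
proof
  show "ennreal \<delta> * emeasure \<nu> A \<le> emeasure (policy_kernel v x) A" if "x \<in> B" "A \<in> sets borel" for x A
  proof -
    interpret prob_space "v x" by (rule prob_policy)
    have "ennreal \<delta> * emeasure \<nu> A = (\<integral>\<^sup>+u. ennreal \<delta> * emeasure \<nu> A \<partial>v x)"
      by (simp add: emeasure_space_1)
    also have "\<dots> \<le> (\<integral>\<^sup>+u. emeasure (total_ker M (x, u)) A \<partial>v x)"
      using AE_graph[of x] minorization[OF that(2,1)]
      by (intro nn_integral_mono_AE) (auto simp: total_ker_graph)
    also have "\<dots> = emeasure (policy_kernel v x) A"
      using nn_integral_policy_kernel[of "indicator A" x] that(2)
        measurable_space[OF total_ker_measurable] measurable_space[OF policy_kernel_measurable, of x]
      by (simp add: space_prob_algebra)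
    finally show ?thesis .
  qed
qed (use policy_kernel_measurable \<nu> \<delta> in auto)

abbreviation Tv :: "('x \<Rightarrow> ennreal) \<Rightarrow> 'x \<Rightarrow> ennreal" where
  "Tv \<equiv> taboo_kernel.T (policy_kernel v) B \<delta> \<nu>"

text \<open>The mass surviving one step does not depend on the policy, and it is exactly the
  normalizing factor of the split chain on level 0.\<close>

lemma taboo_one_eq_atom_weight: "Tv (\<lambda>_. 1) x = atom_weight B \<delta> x"
proof -
  interpret P: taboo_kernel "policy_kernel v" B \<delta> \<nu> by (rule taboo_policy)
  have "atom_weight B \<delta> x + P.regen x = 1"
    using \<delta> by (auto simp: atom_weight_def P.regen_def indicator_def simp flip: ennreal_plus)
  then have "P.T (\<lambda>_. 1) x + P.regen x = atom_weight B \<delta> x + P.regen x" by (simp add: P.T_1)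
  moreover have "P.regen x \<noteq> \<top>" using P.regen_le_1[of x] by (auto simp: top_unique)
  ultimately show ?thesis by (metis ennreal_add_left_cancel add.commute infinity_ennreal_def)
qed

text \<open>What \<open>split_kernel\<close> subtracts is the regeneration part of the
  decomposition, so the truncated difference is exact.\<close>

lemma split_kernel_eq_lift:
  assumes xu: "(x, u) \<in> graph M" and A: "A \<in> sets (split_space B)" and m: "sets \<nu> = sets borel"
  shows "x \<in> B \<Longrightarrow> emeasure (split_kernel M B \<delta> \<nu> (x, False) u) A
      = ((\<integral>\<^sup>+y. fold_split B \<delta> (indicator A) y \<partial>total_ker M (x, u))
          - ennreal \<delta> * (\<integral>\<^sup>+y. fold_split B \<delta> (indicator A) y \<partial>\<nu>)) / ennreal (1 - \<delta>)"
    and "x \<notin> B \<Longrightarrow> emeasure (split_kernel M B \<delta> \<nu> (x, False) u) A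
      = (\<integral>\<^sup>+y. fold_split B \<delta> (indicator A) y \<partial>total_ker M (x, u))"
proof -
  have k: "sets (total_ker M (x, u)) = sets borel"
    using measurable_space[OF total_ker_measurable, of "(x, u)"] by (simp add: space_prob_algebra)
  show "emeasure (split_kernel M B \<delta> \<nu> (x, False) u) A
      = (\<integral>\<^sup>+y. fold_split B \<delta> (indicator A) y \<partial>total_ker M (x, u))" if "x \<notin> B"
    using that xu k
    by (simp add: split_kernel_def split_measure_eq_lift[OF B \<delta>] emeasure_lift[OF B \<delta> _ A] Let_def flip: total_ker_graph)
  assume x: "x \<in> B"
  interpret K: taboo_kernel "\<lambda>_. total_ker M (x, u)" B \<delta> \<nu> by (rule taboo_constant[OF x xu])
  have split: "((\<integral>\<^sup>+y. fold_split B \<delta> (indicator A) y \<partial>total_ker M (x, u))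
          - ennreal \<delta> * (\<integral>\<^sup>+y. fold_split B \<delta> (indicator A) y \<partial>\<nu>)) / ennreal (1 - \<delta>)
      = ennreal (1 / (1 - \<delta>)) * (\<integral>\<^sup>+y. fold_split B \<delta> (indicator A) y \<partial>K.taboo x)"
    if A: "A \<in> sets (split_space B)" for A
  proof -
    note meas = fold_split_indicator_measurable[OF B \<delta> A]
    have fin: "ennreal \<delta> * (\<integral>\<^sup>+y. fold_split B \<delta> (indicator A) y \<partial>\<nu>) \<noteq> \<top>"
      using nn_integral_fold_split_indicator_le[OF B \<delta> K.prob_\<nu>, of A]
      by (auto simp: ennreal_mult_eq_top_iff top_unique)
    have "(\<integral>\<^sup>+y. fold_split B \<delta> (indicator A) y \<partial>total_ker M (x, u))
        = (\<integral>\<^sup>+y. fold_split B \<delta> (indicator A) y \<partial>K.taboo x) + ennreal \<delta> * (\<integral>\<^sup>+y. fold_split B \<delta> (indicator A) y \<partial>\<nu>)"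
      using K.nn_integral_P[OF meas, of x] x by (simp add: K.regen_def)
    then have "(\<integral>\<^sup>+y. fold_split B \<delta> (indicator A) y \<partial>total_ker M (x, u))
          - ennreal \<delta> * (\<integral>\<^sup>+y. fold_split B \<delta> (indicator A) y \<partial>\<nu>)
        = (\<integral>\<^sup>+y. fold_split B \<delta> (indicator A) y \<partial>K.taboo x)"
      using ennreal_add_diff_cancel_right[OF fin] by simp
    then show ?thesis
      using \<delta> by (simp add: divide_ennreal_def inverse_ennreal mult.commute inverse_eq_divide)
  qed
  have "emeasure (split_kernel M B \<delta> \<nu> (x, False) u) A
      = ennreal (1 / (1 - \<delta>)) * (\<integral>\<^sup>+y. fold_split B \<delta> (indicator A) y \<partial>K.taboo x)"
    unfolding split_kernel_def Let_def using x
    by (simp, intro emeasure_measure_of_lift[OF B \<delta> _ A])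
       (auto simp: split_measure_eq_lift[OF B \<delta>] m emeasure_lift[OF B \<delta>] split[symmetric] K.sets_P
          total_ker_graph[OF xu, symmetric] k)
  with split[OF A] show "emeasure (split_kernel M B \<delta> \<nu> (x, False) u) A
      = ((\<integral>\<^sup>+y. fold_split B \<delta> (indicator A) y \<partial>total_ker M (x, u))
          - ennreal \<delta> * (\<integral>\<^sup>+y. fold_split B \<delta> (indicator A) y \<partial>\<nu>)) / ennreal (1 - \<delta>)"
    by simp
qed

text \<open>The link between the two pictures: from \<open>(x, False)\<close> the split chain moves
  by the normalized taboo kernel and the new position is distributed over the levels; from the atom
  it restarts with the split version of \<nu>.\<close>

lemma split_kernel_policy_eq_lift:
  "split_kernel_policy M B \<delta> \<nu> v (x, True) = lift B \<delta> 1 \<nu>"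
  "split_kernel_policy M B \<delta> \<nu> v (x, False)
    = lift B \<delta> (inverse (atom_weight B \<delta> x)) (taboo_kernel.taboo (policy_kernel v) B \<delta> \<nu> x)"
proof -
  interpret P: taboo_kernel "policy_kernel v" B \<delta> \<nu> by (rule taboo_policy)
  interpret v: prob_space "v x" by (rule prob_policy)
  have space_v: "space (v x) = UNIV" using sets_eq_imp_space_eq[OF sets_policy[of x]] by simp
  show "split_kernel_policy M B \<delta> \<nu> v (x, True) = lift B \<delta> 1 \<nu>"
    unfolding split_kernel_policy_def
    by (rule measure_of_eq_lift[OF B \<delta>])
       (use v.emeasure_space_1 in \<open>simp_all add: split_kernel_def split_measure_eq_lift[OF B \<delta>] emeasure_lift[OF B \<delta>] space_v\<close>)
  show "split_kernel_policy M B \<delta> \<nu> v (x, False)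
      = lift B \<delta> (inverse (atom_weight B \<delta> x)) (P.taboo x)"
    unfolding split_kernel_policy_def
  proof (rule measure_of_eq_lift[OF B \<delta>])
    fix A assume A: "A \<in> sets (split_space B)"
    note meas = fold_split_indicator_measurable[OF B \<delta> A]
    let ?h = "\<lambda>u. \<integral>\<^sup>+y. fold_split B \<delta> (indicator A) y \<partial>total_ker M (x, u)"
    have h[measurable]: "?h \<in> borel_measurable (v x)"
      using total_ker_integral_measurable[OF meas] by (simp add: measurable_cong_sets[OF sets_policy refl])
    have int_h: "(\<integral>\<^sup>+u. ?h u \<partial>v x) = (\<integral>\<^sup>+y. fold_split B \<delta> (indicator A) y \<partial>P.taboo x)
        + P.regen x * (\<integral>\<^sup>+y. fold_split B \<delta> (indicator A) y \<partial>\<nu>)"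
      using nn_integral_policy_kernel[OF meas, of x] P.nn_integral_P[OF meas, of x] by simp
    show "(\<integral>\<^sup>+u. emeasure (split_kernel M B \<delta> \<nu> (x, False) u) A \<partial>v (fst (x, False)))
        = inverse (atom_weight B \<delta> x) * (\<integral>\<^sup>+y. fold_split B \<delta> (indicator A) y \<partial>P.taboo x)"
    proof (cases "x \<in> B")
      case False
      have "(\<integral>\<^sup>+u. emeasure (split_kernel M B \<delta> \<nu> (x, False) u) A \<partial>v x) = (\<integral>\<^sup>+u. ?h u \<partial>v x)"
        using AE_graph[of x] by (intro nn_integral_cong_AE) (auto simp: split_kernel_eq_lift(2)[OF _ A P.sets_\<nu> False])
      with int_h False show ?thesis by (simp add: P.regen_def atom_weight_def)
    next
      case True
      let ?n = "ennreal \<delta> * (\<integral>\<^sup>+y. fold_split B \<delta> (indicator A) y \<partial>\<nu>)"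
      have le: "?n \<le> ?h u" if "(x, u) \<in> graph M" for u
      proof -
        interpret K: taboo_kernel "\<lambda>_. total_ker M (x, u)" B \<delta> \<nu> by (rule taboo_constant[OF True that])
        show ?thesis using K.nn_integral_P[OF meas, of x] True by (simp add: K.regen_def)
      qed
      have fin: "?n \<noteq> \<top>"
        using nn_integral_fold_split_indicator_le[OF B \<delta> P.prob_\<nu>, of A]
        by (auto simp: ennreal_mult_eq_top_iff top_unique)
      have "(\<integral>\<^sup>+u. emeasure (split_kernel M B \<delta> \<nu> (x, False) u) A \<partial>v x)
          = (\<integral>\<^sup>+u. (?h u - ?n) / ennreal (1 - \<delta>) \<partial>v x)"
        using AE_graph[of x] by (intro nn_integral_cong_AE) (auto simp: split_kernel_eq_lift(1)[OF _ A P.sets_\<nu> True])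
      also have "\<dots> = (\<integral>\<^sup>+u. ?h u - ?n \<partial>v x) / ennreal (1 - \<delta>)"
        by (rule nn_integral_divide) measurable
      also have "(\<integral>\<^sup>+u. ?h u - ?n \<partial>v x) = (\<integral>\<^sup>+u. ?h u \<partial>v x) - (\<integral>\<^sup>+u. ?n \<partial>v x)"
        using AE_graph[of x] fin v.emeasure_space_1 le
        by (intro nn_integral_diff) (auto simp: infinity_ennreal_def)
      also have "\<dots> = (\<integral>\<^sup>+y. fold_split B \<delta> (indicator A) y \<partial>P.taboo x)"
        unfolding int_h using True v.emeasure_space_1 ennreal_add_diff_cancel_right[OF fin]
        by (simp add: P.regen_def)
      finally show ?thesis
        using True by (simp add: divide_ennreal_def atom_weight_def mult.commute)
    qed
  qed simp
qed

end

end

section \<open>Cycle costs of the split chain as sums over the taboo kernel\<close>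

context split_mdp
begin

lemma atom_weight_pos: "atom_weight B \<delta> x \<noteq> 0" and atom_weight_finite: "atom_weight B \<delta> x \<noteq> \<top>"
  using \<delta> by (auto simp: atom_weight_def indicator_def)

lemma atom_weight_inverse: "atom_weight B \<delta> x * inverse (atom_weight B \<delta> x) = 1"
  using ennreal_divide_self[of "atom_weight B \<delta> x"] atom_weight_pos[of x] atom_weight_finite[of x]
  by (simp add: divide_ennreal_def less_top)

context
  fixes v :: "'x \<Rightarrow> 'u measure" assumes v: "v \<in> stationary_policies M"
begin

lemma policy_cost_measurable[measurable]: "policy_cost v \<in> borel_measurable borel"
  unfolding policy_cost_def[abs_def]
  by (rule nn_integral_measurable_subprob_algebra2[OF _ policy_measurable(2)[OF v]]) (simp add: borel_prod)

lemma split_cost_policy_eq: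
  "split_cost_policy M B \<delta> v s
    = (if snd s then 0 else inverse (atom_weight B \<delta> (fst s)) * policy_cost v (fst s))"
proof -
  let ?x = "fst s"
  have "(\<integral>\<^sup>+u. split_cost M B \<delta> s u \<partial>v ?x)
      = (\<integral>\<^sup>+u. (if snd s then 0 else inverse (atom_weight B \<delta> ?x) * tcost (?x, u)) \<partial>v ?x)"
    using AE_graph[OF v, of ?x]
    by (intro nn_integral_cong_AE)
       (auto simp: split_cost_def tcost_graph atom_weight_def divide_ennreal_def mult.commute elim!: eventually_mono)
  also have "\<dots> = (if snd s then 0 else inverse (atom_weight B \<delta> ?x) * policy_cost v ?x)"
    unfolding policy_cost_def using tcost_Pair[of ?x]
    by (auto intro!: nn_integral_cmult simp: measurable_cong_sets[OF sets_policy[OF v] refl])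
  finally show ?thesis by (simp add: split_cost_policy_def)
qed

lemma atom_weight_split_cost: "atom_weight B \<delta> x * split_cost_policy M B \<delta> v (x, False) = policy_cost v x"
  by (simp add: split_cost_policy_eq mult.assoc[symmetric] atom_weight_inverse)

lemma split_cost_policy_measurable: "split_cost_policy M B \<delta> v \<in> borel_measurable (split_space B)"
proof -
  note [measurable] = measurable_fst_split[OF B \<delta>] measurable_snd_split[OF B \<delta>] atom_weight_measurable[OF B \<delta>]
  have "(\<lambda>s. if snd s then 0 else inverse (atom_weight B \<delta> (fst s)) * policy_cost v (fst s))
      \<in> borel_measurable (split_space B)"
    by measurable
  then show ?thesis by (simp add: split_cost_policy_eq[abs_def])
qed

lemma split_kernel_policy_prob:
  assumes s: "s \<in> split_states B"
  shows "prob_space (split_kernel_policy M B \<delta> \<nu> v s)" "sets (split_kernel_policy M B \<delta> \<nu> v s) = sets (split_space B)"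
proof -
  interpret P: taboo_kernel "policy_kernel v" B \<delta> \<nu> by (rule taboo_policy[OF v])
  show sets: "sets (split_kernel_policy M B \<delta> \<nu> v s) = sets (split_space B)"
    using split_kernel_policy_eq_lift[OF v] by (cases s; cases "snd s") (auto simp: sets_lift[OF B \<delta>])
  have one: "fold_split B \<delta> (indicator (split_states B)) y = 1" for y
    using \<delta> by (auto simp: fold_split_def split_states_def atom_weight_def indicator_def simp flip: ennreal_plus)
  have top: "split_states B \<in> sets (split_space B)"
    using sets.top[of "split_space B"] by (simp add: space_split_space[OF B \<delta>])
  have "emeasure (split_kernel_policy M B \<delta> \<nu> v s) (split_states B) = 1"
  proof (cases s)
    case (Pair x b)
    show ?thesis
    proof (cases b)
      case True
      then show ?thesis
        using Pair prob_space.emeasure_space_1[OF P.prob_\<nu>]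
        by (simp add: split_kernel_policy_eq_lift[OF v] emeasure_lift[OF B \<delta> _ top] one)
    next
      case False
      then have "emeasure (split_kernel_policy M B \<delta> \<nu> v s) (split_states B)
          = inverse (atom_weight B \<delta> x) * P.T (\<lambda>_. 1) x"
        using Pair by (simp add: split_kernel_policy_eq_lift[OF v] emeasure_lift[OF B \<delta> _ top] one P.T_def)
      then show ?thesis
        by (simp add: taboo_one_eq_atom_weight[OF v] atom_weight_inverse mult.commute[of "inverse _"])
    qed
  qed
  then show "prob_space (split_kernel_policy M B \<delta> \<nu> v s)"
    using sets_eq_imp_space_eq[OF sets] by (intro prob_spaceI) (simp add: space_split_space[OF B \<delta>])
qed

lemma split_kernel_policy_measurable:
  "split_kernel_policy M B \<delta> \<nu> v \<in> split_space B \<rightarrow>\<^sub>M subprob_algebra (split_space B)"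
proof (rule measurable_subprob_algebra)
  interpret P: taboo_kernel "policy_kernel v" B \<delta> \<nu> by (rule taboo_policy[OF v])
  fix A assume A: "A \<in> sets (split_space B)"
  note [measurable] = measurable_fst_split[OF B \<delta>] measurable_snd_split[OF B \<delta>] atom_weight_measurable[OF B \<delta>]
    fold_split_indicator_measurable[OF B \<delta> A]
  have [measurable]: "P.T (fold_split B \<delta> (indicator A)) \<in> borel_measurable borel"
    by (rule P.T_measurable) simp
  have "emeasure (split_kernel_policy M B \<delta> \<nu> v s) A
      = (if snd s then \<integral>\<^sup>+y. fold_split B \<delta> (indicator A) y \<partial>\<nu>
         else inverse (atom_weight B \<delta> (fst s)) * P.T (fold_split B \<delta> (indicator A)) (fst s))" for s
    by (cases s; cases "snd s")
       (auto simp: split_kernel_policy_eq_lift[OF v] emeasure_lift[OF B \<delta> _ A] P.T_def)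
  moreover have "(\<lambda>s. if snd s then \<integral>\<^sup>+y. fold_split B \<delta> (indicator A) y \<partial>\<nu>
         else inverse (atom_weight B \<delta> (fst s)) * P.T (fold_split B \<delta> (indicator A)) (fst s))
      \<in> borel_measurable (split_space B)"
    by measurable
  ultimately show "(\<lambda>s. emeasure (split_kernel_policy M B \<delta> \<nu> v s) A) \<in> borel_measurable (split_space B)"
    by simp
qed (auto simp: split_kernel_policy_prob space_split_space[OF B \<delta>] intro: prob_space_imp_subprob_space)

text \<open>
  Multiplication by \<^const>\<open>atom_weight\<close> turns the split chain killed at the atom into the
  taboo kernel.
\<close>

lemma cycle_mean_eq:
  assumes g: "g \<in> borel_measurable (split_space B)"
  shows "atom_weight B \<delta> x * cycle_mean M B \<delta> \<nu> v (x, False) g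
    = (\<Sum>k. (Tv v ^^ k) (\<lambda>y. atom_weight B \<delta> y * g (y, False)) x)"
proof -
  interpret P: taboo_kernel "policy_kernel v" B \<delta> \<nu> by (rule taboo_policy[OF v])
  define D where "D = split_states B - B \<times> {True}"
  define R where "R g s = (\<integral>\<^sup>+y. indicator D y * g y \<partial>split_kernel_policy M B \<delta> \<nu> v s)"
    for g :: "'x \<times> bool \<Rightarrow> ennreal" and s
  have D[measurable]: "D \<in> sets (split_space B)"
    using sets.compl_sets[OF split_atom_measurable[OF B \<delta>]] by (simp add: D_def space_split_space[OF B \<delta>])
  have s: "(x, False) \<in> space (split_space B)" for x
    by (simp add: space_split_space[OF B \<delta>] split_states_def)
  have R_meas: "R g \<in> borel_measurable (split_space B)" if "g \<in> borel_measurable (split_space B)" for g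
    unfolding R_def[abs_def] using that
    by (intro nn_integral_measurable_subprob_algebra2[OF _ split_kernel_policy_measurable]) simp
  have Rk_meas: "(R ^^ k) g \<in> borel_measurable (split_space B)" for k
    by (induction k) (auto intro: R_meas g)
  \<comment> \<open>Survivors are on level 0 only, so \<open>fold_split\<close> reduces to the
    factor \<open>atom_weight\<close>. It cancels the normalization of the following step, which is
    why the conjugated operator is exactly \<open>T\<close>.\<close>
  have R: "atom_weight B \<delta> x * R g (x, False) = P.T (\<lambda>y. atom_weight B \<delta> y * g (y, False)) x"
    if g: "g \<in> borel_measurable (split_space B)" for g x
  proof -
    have "R g (x, False) = inverse (atom_weight B \<delta> x) * (\<integral>\<^sup>+y. fold_split B \<delta> (\<lambda>s. indicator D s * g s) y \<partial>P.taboo x)"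
      unfolding R_def split_kernel_policy_eq_lift[OF v]
      by (rule nn_integral_lift[OF B \<delta>]) (use g in simp_all)
    also have "fold_split B \<delta> (\<lambda>s. indicator D s * g s) = (\<lambda>y. atom_weight B \<delta> y * g (y, False))"
      by (auto simp: fun_eq_iff fold_split_def D_def split_states_def indicator_def)
    finally show ?thesis
      by (simp add: P.T_def atom_weight_inverse mult.assoc[symmetric])
  qed
  have Rk: "atom_weight B \<delta> x * (R ^^ k) g (x, False) = (P.T ^^ k) (\<lambda>y. atom_weight B \<delta> y * g (y, False)) x" for k x
  proof (induction k arbitrary: x)
    case (Suc k)
    then show ?case using R[OF Rk_meas, of x k] by simp
  qed simp
  have "cycle_mean M B \<delta> \<nu> v (x, False) g = (\<integral>\<^sup>+\<omega>. (\<Sum>k. if \<forall>i\<in>{1..k}. \<omega> i \<notin> B \<times> {True} then g (\<omega> k) else 0)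
        \<partial>path_law (\<lambda>n h. case n of 0 \<Rightarrow> return (split_space B) (x, False)
          | Suc m \<Rightarrow> split_kernel_policy M B \<delta> \<nu> v (h m)) (split_space B))"
    unfolding cycle_mean_def split_law_def less_hit_time_iff[OF B \<delta>] ..
  also have "\<dots> = (\<Sum>k. (R ^^ k) g (x, False))"
    unfolding R_def[abs_def]
    by (rule nn_integral_path_law_killed[OF split_kernel_policy_measurable _ s D g])
       (auto simp: split_kernel_policy_prob space_split_space[OF B \<delta>] D_def)
  finally show ?thesis
    by (simp add: ennreal_suminf_cmult[symmetric] Rk del: ennreal_suminf_cmult)
qed

end

text \<open>\<open>atom_weight\<close> times the positive part of the split cost minus \<beta> on
  level 0; \<open>saved_cost\<close> is the negative part. At most one of them is nonzero at a
  point.\<close>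

definition excess_cost :: "('x \<Rightarrow> 'u measure) \<Rightarrow> 'x \<Rightarrow> ennreal" where
  "excess_cost v y = policy_cost v y - beta M * atom_weight B \<delta> y"

definition saved_cost :: "('x \<Rightarrow> 'u measure) \<Rightarrow> 'x \<Rightarrow> ennreal" where
  "saved_cost v y = beta M * atom_weight B \<delta> y - policy_cost v y"

lemma excess_cost_measurable: "v \<in> stationary_policies M \<Longrightarrow> excess_cost v \<in> borel_measurable borel"
  and saved_cost_measurable: "v \<in> stationary_policies M \<Longrightarrow> saved_cost v \<in> borel_measurable borel"
  unfolding excess_cost_def[abs_def] saved_cost_def[abs_def]
  using policy_cost_measurable[of v] atom_weight_measurable[OF B \<delta>] by measurable

lemma excess_add: "policy_cost v y + saved_cost v y = beta M * atom_weight B \<delta> y + excess_cost v y"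
proof -
  have fin: "beta M * atom_weight B \<delta> y < \<top>"
    using beta_finite atom_weight_finite[of y] by (simp add: ennreal_mult_less_top less_top)
  show ?thesis
  proof (cases "policy_cost v y \<le> beta M * atom_weight B \<delta> y")
    case True
    then show ?thesis
      unfolding excess_cost_def saved_cost_def
      using le_less_trans[OF True fin] by (simp add: add_diff_inverse_ennreal diff_eq_0_ennreal)
  next
    case False
    then have "beta M * atom_weight B \<delta> y \<le> policy_cost v y" by simp
    then show ?thesis
      unfolding excess_cost_def saved_cost_def
      using fin by (simp add: add_diff_inverse_ennreal diff_eq_0_ennreal)
  qed
qed

definition total_excess :: "('x \<Rightarrow> 'u measure) \<Rightarrow> 'x \<Rightarrow> ennreal" where
  "total_excess v x = (\<Sum>k. (Tv v ^^ k) (excess_cost v) x)"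

definition total_saved :: "('x \<Rightarrow> 'u measure) \<Rightarrow> 'x \<Rightarrow> ennreal" where
  "total_saved v x = (\<Sum>k. (Tv v ^^ k) (saved_cost v) x)"

lemma atom_weight_cycle_mean:
  assumes v: "v \<in> stationary_policies M"
  shows "atom_weight B \<delta> x * cycle_mean M B \<delta> \<nu> v (x, False) (\<lambda>s. split_cost_policy M B \<delta> v s - beta M) = total_excess v x"
    and "atom_weight B \<delta> x * cycle_mean M B \<delta> \<nu> v (x, False) (\<lambda>s. beta M - split_cost_policy M B \<delta> v s) = total_saved v x"
proof -
  note [measurable] = split_cost_policy_measurable[OF v]
  have *: "(\<lambda>s. split_cost_policy M B \<delta> v s - beta M) \<in> borel_measurable (split_space B)"
    "(\<lambda>s. beta M - split_cost_policy M B \<delta> v s) \<in> borel_measurable (split_space B)"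
    by measurable
  show "atom_weight B \<delta> x * cycle_mean M B \<delta> \<nu> v (x, False) (\<lambda>s. split_cost_policy M B \<delta> v s - beta M) = total_excess v x"
    "atom_weight B \<delta> x * cycle_mean M B \<delta> \<nu> v (x, False) (\<lambda>s. beta M - split_cost_policy M B \<delta> v s) = total_saved v x"
    unfolding cycle_mean_eq[OF v *(1)] cycle_mean_eq[OF v *(2)] total_excess_def total_saved_def
    by (simp_all add: ennreal_right_diff_distrib atom_weight_finite atom_weight_split_cost[OF v]
        excess_cost_def[abs_def] saved_cost_def[abs_def] mult.commute[of "beta M"])
qed

text \<open>Together the two parts identify \<open>V_star\<close> as the infimum of
  \<open>total_excess - total_saved\<close>: the factor \<open>1 - \<delta>\<close> in its
  definition on \<open>B\<close> is \<open>atom_weight\<close>. Finite savings exclude differences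
  of two infinities.\<close>

lemma V_star_bounds:
  assumes saved: "\<And>v. v \<in> stationary_policies M \<Longrightarrow> total_saved v x < \<infinity>"
  shows "v \<in> stationary_policies M \<Longrightarrow> V_star M B \<delta> \<nu> x \<le> enn2ereal (total_excess v x) - enn2ereal (total_saved v x)"
    and "(\<And>v. v \<in> stationary_policies M \<Longrightarrow> z \<le> enn2ereal (total_excess v x) - enn2ereal (total_saved v x))
      \<Longrightarrow> z \<le> V_star M B \<delta> \<nu> x"
proof -
  define w where "w = 1 - \<delta> * indicator B x"
  have w: "0 < w" "atom_weight B \<delta> x = ennreal w"
    using \<delta> by (auto simp: w_def atom_weight_def indicator_def)
  define f where "f v = enn2ereal (cycle_mean M B \<delta> \<nu> v (x, False) (\<lambda>s. split_cost_policy M B \<delta> v s - beta M))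
     - enn2ereal (cycle_mean M B \<delta> \<nu> v (x, False) (\<lambda>s. beta M - split_cost_policy M B \<delta> v s))" for v
  have V: "V_star M B \<delta> \<nu> x = ereal w * (INF v\<in>stationary_policies M. f v)"
    by (simp add: V_star_def V_star_split_def f_def w_def)
  have f: "ereal w * f v = enn2ereal (total_excess v x) - enn2ereal (total_saved v x)" if v: "v \<in> stationary_policies M" for v
  proof -
    let ?a = "cycle_mean M B \<delta> \<nu> v (x, False) (\<lambda>s. split_cost_policy M B \<delta> v s - beta M)"
    let ?b = "cycle_mean M B \<delta> \<nu> v (x, False) (\<lambda>s. beta M - split_cost_policy M B \<delta> v s)"
    have ab: "total_excess v x = ennreal w * ?a" "total_saved v x = ennreal w * ?b"
      using atom_weight_cycle_mean[OF v, of x] w(2) by auto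
    have "?b \<noteq> \<top>" using saved[OF v] ab(2) w(1) by (auto simp: ennreal_mult_top)
    then obtain b where "?b = ennreal b" "b \<ge> 0" by (cases ?b) auto
    then show ?thesis
      unfolding f_def ab using w(1)
      by (cases ?a) (auto simp: ennreal_mult_top ennreal_mult[symmetric] right_diff_distrib)
  qed
  show "V_star M B \<delta> \<nu> x \<le> enn2ereal (total_excess v x) - enn2ereal (total_saved v x)" if v: "v \<in> stationary_policies M"
    unfolding V f[OF v, symmetric] using w(1) v by (intro ereal_mult_left_mono INF_lower) auto
  assume z: "\<And>v. v \<in> stationary_policies M \<Longrightarrow> z \<le> enn2ereal (total_excess v x) - enn2ereal (total_saved v x)"
  have "z / ereal w \<le> f v" if "v \<in> stationary_policies M" for v
    using z[OF that] f[OF that] w(1) by (subst ereal_divide_le_pos) auto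
  then have "z / ereal w \<le> (INF v\<in>stationary_policies M. f v)" by (rule INF_greatest)
  then show "z \<le> V_star M B \<delta> \<nu> x"
    unfolding V using w(1) by (subst (asm) ereal_divide_le_pos) auto
qed

end

section \<open>The optimality equation along a cycle\<close>

text \<open>Adding a lower bound trades the signed extended integral for a nonnegative one. The
  constant may have either sign, hence the case distinctions.\<close>

lemma eint_add_const:
  assumes N: "prob_space N" and f[measurable]: "f \<in> borel_measurable N" and C: "\<And>x. - C \<le> f x"
  shows "eint N (\<lambda>x. ereal (f x)) + ereal C = enn2ereal (\<integral>\<^sup>+x. ennreal (f x + C) \<partial>N)"
proof -
  interpret prob_space N by fact
  define p n where "p = (\<integral>\<^sup>+x. ennreal (f x) \<partial>N)" and "n = (\<integral>\<^sup>+x. ennreal (- f x) \<partial>N)"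
  have e: "eint N (\<lambda>x. ereal (f x)) = enn2ereal p - enn2ereal n"
    by (simp add: eint_def p_def n_def ennreal_def[symmetric] e2ennreal_ereal)
  have n: "n \<le> ennreal \<bar>C\<bar>"
  proof -
    have "n \<le> (\<integral>\<^sup>+x. ennreal \<bar>C\<bar> \<partial>N)"
      unfolding n_def using C by (intro nn_integral_mono ennreal_leI) (metis abs_ge_self neg_le_iff_le minus_minus order.trans)
    then show ?thesis by (simp add: emeasure_space_1)
  qed
  then obtain n' where n': "n = ennreal n'" "0 \<le> n'" by (cases n) (auto simp: top_unique)
  have "(\<integral>\<^sup>+x. ennreal (f x + C) \<partial>N) + n + ennreal (- C) = p + ennreal C"
  proof -
    have "ennreal (f x + C) + ennreal (- f x) + ennreal (- C) = ennreal (f x) + ennreal C" for x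
      using C[of x] by (cases "0 \<le> f x"; cases "0 \<le> C") (auto simp: ennreal_neg simp flip: ennreal_plus)
    then have "(\<integral>\<^sup>+x. ennreal (f x + C) + ennreal (- f x) + ennreal (- C) \<partial>N) = (\<integral>\<^sup>+x. ennreal (f x) + ennreal C \<partial>N)"
      by (simp only:)
    then show ?thesis
      by (simp add: nn_integral_add p_def n_def emeasure_space_1)
  qed
  then show ?thesis
    unfolding e n'
    by (cases "\<integral>\<^sup>+x. ennreal (f x + C) \<partial>N"; cases p; cases "0 \<le> C")
       (use n'(2) in \<open>auto simp: ennreal_neg top_add add_top simp flip: ennreal_plus\<close>)
qed

locale acoe_mdp = split_mdp +
  fixes V :: "'a \<Rightarrow> real" and f :: "'a \<Rightarrow> 'b" and \<epsilon> C\<^sub>0 b C :: real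
  assumes \<epsilon>: "0 < \<epsilon>" "\<And>x u. (x, u) \<in> graph M \<Longrightarrow> x \<notin> B \<Longrightarrow> beta M + ennreal \<epsilon> \<le> cost M (x, u)"
    and V_eq_V_star: "\<And>x. ereal (V x) = V_star M B \<delta> \<nu> x"
    and V_measurable[measurable]: "V \<in> borel_measurable borel" and V_ge: "0 \<le> C\<^sub>0" "\<And>x. - C\<^sub>0 \<le> V x"
    and acoe: "solves_acoe M V" and selector: "minimizing_selector M V f"
    and b: "0 \<le> b" "beta M = ennreal b"
    and C: "C = C\<^sub>0 + (b + \<epsilon>) / \<delta>"
begin

text \<open>The constant is chosen so that \<open>V + C\<close> is at least \<open>b\<close>, which
  makes \<open>\<kappa>\<close> nonnegative, and so that \<open>\<delta> * C\<close> pays for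
  \<open>b + \<epsilon>\<close>, which produces the drift on \<open>B\<close> in
  \<open>step_lower_drift\<close>.\<close>

lemma C_bounds: "0 \<le> C" "b + \<epsilon> \<le> \<delta> * C" "- C \<le> V x" "b \<le> V x + C"
proof -
  have "b + \<epsilon> \<le> (b + \<epsilon>) / \<delta>" using \<delta> b \<epsilon>(1) by (simp add: le_divide_eq mult_left_le)
  then show "0 \<le> C" "- C \<le> V x" "b \<le> V x + C" using V_ge(1) V_ge(2)[of x] b \<epsilon>(1) by (simp_all add: C)
  show "b + \<epsilon> \<le> \<delta> * C" using \<delta> V_ge(1) by (simp add: C field_simps)
qed

definition Y :: "'a \<Rightarrow> ennreal" where
  "Y x = ennreal (V x + C)"

lemma Y_measurable[measurable]: "Y \<in> borel_measurable borel"
  unfolding Y_def[abs_def] by measurable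

lemma Y_finite: "Y x < \<infinity>"
  by (simp add: Y_def)

lemma prob_total_ker: "prob_space (total_ker M p)" and sets_total_ker: "sets (total_ker M p) = sets borel"
  using measurable_space[OF total_ker_measurable, of p] by (auto simp: space_prob_algebra)

lemma eint_V: "eint (total_ker M p) (\<lambda>y. ereal (V y)) + ereal C = enn2ereal (\<integral>\<^sup>+y. Y y \<partial>total_ker M p)"
  unfolding Y_def
  by (rule eint_add_const[OF prob_total_ker _ C_bounds(3)]) (simp add: measurable_cong_sets[OF sets_total_ker refl])

text \<open>Adding \<open>C\<close> and \<open>b\<close> compensates the negative values of
  \<open>V\<close> and the subtraction of \<beta>, so the optimality equation becomes a relation
  between nonnegative quantities.\<close>

lemma acoe_rhs_eq:
  assumes "(x, u) \<in> graph M"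
  shows "acoe_rhs M V x u + ereal C + ereal b = enn2ereal (tcost (x, u) + (\<integral>\<^sup>+y. Y y \<partial>total_ker M (x, u)))"
proof -
  let ?e = "eint (total_ker M (x, u)) (\<lambda>y. ereal (V y))"
  have "?e \<noteq> - \<infinity>"
    using eint_V[of "(x, u)"] by (cases "\<integral>\<^sup>+y. Y y \<partial>total_ker M (x, u)") auto
  moreover have "acoe_rhs M V x u = enn2ereal (tcost (x, u)) - ereal b + ?e"
    using assms b by (simp add: acoe_rhs_def tcost_graph total_ker_graph)
  ultimately have "acoe_rhs M V x u + ereal C + ereal b = enn2ereal (tcost (x, u)) + (?e + ereal C)"
    by (cases ?e; cases "tcost (x, u)") auto
  also have "\<dots> = enn2ereal (tcost (x, u) + (\<integral>\<^sup>+y. Y y \<partial>total_ker M (x, u)))"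
    by (simp add: eint_V plus_ennreal.rep_eq)
  finally show ?thesis .
qed

lemma Y_beta: "enn2ereal (Y x + ennreal b) = ereal (V x) + ereal C + ereal b"
  using C_bounds(3)[of x] b by (simp add: Y_def enn2ereal_ennreal flip: ennreal_plus)

lemma Y_le:
  assumes "(x, u) \<in> graph M"
  shows "Y x + ennreal b \<le> tcost (x, u) + (\<integral>\<^sup>+y. Y y \<partial>total_ker M (x, u))"
proof -
  have "ereal (V x) \<le> acoe_rhs M V x u"
    using acoe assms by (metis solves_acoe_def graph_iff)
  then have "enn2ereal (Y x + ennreal b) \<le> acoe_rhs M V x u + ereal C + ereal b"
    unfolding Y_beta by (intro add_right_mono)
  then show ?thesis by (simp only: acoe_rhs_eq[OF assms] less_eq_ennreal.rep_eq)
qed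

lemma f_graph: "(x, f x) \<in> graph M"
  using selector by (simp add: minimizing_selector_def graph_iff)

lemma Y_eq: "Y x + ennreal b = tcost (x, f x) + (\<integral>\<^sup>+y. Y y \<partial>total_ker M (x, f x))"
proof -
  have "ereal (V x) = acoe_rhs M V x (f x)"
    using acoe selector f_graph[of x] by (metis solves_acoe_def minimizing_selector_def graph_iff order.antisym)
  then have "enn2ereal (Y x + ennreal b) = acoe_rhs M V x (f x) + ereal C + ereal b"
    unfolding Y_beta by simp
  then show ?thesis by (simp only: acoe_rhs_eq[OF f_graph] enn2ereal_inject)
qed

abbreviation "opt \<equiv> dirac_policy f"

lemma f_measurable: "f \<in> borel \<rightarrow>\<^sub>M borel"
  using selector by (simp add: minimizing_selector_def)

lemma opt_stationary: "opt \<in> stationary_policies M"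
proof -
  have "opt \<in> borel \<rightarrow>\<^sub>M prob_algebra borel"
    unfolding dirac_policy_def by (rule measurable_compose[OF f_measurable measurable_return_prob_space])
  moreover have "emeasure (opt x) (actions M x) = 1" for x
    using actions(2)[of x] f_graph[of x] by (simp add: dirac_policy_def graph_iff)
  ultimately show ?thesis by (simp add: stationary_policies_def)
qed

lemma policy_kernel_opt: "policy_kernel opt x = total_ker M (x, f x)"
  unfolding policy_kernel_def dirac_policy_def
  by (rule bind_return[OF measurable_prob_algebraD[OF total_ker_Pair]]) simp

lemma policy_cost_opt: "policy_cost opt x = tcost (x, f x)"
  using tcost_Pair[of x] by (simp add: policy_cost_def dirac_policy_def nn_integral_return)

lemma opt_kernel: "taboo_kernel (policy_kernel opt) B \<delta> \<nu>"
  by (rule taboo_policy[OF opt_stationary])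

sublocale opt: taboo_kernel "policy_kernel (dirac_policy f)" B \<delta> \<nu>
  by (rule opt_kernel)

lemma nn_integral_Y_opt_finite: "(\<integral>\<^sup>+y. Y y \<partial>policy_kernel opt x) < \<infinity>"
proof -
  have "(\<integral>\<^sup>+y. Y y \<partial>policy_kernel opt x) \<le> Y x + ennreal b"
    unfolding policy_kernel_opt Y_eq by simp
  also have "\<dots> < \<infinity>" by (simp add: Y_def)
  finally show ?thesis .
qed

lemma B_nonempty: "B \<noteq> {}"
  using \<nu>(2) by auto

text \<open>At a point of \<open>B\<close> the minorization bounds \<delta> times this integral by
  the integral of \<open>Y\<close> under the optimal action, which the optimality equation keeps
  finite.\<close>

lemma nn_integral_\<nu>_Y_finite: "(\<integral>\<^sup>+y. Y y \<partial>\<nu>) < \<infinity>"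
proof -
  obtain x where "x \<in> B" using B_nonempty by auto
  then have "ennreal \<delta> * (\<integral>\<^sup>+y. Y y \<partial>\<nu>) \<le> (\<integral>\<^sup>+y. Y y \<partial>policy_kernel opt x)"
    by (subst opt.nn_integral_P) (auto simp: opt.regen_def)
  also have "\<dots> < \<infinity>" by (rule nn_integral_Y_opt_finite)
  finally show ?thesis using \<delta> by (auto simp: ennreal_mult_less_top)
qed

text \<open>The value returned at regeneration. Formally it is \<open>\<nu>(V) + C - b\<close>, so
  \<open>\<kappa> = C\<close> means that \<open>V\<close> has \<nu>-integral \<beta>.\<close>

definition \<kappa> :: real where
  "\<kappa> = enn2real (\<integral>\<^sup>+y. Y y \<partial>\<nu>) - b"

lemma \<kappa>: "0 \<le> \<kappa>" "(\<integral>\<^sup>+y. Y y \<partial>\<nu>) = ennreal \<kappa> + ennreal b"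
proof -
  have "ennreal b = (\<integral>\<^sup>+y. ennreal b \<partial>\<nu>)"
    using prob_space.emeasure_space_1[OF opt.prob_\<nu>] by simp
  also have "\<dots> \<le> (\<integral>\<^sup>+y. Y y \<partial>\<nu>)"
    unfolding Y_def using C_bounds(4) by (intro nn_integral_mono ennreal_leI)
  finally have le: "ennreal b \<le> (\<integral>\<^sup>+y. Y y \<partial>\<nu>)" .
  obtain r where r: "(\<integral>\<^sup>+y. Y y \<partial>\<nu>) = ennreal r" "0 \<le> r"
    using nn_integral_\<nu>_Y_finite by (cases "\<integral>\<^sup>+y. Y y \<partial>\<nu>") auto
  show "0 \<le> \<kappa>" "(\<integral>\<^sup>+y. Y y \<partial>\<nu>) = ennreal \<kappa> + ennreal b"
    using le r b by (auto simp: \<kappa>_def ennreal_le_iff simp flip: ennreal_plus)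
qed

lemma beta_split: "beta M * atom_weight B \<delta> x + ennreal b * opt.regen x = ennreal b"
proof -
  have "atom_weight B \<delta> x + opt.regen x = 1"
    using \<delta> by (auto simp: atom_weight_def opt.regen_def indicator_def simp flip: ennreal_plus)
  then show ?thesis unfolding b(2) by (metis distrib_left mult_1_right)
qed

lemma excess_ge:
  assumes v: "v \<in> stationary_policies M" and x: "x \<notin> B"
  shows "ennreal \<epsilon> \<le> excess_cost v x"
proof -
  interpret prob_space "v x" by (rule prob_policy[OF v])
  have "beta M + ennreal \<epsilon> = (\<integral>\<^sup>+u. beta M + ennreal \<epsilon> \<partial>v x)" by (simp add: emeasure_space_1)
  also have "\<dots> \<le> policy_cost v x"
    unfolding policy_cost_def using AE_graph[OF v, of x] \<epsilon>(2)[OF _ x]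
    by (intro nn_integral_mono_AE) (auto simp: tcost_graph)
  finally have "(beta M + ennreal \<epsilon>) - beta M \<le> policy_cost v x - beta M"
    by (rule ennreal_minus_mono) simp
  then show ?thesis using x b by (simp add: excess_cost_def atom_weight_def)
qed

text \<open>Off \<open>B\<close> the cost exceeds \<beta> and nothing is saved; on \<open>B\<close>
  at most \<open>b\<close> is saved, and \<open>regen\<close> equals \<delta> there. The form of the
  bound makes its sum over a cycle at most \<open>b / \<delta>\<close>.\<close>

lemma saved_le:
  assumes v: "v \<in> stationary_policies M"
  shows "saved_cost v x \<le> ennreal (b / \<delta>) * opt.regen x"
proof (cases "x \<in> B")
  case True
  have "saved_cost v x \<le> beta M * atom_weight B \<delta> x" unfolding saved_cost_def by (rule diff_le_self_ennreal)
  also have "\<dots> \<le> ennreal b" using b \<delta> True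
    by (auto simp: atom_weight_def simp flip: ennreal_mult intro!: ennreal_leI mult_left_le)
  also have "\<dots> = ennreal (b / \<delta>) * opt.regen x"
    using True \<delta> b by (simp add: opt.regen_def flip: ennreal_mult)
  finally show ?thesis .
next
  case False
  have "ennreal \<epsilon> \<le> excess_cost v x" by (rule excess_ge[OF v False])
  have "\<not> policy_cost v x \<le> beta M"
  proof
    assume le: "policy_cost v x \<le> beta M"
    then have "policy_cost v x < \<top>" using beta_finite by (auto intro: le_less_trans)
    with le have "excess_cost v x = 0" using False by (simp add: excess_cost_def atom_weight_def diff_eq_0_ennreal)
    with \<open>ennreal \<epsilon> \<le> excess_cost v x\<close> \<epsilon>(1) show False by simp
  qed
  then show ?thesis
    using False b by (simp add: saved_cost_def atom_weight_def diff_eq_0_ennreal)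
qed

lemma total_saved_le:
  assumes v: "v \<in> stationary_policies M"
  shows "total_saved v x \<le> ennreal (b / \<delta>)"
proof -
  interpret P: taboo_kernel "policy_kernel v" B \<delta> \<nu> by (rule taboo_policy[OF v])
  have "total_saved v x \<le> (\<Sum>k. (P.T ^^ k) (\<lambda>x. ennreal (b / \<delta>) * P.regen x) x)"
    unfolding total_saved_def using saved_le[OF v] by (intro suminf_le P.Tn_mono) (auto simp: P.regen_def opt.regen_def)
  also have "\<dots> \<le> ennreal (b / \<delta>)" by (rule P.suminf_Tn_cmult_regen)
  finally show ?thesis .
qed

lemma total_saved_finite: "v \<in> stationary_policies M \<Longrightarrow> total_saved v x < \<infinity>"
  by (rule le_less_trans[OF total_saved_le]) simp_all

lemma V_le_cycle:
  assumes v: "v \<in> stationary_policies M"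
  shows "Y x + total_saved v x \<le> total_excess v x + ennreal C"
proof -
  obtain s where s: "total_saved v x = ennreal s" "0 \<le> s"
    using total_saved_le[OF v, of x] by (cases "total_saved v x") (auto simp: top_unique)
  have "ereal (V x) \<le> enn2ereal (total_excess v x) - enn2ereal (total_saved v x)"
    unfolding V_eq_V_star using total_saved_finite by (intro V_star_bounds(1) v)
  then show ?thesis
    unfolding s(1) Y_def using s(2) C_bounds(1) C_bounds(3)[of x]
    by (cases "total_excess v x") (auto simp: top_add ennreal_le_iff simp flip: ennreal_plus)
qed

text \<open>The optimality inequality averaged over actions. At regeneration the integral against
  \<nu> is \<open>\<kappa> + b\<close>; its part \<open>b\<close> completes the level 0 share of
  \<beta> to the whole of \<beta>, which then cancels.\<close>

lemma Y_step:
  assumes v: "v \<in> stationary_policies M"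
  shows "Y x + saved_cost v x \<le> excess_cost v x + ennreal \<kappa> * opt.regen x + Tv v Y x"
proof -
  interpret P: taboo_kernel "policy_kernel v" B \<delta> \<nu> by (rule taboo_policy[OF v])
  interpret prob_space "v x" by (rule prob_policy[OF v])
  have "Y x + ennreal b = (\<integral>\<^sup>+u. Y x + ennreal b \<partial>v x)" by (simp add: emeasure_space_1)
  also have "\<dots> \<le> (\<integral>\<^sup>+u. tcost (x, u) + (\<integral>\<^sup>+y. Y y \<partial>total_ker M (x, u)) \<partial>v x)"
    using AE_graph[OF v, of x] by (intro nn_integral_mono_AE) (auto intro: Y_le)
  also have "\<dots> = policy_cost v x + (\<integral>\<^sup>+y. Y y \<partial>policy_kernel v x)"
    unfolding policy_cost_def nn_integral_policy_kernel[OF v Y_measurable]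
    using total_ker_integral_measurable[OF v Y_measurable, of x] tcost_Pair[of x]
    by (intro nn_integral_add) (simp_all add: measurable_cong_sets[OF sets_policy[OF v] refl])
  also have "(\<integral>\<^sup>+y. Y y \<partial>policy_kernel v x) = P.T Y x + P.regen x * (ennreal \<kappa> + ennreal b)"
    by (simp add: P.nn_integral_P_T \<kappa>)
  finally have "ennreal b + (Y x + saved_cost v x)
      \<le> (policy_cost v x + saved_cost v x) + P.T Y x + P.regen x * (ennreal \<kappa> + ennreal b)"
    by (simp add: add_right_mono ac_simps)
  also have "\<dots> = (beta M * atom_weight B \<delta> x + ennreal b * opt.regen x) + (excess_cost v x + ennreal \<kappa> * opt.regen x + P.T Y x)"
    unfolding excess_add by (simp add: opt.regen_def P.regen_def algebra_simps)
  finally have "ennreal b + (Y x + saved_cost v x) \<le> ennreal b + (excess_cost v x + ennreal \<kappa> * opt.regen x + P.T Y x)"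
    by (simp add: beta_split)
  then show ?thesis by (simp add: ennreal_add_left_cancel_le)
qed

lemma Y_step_opt:
  "Y x + saved_cost opt x = excess_cost opt x + ennreal \<kappa> * opt.regen x + opt.T Y x"
proof -
  have "ennreal b + (Y x + saved_cost opt x) = (policy_cost opt x + saved_cost opt x) + (\<integral>\<^sup>+y. Y y \<partial>policy_kernel opt x)"
    using Y_eq[of x] by (simp add: policy_cost_opt policy_kernel_opt ac_simps)
  also have "(\<integral>\<^sup>+y. Y y \<partial>policy_kernel opt x) = opt.T Y x + opt.regen x * (ennreal \<kappa> + ennreal b)"
    by (simp add: opt.nn_integral_P_T \<kappa>)
  finally have "ennreal b + (Y x + saved_cost opt x)
      = (beta M * atom_weight B \<delta> x + ennreal b * opt.regen x) + (excess_cost opt x + ennreal \<kappa> * opt.regen x + opt.T Y x)"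
    unfolding excess_add by (simp add: algebra_simps)
  then show ?thesis by (simp add: beta_split ennreal_add_left_cancel)
qed

text \<open>By the bound with \<open>C\<close>, \<open>Y\<close> is dominated by the cycle cost plus
  a constant, so \<open>T ^^ n\<close> applied to it vanishes where that cost is finite; iterating
  \<open>Y_step\<close> then yields the bound with \<kappa>.\<close>

lemma V_le_cycle_\<kappa>:
  assumes v: "v \<in> stationary_policies M"
  shows "Y x + total_saved v x \<le> total_excess v x + ennreal \<kappa>"
proof (cases "total_excess v x < \<infinity>")
  case True
  interpret P: taboo_kernel "policy_kernel v" B \<delta> \<nu> by (rule taboo_policy[OF v])
  note [measurable] = excess_cost_measurable[OF v] saved_cost_measurable[OF v]
  have "Y y \<le> (\<Sum>k. (P.T ^^ k) (excess_cost v) y) + ennreal C" for y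
    using order.trans[OF le_iff_add[THEN iffD2, OF exI, OF refl] V_le_cycle[OF v, of y]]
    by (simp add: total_excess_def)
  then have "(\<lambda>n. (P.T ^^ n) Y x) \<longlonglongrightarrow> 0"
    using True by (intro P.Tn_tendsto_0_of_cycle_cost[OF _ _ \<epsilon>(1) excess_ge[OF v]]) (auto simp: total_excess_def)
  from P.value_le_cycle_cost[OF _ _ _ _ this, of "saved_cost v" "excess_cost v" "ennreal \<kappa>"] Y_step[OF v]
  show ?thesis
    by (simp add: total_excess_def total_saved_def opt.regen_def P.regen_def)
next
  case False
  then show ?thesis by (simp add: infinity_ennreal_def top_add less_top[symmetric])
qed

text \<open>By \<open>V_le_cycle_\<kappa>\<close>, the number \<open>V x + C - \<kappa>\<close> lies
  below the cycle cost of every policy, hence below their infimum, which is \<open>V x\<close>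
  itself.\<close>

lemma C_le_\<kappa>: "C \<le> \<kappa>"
proof -
  obtain x where "x \<in> B" using B_nonempty by auto
  have "ereal (V x + C - \<kappa>) \<le> V_star M B \<delta> \<nu> x"
  proof (rule V_star_bounds(2))
    show "total_saved v x < \<infinity>" if "v \<in> stationary_policies M" for v
      by (rule total_saved_finite[OF that])
    fix v assume v: "v \<in> stationary_policies M"
    obtain s where s: "total_saved v x = ennreal s" "0 \<le> s"
      using total_saved_le[OF v, of x] by (cases "total_saved v x") (auto simp: top_unique)
    show "ereal (V x + C - \<kappa>) \<le> enn2ereal (total_excess v x) - enn2ereal (total_saved v x)"
      using V_le_cycle_\<kappa>[OF v, of x] \<kappa>(1) C_bounds(3)[of x]
      unfolding s(1) Y_def using s(2)
      by (cases "total_excess v x") (auto simp: ennreal_le_iff simp flip: ennreal_plus)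
  qed
  then show ?thesis by (simp flip: V_eq_V_star)
qed

text \<open>Along the optimal policy the optimality relation is an equality, which gives the
  opposite inequality \<kappa> \<le> C; the absence of slack then makes the boundary term
  vanish.\<close>

lemma opt_cycle:
  shows total_excess_opt_le: "total_excess opt x \<le> Y x + ennreal (b / \<delta>)"
    and \<kappa>_eq: "\<kappa> = C"
    and Tn_Y_tendsto_0: "(\<lambda>n. (opt.T ^^ n) Y x) \<longlonglongrightarrow> 0"
proof -
  note [measurable] = excess_cost_measurable[OF opt_stationary] saved_cost_measurable[OF opt_stationary]
  note * = opt.value_eq_cycle_cost[OF Y_measurable _ _ Y_step_opt saved_le[OF opt_stationary] \<epsilon>(1)
      excess_ge[OF opt_stationary] Y_finite V_le_cycle[OF opt_stationary, unfolded total_saved_def total_excess_def]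
      C_bounds(1) \<kappa>(1)]
  show "total_excess opt x \<le> Y x + ennreal (b / \<delta>)"
    unfolding total_excess_def by (rule *(1)) simp_all
  show eq: "\<kappa> = C"
    using C_le_\<kappa> by (intro order.antisym *(2)) simp_all
  show "(\<lambda>n. (opt.T ^^ n) Y x) \<longlonglongrightarrow> 0"
    by (rule *(3)) (simp_all add: eq)
qed

lemma nn_integral_\<nu>_Y: "(\<integral>\<^sup>+y. Y y \<partial>\<nu>) = ennreal (C + b)"
  using \<kappa>(2) b C_bounds(1) by (simp add: \<kappa>_eq)

end

section \<open>Integrability over a cycle of the optimal chain\<close>

lemma emeasure_induced_kernel:
  assumes "split_mdp M B \<delta> \<nu>" and v: "v \<in> stationary_policies M" and A: "A \<in> sets borel"
  shows "emeasure (induced_kernel M v x) A = emeasure (split_mdp.policy_kernel M v x) A"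
proof -
  interpret split_mdp M B \<delta> \<nu> by fact
  have sets: "sets (policy_kernel v x) = sets borel"
    using measurable_space[OF policy_kernel_measurable[OF v], of x] by (simp add: space_prob_algebra)
  have eq: "(\<integral>\<^sup>+u. emeasure (ker M (x, u)) A \<partial>v x) = emeasure (policy_kernel v x) A"
    if A: "A \<in> sets borel" for A
  proof -
    have "(\<integral>\<^sup>+u. emeasure (ker M (x, u)) A \<partial>v x) = (\<integral>\<^sup>+u. emeasure (total_ker M (x, u)) A \<partial>v x)"
      using AE_graph[OF v, of x] by (intro nn_integral_cong_AE) (auto simp: total_ker_graph)
    then show ?thesis
      using nn_integral_policy_kernel[OF v, of "indicator A" x] A sets
        measurable_space[OF total_ker_measurable] by (simp add: space_prob_algebra)
  qed
  have "induced_kernel M v x = measure_of UNIV (sets borel) (emeasure (policy_kernel v x))"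
    unfolding induced_kernel_def
    by (rule measure_of_eq) (use eq sets.sigma_sets_eq[of borel] in auto)
  also have "\<dots> = policy_kernel v x"
    using measure_of_of_measure[of "policy_kernel v x"] sets sets_eq_imp_space_eq[OF sets] by simp
  finally show ?thesis by simp
qed

context acoe_mdp
begin

lemma opt_cycle_length:
  "(\<Sum>k. (opt.T ^^ k) (\<lambda>_. 1) x) \<le> ennreal (1 / \<epsilon>) * (Y x + ennreal (b / \<delta>)) + ennreal (1 / \<delta>)"
  using total_excess_opt_le[of x]
  by (intro order.trans[OF opt.cycle_length_finite[OF excess_cost_measurable[OF opt_stationary] \<epsilon>(1)
        excess_ge[OF opt_stationary]]] add_right_mono mult_left_mono) (simp_all add: total_excess_def)

lemma opt_T_one_tendsto_0: "(\<lambda>n. (opt.T ^^ n) (\<lambda>_. 1) x) \<longlonglongrightarrow> 0"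
proof (rule ennreal_suminf_tendsto_0)
  have "Y x + ennreal (b / \<delta>) < \<infinity>" by (simp add: Y_def)
  then show "(\<Sum>k. (opt.T ^^ k) (\<lambda>_. 1) x) < \<infinity>"
    by (rule le_less_trans[OF opt_cycle_length ennreal_affine_finite])
qed

lemma nn_integral_\<nu>_cmult_Y_add: "(\<integral>\<^sup>+x. ennreal p * Y x + ennreal q \<partial>\<nu>) < \<infinity>"
proof -
  have "(\<integral>\<^sup>+x. ennreal p * Y x + ennreal q \<partial>\<nu>) = ennreal p * ennreal (C + b) + ennreal q"
    using prob_space.emeasure_space_1[OF opt.prob_\<nu>]
    by (simp add: nn_integral_add nn_integral_cmult nn_integral_\<nu>_Y)
  also have "\<dots> < \<infinity>" by (rule ennreal_affine_finite) simp
  finally show ?thesis .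
qed

text \<open>Since \<open>Y\<close> is \<nu>-integrable, a bound of the cycle sums that is affine in
  \<open>Y\<close> is enough.\<close>

lemma suminf_nn_integral_\<nu>_le:
  assumes [measurable]: "g \<in> borel_measurable borel"
    and le: "\<And>x. (\<Sum>k. (opt.T ^^ k) g x) \<le> ennreal p * Y x + ennreal q"
  shows "(\<Sum>k. \<integral>\<^sup>+x. (opt.T ^^ k) g x \<partial>\<nu>) < \<infinity>"
proof -
  have "(\<Sum>k. \<integral>\<^sup>+x. (opt.T ^^ k) g x \<partial>\<nu>) = (\<integral>\<^sup>+x. (\<Sum>k. (opt.T ^^ k) g x) \<partial>\<nu>)"
    by (rule nn_integral_suminf[symmetric]) simp
  also have "\<dots> \<le> (\<integral>\<^sup>+x. ennreal p * Y x + ennreal q \<partial>\<nu>)" by (intro nn_integral_mono le)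
  also have "\<dots> < \<infinity>" by (rule nn_integral_\<nu>_cmult_Y_add)
  finally show ?thesis .
qed

lemma suminf_nn_integral_\<nu>_one: "(\<Sum>k. \<integral>\<^sup>+x. (opt.T ^^ k) (\<lambda>_. 1) x \<partial>\<nu>) < \<infinity>"
proof (rule suminf_nn_integral_\<nu>_le)
  fix x
  have "ennreal (1 / \<epsilon>) * (Y x + ennreal (b / \<delta>)) + ennreal (1 / \<delta>)
      = ennreal (1 / \<epsilon>) * Y x + ennreal (1 / \<epsilon> * (b / \<delta>) + 1 / \<delta>)"
    using \<epsilon>(1) b \<delta> by (simp add: distrib_left add.assoc flip: ennreal_mult ennreal_plus)
  with opt_cycle_length[of x]
  show "(\<Sum>k. (opt.T ^^ k) (\<lambda>_. 1) x) \<le> ennreal (1 / \<epsilon>) * Y x + ennreal (1 / \<epsilon> * (b / \<delta>) + 1 / \<delta>)"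
    by simp
qed simp

text \<open>
  An invariant probability measure dominates a positive multiple of \<open>\<Sum>k. \<nu> T\<^sup>k\<close>, the occupation
  measure of a cycle.
\<close>

lemma suminf_nn_integral_\<nu>_of_invariant:
  assumes inv: "invariant_prob M opt \<pi>" and g[measurable]: "g \<in> borel_measurable borel"
    and fin: "(\<integral>\<^sup>+x. g x \<partial>\<pi>) < \<infinity>"
  shows "(\<Sum>k. \<integral>\<^sup>+x. (opt.T ^^ k) g x \<partial>\<nu>) < \<infinity>"
proof -
  have \<pi>: "prob_space \<pi>" "sets \<pi> = sets borel"
    using inv by (auto simp: invariant_prob_def space_prob_algebra)
  interpret \<pi>: prob_space \<pi> by fact
  note [measurable_cong] = \<pi>(2)
  have space_\<pi>: "space \<pi> = UNIV" using sets_eq_imp_space_eq[OF \<pi>(2)] by simp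
  have P_\<pi>: "policy_kernel opt \<in> \<pi> \<rightarrow>\<^sub>M subprob_algebra borel"
    using opt.P_measurable by (simp add: measurable_cong_sets[OF \<pi>(2) refl])
  have bind: "\<pi> = \<pi> \<bind> policy_kernel opt"
  proof (rule measure_eqI)
    show "sets \<pi> = sets (\<pi> \<bind> policy_kernel opt)"
      using \<pi>(2) by (subst sets_bind[where N=borel]) (auto simp: space_\<pi>)
    fix A assume "A \<in> sets \<pi>"
    then have A: "A \<in> sets borel" by (simp add: \<pi>(2))
    have "emeasure \<pi> A = (\<integral>\<^sup>+x. emeasure (induced_kernel M opt x) A \<partial>\<pi>)"
      using inv A by (simp add: invariant_prob_def)
    also have "\<dots> = (\<integral>\<^sup>+x. emeasure (policy_kernel opt x) A \<partial>\<pi>)"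
      by (simp add: emeasure_induced_kernel[OF split_mdp_axioms opt_stationary A])
    also have "\<dots> = emeasure (\<pi> \<bind> policy_kernel opt) A"
      by (rule emeasure_bind[symmetric, OF _ P_\<pi> A]) (simp add: space_\<pi>)
    finally show "emeasure \<pi> A = emeasure (\<pi> \<bind> policy_kernel opt) A" .
  qed
  \<comment> \<open>The stationary rate of regeneration: by invariance, \<pi> is its own image under
    the taboo kernel plus \<rho> times \<nu>.\<close>
  define \<rho> where "\<rho> = (\<integral>\<^sup>+x. opt.regen x \<partial>\<pi>)"
  have step: "(\<integral>\<^sup>+x. h x \<partial>\<pi>) = (\<integral>\<^sup>+x. opt.T h x \<partial>\<pi>) + \<rho> * (\<integral>\<^sup>+x. h x \<partial>\<nu>)"
    if [measurable]: "h \<in> borel_measurable borel" for h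
  proof -
    have [measurable]: "opt.T h \<in> borel_measurable borel" by (rule opt.T_measurable) fact
    have "(\<integral>\<^sup>+x. h x \<partial>\<pi>) = (\<integral>\<^sup>+x. \<integral>\<^sup>+y. h y \<partial>policy_kernel opt x \<partial>\<pi>)"
      by (subst bind) (rule nn_integral_bind[OF that P_\<pi>])
    also have "\<dots> = (\<integral>\<^sup>+x. opt.T h x + opt.regen x * (\<integral>\<^sup>+x. h x \<partial>\<nu>) \<partial>\<pi>)"
      by (simp add: opt.nn_integral_P_T)
    also have "\<dots> = (\<integral>\<^sup>+x. opt.T h x \<partial>\<pi>) + \<rho> * (\<integral>\<^sup>+x. h x \<partial>\<nu>)"
      by (simp add: nn_integral_add nn_integral_multc \<rho>_def)
    finally show ?thesis .
  qed
  have it: "(\<integral>\<^sup>+x. h x \<partial>\<pi>) = (\<integral>\<^sup>+x. (opt.T ^^ n) h x \<partial>\<pi>) + \<rho> * (\<Sum>k<n. \<integral>\<^sup>+x. (opt.T ^^ k) h x \<partial>\<nu>)"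
    if h: "h \<in> borel_measurable borel" for h n
    by (induction n) (use step[OF opt.Tn_measurable[OF h]] in \<open>simp_all add: distrib_left ac_simps\<close>)
  \<comment> \<open>Without regeneration the killed chain would keep all the mass of \<pi>, whereas
    its survival probabilities tend to 0.\<close>
  have "\<rho> \<noteq> 0"
  proof
    assume "\<rho> = 0"
    then have one: "(\<integral>\<^sup>+x. (opt.T ^^ n) (\<lambda>_. 1) x \<partial>\<pi>) = 1" for n
      using it[of "\<lambda>_. 1" n] \<pi>.emeasure_space_1 by simp
    have "(\<lambda>n. \<integral>\<^sup>+x. (opt.T ^^ n) (\<lambda>_. 1) x \<partial>\<pi>) \<longlonglongrightarrow> (\<integral>\<^sup>+x. 0 \<partial>\<pi>)"
    proof (rule nn_integral_dominated_convergence[where w="\<lambda>_. 1"])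
      show "AE x in \<pi>. (opt.T ^^ n) (\<lambda>_. 1) x \<le> 1" for n
        using opt.regen_sum by (intro AE_I2) (metis add.commute le_iff_add)
    qed (use opt_T_one_tendsto_0 \<pi>.emeasure_space_1 in auto)
    then show False by (simp add: one LIMSEQ_const_iff)
  qed
  have "\<rho> * (\<Sum>k. \<integral>\<^sup>+x. (opt.T ^^ k) g x \<partial>\<nu>) \<le> (\<integral>\<^sup>+x. g x \<partial>\<pi>)"
    unfolding ennreal_suminf_cmult[symmetric]
  proof (rule suminf_le_const)
    fix n show "(\<Sum>k<n. \<rho> * (\<integral>\<^sup>+x. (opt.T ^^ k) g x \<partial>\<nu>)) \<le> (\<integral>\<^sup>+x. g x \<partial>\<pi>)"
      using it[OF g, of n] by (metis add.commute le_iff_add sum_distrib_left)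
  qed simp
  then have "\<rho> * (\<Sum>k. \<integral>\<^sup>+x. (opt.T ^^ k) g x \<partial>\<nu>) < \<infinity>" using fin by (rule le_less_trans)
  with \<open>\<rho> \<noteq> 0\<close> show ?thesis by (auto simp: ennreal_mult_less_top)
qed

text \<open>A cost dominating a multiple of \<open>V\<close> bounds \<open>Y\<close> by a multiple
  of the excess cost plus a constant, and the cycle sums of both the excess cost and the constant 1
  are \<nu>-integrable.\<close>

lemma suminf_nn_integral_\<nu>_Y_of_cost:
  assumes \<theta>: "0 < \<theta>" "\<And>x. ereal (\<theta> * V x - \<theta>') \<le> enn2ereal (tcost (x, f x))"
  shows "(\<Sum>k. \<integral>\<^sup>+x. (opt.T ^^ k) Y x \<partial>\<nu>) < \<infinity>"
proof -
  note [measurable] = excess_cost_measurable[OF opt_stationary]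
  define q where "q = b + \<bar>\<theta>'\<bar> + \<theta> * C"
  have q: "0 \<le> q" using b \<theta> C_bounds(1) by (simp add: q_def)
  have "Y x \<le> ennreal (1 / \<theta>) * excess_cost opt x + ennreal (q / \<theta>)" for x
  proof -
    have "tcost (x, f x) \<le> excess_cost opt x + ennreal b"
    proof -
      have "policy_cost opt x \<le> beta M * atom_weight B \<delta> x + excess_cost opt x"
        unfolding excess_add[symmetric] by simp
      also have "\<dots> \<le> ennreal b * 1 + excess_cost opt x"
        using \<delta> unfolding b(2) by (intro add_right_mono mult_left_mono) (auto simp: atom_weight_def)
      finally show ?thesis by (simp add: policy_cost_opt add.commute)
    qed
    then have "enn2ereal (tcost (x, f x)) \<le> enn2ereal (excess_cost opt x + ennreal b)"
      by (simp add: less_eq_ennreal.rep_eq)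
    with \<theta>(2)[of x] have "ereal (\<theta> * V x - \<theta>') \<le> enn2ereal (excess_cost opt x + ennreal b)" by (rule order.trans)
    then show ?thesis
      using \<theta>(1) b q C_bounds(3)[of x]
      by (cases "excess_cost opt x")
         (auto simp: Y_def q_def ennreal_mult_top top_add ennreal_le_iff field_simps simp flip: ennreal_plus ennreal_mult)
  qed
  then have "(opt.T ^^ k) Y x \<le> (opt.T ^^ k) (\<lambda>x. ennreal (1 / \<theta>) * excess_cost opt x + ennreal (q / \<theta>) * 1) x" for k x
    by (intro opt.Tn_mono) simp
  moreover have "(opt.T ^^ k) (\<lambda>x. ennreal (1 / \<theta>) * excess_cost opt x + ennreal (q / \<theta>) * 1) x
      = ennreal (1 / \<theta>) * (opt.T ^^ k) (excess_cost opt) x + ennreal (q / \<theta>) * (opt.T ^^ k) (\<lambda>_. 1) x" for k x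
    by (rule trans[OF fun_cong[OF opt.Tn_add] arg_cong2[where f="(+)", OF fun_cong[OF opt.Tn_cmult] fun_cong[OF opt.Tn_cmult]]])
      measurable
  ultimately have "(\<Sum>k. \<integral>\<^sup>+x. (opt.T ^^ k) Y x \<partial>\<nu>)
      \<le> (\<Sum>k. \<integral>\<^sup>+x. ennreal (1 / \<theta>) * (opt.T ^^ k) (excess_cost opt) x + ennreal (q / \<theta>) * (opt.T ^^ k) (\<lambda>_. 1) x \<partial>\<nu>)"
    by (intro suminf_le nn_integral_mono summableI) simp_all
  also have "\<dots> = ennreal (1 / \<theta>) * (\<Sum>k. \<integral>\<^sup>+x. (opt.T ^^ k) (excess_cost opt) x \<partial>\<nu>)
      + ennreal (q / \<theta>) * (\<Sum>k. \<integral>\<^sup>+x. (opt.T ^^ k) (\<lambda>_. 1) x \<partial>\<nu>)"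
    by (simp add: nn_integral_add nn_integral_cmult suminf_add[symmetric])
  also have "\<dots> < \<infinity>"
  proof -
    have "(\<Sum>k. \<integral>\<^sup>+x. (opt.T ^^ k) (excess_cost opt) x \<partial>\<nu>) < \<infinity>"
      using total_excess_opt_le by (intro suminf_nn_integral_\<nu>_le[of _ 1 "b / \<delta>"]) (auto simp: total_excess_def)
    with suminf_nn_integral_\<nu>_one show ?thesis
      by (auto simp: ennreal_mult_less_top)
  qed
  finally show ?thesis .
qed

end

section \<open>The Bellman operator\<close>

text \<open>Supplies the compact set of states to which inf-compactness over compacta is applied
  along a convergent sequence.\<close>

lemma compact_insert_range:
  fixes X :: "nat \<Rightarrow> 'a::metric_space"
  assumes lim: "X \<longlonglongrightarrow> x"
  shows "compact (insert x (range X))"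
  unfolding compact_eq_Heine_Borel
proof (intro allI impI)
  fix \<C> assume "(\<forall>T\<in>\<C>. open T) \<and> insert x (range X) \<subseteq> \<Union>\<C>"
  then have \<C>: "\<forall>T\<in>\<C>. open T" "insert x (range X) \<subseteq> \<Union>\<C>" by blast+
  then obtain T where T: "T \<in> \<C>" "x \<in> T" by auto
  then have "\<forall>\<^sub>F n in sequentially. X n \<in> T" using topological_tendstoD[OF lim] \<C>(1) by auto
  then obtain N where N: "\<And>n. N \<le> n \<Longrightarrow> X n \<in> T" by (auto simp: eventually_sequentially)
  have "\<forall>n. \<exists>T'\<in>\<C>. X n \<in> T'" using \<C>(2) by auto
  then obtain U where U: "\<And>n. U n \<in> \<C>" "\<And>n. X n \<in> U n" by metis
  have "X n \<in> \<Union>(insert T (U ` {..<N}))" for n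
    using N[of n] U(2)[of n] by (cases "n < N") auto
  then have "insert x (range X) \<subseteq> \<Union>(insert T (U ` {..<N}))" using T(2) by auto
  then show "\<exists>\<C>'\<subseteq>\<C>. finite \<C>' \<and> insert x (range X) \<subseteq> \<Union>\<C>'"
    using T(1) U(1) by (intro exI[of _ "insert T (U ` {..<N})"]) auto
qed

locale rvi_mdp = acoe_mdp +
  assumes continuous: "basic_assumptions M" and K_inf_compact: "K_inf_compact_cost M"
begin

text \<open>The bracket under the infimum of the Bellman operator, shifted by \<open>m\<close>,
  which makes the integrand nonnegative when \<open>- m \<le> g\<close>.\<close>

definition one_step :: "('a \<Rightarrow> real) \<Rightarrow> real \<Rightarrow> 'a \<times> 'b \<Rightarrow> ennreal" where
  "one_step g m p = tcost p + (\<integral>\<^sup>+y. ennreal (g y + m) \<partial>total_ker M p)"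

text \<open>The class preserved by value iteration: the growth bound keeps integrals finite under
  the optimal action, and semicontinuity provides measurability.\<close>

definition admissible_value :: "('a \<Rightarrow> real) \<Rightarrow> bool" where
  "admissible_value g \<longleftrightarrow> g \<in> lsc_bdd_below \<and> (\<exists>c\<ge>0. \<forall>x. g x \<le> c * (1 + (V x + C)))"

definition S :: "('a \<Rightarrow> real) \<Rightarrow> 'a \<Rightarrow> real" where
  "S g x = real_of_ereal (bellman M (\<lambda>y. ereal (g y)) x)"

lemma lsc_measurable: "g \<in> lsc_bdd_below \<Longrightarrow> g \<in> borel_measurable borel"
  by (auto simp: lsc_bdd_below_def borel_measurable_iff_le)

context
  fixes g :: "'a \<Rightarrow> real" and m :: real
  assumes g: "admissible_value g" and m: "\<And>x. - m \<le> g x"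
begin

lemma g_measurable[measurable]: "g \<in> borel_measurable borel"
  using g by (auto simp: admissible_value_def intro: lsc_measurable)

lemma eint_g:
  assumes "(x, u) \<in> graph M"
  shows "enn2ereal (cost M (x, u)) + eint (ker M (x, u)) (\<lambda>y. ereal (g y)) + ereal m = enn2ereal (one_step g m (x, u))"
proof -
  have "eint (total_ker M (x, u)) (\<lambda>y. ereal (g y)) + ereal m
      = enn2ereal (\<integral>\<^sup>+y. ennreal (g y + m) \<partial>total_ker M (x, u))"
    by (rule eint_add_const[OF prob_total_ker _ m]) (simp add: measurable_cong_sets[OF sets_total_ker refl])
  then show ?thesis
    using assms by (simp add: one_step_def tcost_graph total_ker_graph plus_ennreal.rep_eq add.assoc)
qed

lemma bellman_le:
  assumes "(x, u) \<in> graph M"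
  shows "bellman M (\<lambda>y. ereal (g y)) x + ereal m \<le> enn2ereal (one_step g m (x, u))"
proof -
  have "bellman M (\<lambda>y. ereal (g y)) x \<le> enn2ereal (cost M (x, u)) + eint (ker M (x, u)) (\<lambda>y. ereal (g y))"
    unfolding bellman_def using assms by (intro INF_lower) (simp add: graph_iff)
  then show ?thesis unfolding eint_g[OF assms, symmetric] by (rule add_right_mono)
qed

lemma bellman_ge:
  assumes "\<And>u. (x, u) \<in> graph M \<Longrightarrow> ereal (z + m) \<le> enn2ereal (one_step g m (x, u))"
  shows "ereal z \<le> bellman M (\<lambda>y. ereal (g y)) x"
  unfolding bellman_def
proof (rule INF_greatest)
  fix u assume "u \<in> actions M x"
  then have xu: "(x, u) \<in> graph M" by (simp add: graph_iff)
  show "ereal z \<le> enn2ereal (cost M (x, u)) + eint (ker M (x, u)) (\<lambda>y. ereal (g y))"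
    using assms[OF xu] unfolding eint_g[OF xu, symmetric]
    by (cases "enn2ereal (cost M (x, u)) + eint (ker M (x, u)) (\<lambda>y. ereal (g y))") auto
qed

lemma one_step_opt_finite: "one_step g m (x, f x) < \<infinity>"
proof -
  obtain c where c: "0 \<le> c" "\<And>x. g x \<le> c * (1 + (V x + C))"
    using g by (auto simp: admissible_value_def)
  have "tcost (x, f x) \<le> Y x + ennreal b" unfolding Y_eq by simp
  then have 1: "tcost (x, f x) < \<top>" by (rule le_less_trans) (simp add: Y_def)
  have "(\<integral>\<^sup>+y. ennreal (g y + m) \<partial>total_ker M (x, f x))
      \<le> (\<integral>\<^sup>+y. ennreal c * Y y + ennreal (c + \<bar>m\<bar>) \<partial>total_ker M (x, f x))"
  proof (intro nn_integral_mono)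
    fix y
    have "ennreal (g y + m) \<le> ennreal (c * (V y + C) + (c + \<bar>m\<bar>))"
      using c(2)[of y] by (intro ennreal_leI) (simp add: algebra_simps)
    also have "\<dots> = ennreal c * Y y + ennreal (c + \<bar>m\<bar>)"
      using c(1) C_bounds(3)[of y] by (simp add: Y_def ennreal_plus ennreal_mult)
    finally show "ennreal (g y + m) \<le> ennreal c * Y y + ennreal (c + \<bar>m\<bar>)" .
  qed
  also have "\<dots> = ennreal c * (\<integral>\<^sup>+y. Y y \<partial>total_ker M (x, f x)) + ennreal (c + \<bar>m\<bar>)"
    using prob_space.emeasure_space_1[OF prob_total_ker]
    by (simp add: nn_integral_add nn_integral_cmult measurable_cong_sets[OF sets_total_ker refl])
  also have "\<dots> < \<infinity>"
    using nn_integral_Y_opt_finite[of x] by (intro ennreal_affine_finite) (simp add: policy_kernel_opt)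
  finally show ?thesis using 1 by (simp add: one_step_def)
qed

lemma bellman_eq: "bellman M (\<lambda>y. ereal (g y)) x = ereal (S g x)"
proof -
  have "ereal (- m) \<le> bellman M (\<lambda>y. ereal (g y)) x"
    by (rule bellman_ge) (simp add: zero_ereal_def[symmetric])
  moreover have "bellman M (\<lambda>y. ereal (g y)) x + ereal m < \<infinity>"
    using bellman_le[OF f_graph, of x] one_step_opt_finite[of x]
    by (cases "one_step g m (x, f x)") (auto intro: le_less_trans)
  ultimately show ?thesis
    unfolding S_def by (cases "bellman M (\<lambda>y. ereal (g y)) x") auto
qed

lemma S_ge_neg: "- m \<le> S g x"
  using bellman_ge[of x "- m"] by (simp add: bellman_eq zero_ereal_def[symmetric])

lemma S_le: "(x, u) \<in> graph M \<Longrightarrow> ereal (S g x + m) \<le> enn2ereal (one_step g m (x, u))"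
  using bellman_le[of x u] by (simp add: bellman_eq)

lemma S_ge: "(\<And>u. (x, u) \<in> graph M \<Longrightarrow> ereal (z + m) \<le> enn2ereal (one_step g m (x, u))) \<Longrightarrow> z \<le> S g x"
  using bellman_ge[of x z] by (simp add: bellman_eq)

lemma one_step_finite:
  assumes "one_step g m (x, u) < \<infinity>"
  shows "integrable (total_ker M (x, u)) g"
    and "enn2ereal (one_step g m (x, u)) = ereal (enn2real (tcost (x, u)) + (\<integral>y. g y \<partial>total_ker M (x, u)) + m)"
proof -
  interpret prob_space "total_ker M (x, u)" by (rule prob_total_ker)
  note [measurable_cong] = sets_total_ker
  have fin: "tcost (x, u) < \<top>" "(\<integral>\<^sup>+y. ennreal (g y + m) \<partial>total_ker M (x, u)) < \<top>"
    using assms by (auto simp: one_step_def)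
  have gm: "0 \<le> g y + m" for y using m[of y] by simp
  have int: "integrable (total_ker M (x, u)) (\<lambda>y. g y + m)"
    using fin(2) gm by (intro integrableI_nonneg) auto
  from Bochner_Integration.integrable_diff[OF int integrable_const[of m]]
  show int_g: "integrable (total_ker M (x, u)) g" by simp
  have "(\<integral>\<^sup>+y. ennreal (g y + m) \<partial>total_ker M (x, u)) = ennreal (\<integral>y. g y + m \<partial>total_ker M (x, u))"
    using int gm by (intro nn_integral_eq_integral) auto
  also have "(\<integral>y. g y + m \<partial>total_ker M (x, u)) = (\<integral>y. g y \<partial>total_ker M (x, u)) + m"
    using int_g by (simp add: prob_space)
  finally have eq: "(\<integral>\<^sup>+y. ennreal (g y + m) \<partial>total_ker M (x, u)) = ennreal ((\<integral>y. g y \<partial>total_ker M (x, u)) + m)" .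
  have "0 \<le> (\<integral>y. g y + m \<partial>total_ker M (x, u))" using gm by (intro integral_nonneg_AE) auto
  then have "0 \<le> (\<integral>y. g y \<partial>total_ker M (x, u)) + m" using int_g by (simp add: prob_space)
  then show "enn2ereal (one_step g m (x, u)) = ereal (enn2real (tcost (x, u)) + (\<integral>y. g y \<partial>total_ker M (x, u)) + m)"
    using fin(1) unfolding one_step_def eq plus_ennreal.rep_eq
    by (cases "tcost (x, u)") auto
qed

text \<open>Actions of infinite one-step value cannot lower the infimum, so a lower bound has to be
  checked only where the cost is finite and real integrals are available.\<close>

lemma S_geI:
  assumes "\<And>u c. (x, u) \<in> graph M \<Longrightarrow> tcost (x, u) = ennreal c \<Longrightarrow> 1 \<le> c
    \<Longrightarrow> integrable (total_ker M (x, u)) g \<Longrightarrow> z \<le> c + (\<integral>y. g y \<partial>total_ker M (x, u))"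
  shows "z \<le> S g x"
proof (rule S_ge)
  fix u assume xu: "(x, u) \<in> graph M"
  show "ereal (z + m) \<le> enn2ereal (one_step g m (x, u))"
  proof (cases "one_step g m (x, u) < \<infinity>")
    case True
    have "tcost (x, u) < \<top>" using True by (simp add: one_step_def)
    then obtain c where c: "tcost (x, u) = ennreal c" "0 \<le> c" by (cases "tcost (x, u)") auto
    have "1 \<le> ennreal c"
      using basic xu by (auto simp: basic_mdp_def tcost_graph[OF xu] simp flip: c(1))
    then have "1 \<le> c" using c(2) by (simp add: ennreal_1[symmetric] del: ennreal_1)
    from assms[OF xu c(1) this one_step_finite(1)[OF True]] c
    show ?thesis unfolding one_step_finite(2)[OF True] by simp
  next
    case False
    then show ?thesis by (simp add: less_top[symmetric])
  qed
qed

lemma g_integrable_opt: "integrable (policy_kernel opt x) g"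
  and S_le_opt: "S g x \<le> enn2real (tcost (x, f x)) + (\<integral>y. g y \<partial>policy_kernel opt x)"
  using one_step_finite[OF one_step_opt_finite, of x] S_le[OF f_graph, of x]
  by (simp_all add: policy_kernel_opt)

text \<open>The truncations \<open>h j\<close> are bounded Borel functions, so strong continuity
  carries their integrals to the limit, while the cost is lower semicontinuous on the graph. The
  supremum over \<open>j\<close> is taken only afterwards, by monotone convergence.\<close>

lemma lsc_one_step:
  assumes p: "\<And>k. p k \<in> graph M" and l: "l \<in> graph M" and lim: "p \<longlonglongrightarrow> l"
    and e: "e \<longlonglongrightarrow> 0" "\<And>k. 0 \<le> e k" and A: "0 \<le> A"
    and le: "\<And>k. one_step g m (p k) \<le> ennreal (A + e k)"
  shows "one_step g m l \<le> ennreal A"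
proof -
  have gm: "0 \<le> g y + m" for y using m[of y] by simp
  define h where "h j y = min (g y + m) (real j)" for j y
  have h_meas[measurable]: "h j \<in> borel_measurable borel" for j unfolding h_def[abs_def] by measurable
  have h: "0 \<le> h j y" "h j y \<le> real j" "h j y \<le> g y + m" for j y using gm[of y] by (auto simp: h_def)
  define J where "J j q = (\<integral>y. h j y \<partial>ker M q)" for j q
  have J_cont: "continuous_on (graph M) (J j)" for j
  proof -
    have "h j \<in> bounded_borel"
      using h[of j] by (auto simp: bounded_borel_def intro!: boundedI[of _ "real j"])
    then show ?thesis using continuous unfolding basic_assumptions_def J_def[abs_def] by blast
  qed
  have J: "(\<integral>\<^sup>+y. ennreal (h j y) \<partial>total_ker M q) = ennreal (J j q)" "0 \<le> J j q" if q: "q \<in> graph M" for j q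
  proof -
    interpret prob_space "total_ker M q" by (rule prob_total_ker)
    have t: "total_ker M q = ker M q" using q by (simp add: total_ker_def)
    have "integrable (total_ker M q) (h j)"
      using h[of j] by (intro integrable_const_bound[of _ "real j"]) (auto simp: measurable_cong_sets[OF sets_total_ker refl])
    then show "(\<integral>\<^sup>+y. ennreal (h j y) \<partial>total_ker M q) = ennreal (J j q)"
      unfolding J_def t by (intro nn_integral_eq_integral) (use h in auto)
    show "0 \<le> J j q" unfolding J_def using h by (intro integral_nonneg_AE) auto
  qed
  have bound: "tcost l + ennreal (J j l) \<le> ennreal A" for j
  proof (rule ennreal_le_epsilon)
    fix \<eta> :: real assume \<eta>: "0 < \<eta>"
    have "(\<lambda>k. J j (p k)) \<longlonglongrightarrow> J j l"
      by (rule continuous_on_tendsto_compose[OF J_cont lim l]) (simp add: p)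
    then have "\<forall>\<^sub>F k in sequentially. J j l - \<eta> / 2 < J j (p k)"
      using \<eta> by (intro order_tendstoD) auto
    moreover have "\<forall>\<^sub>F k in sequentially. e k < \<eta> / 2"
      using \<eta> by (intro order_tendstoD[OF e(1)]) auto
    \<comment> \<open>The cost must fit into what the truncated integral leaves of the bound; this
      puts \<open>p k\<close> eventually into a fixed closed sublevel set, to which the limit then
      belongs.\<close>
    ultimately have ev: "\<forall>\<^sub>F k in sequentially. cost M (p k) \<le> ennreal (A + \<eta> - J j l) \<and> 0 \<le> A + \<eta> - J j l"
    proof eventually_elim
      case (elim k)
      have "tcost (p k) + ennreal (J j (p k)) \<le> one_step g m (p k)"
        unfolding one_step_def J(1)[OF p, symmetric]
        by (intro add_left_mono nn_integral_mono ennreal_leI h)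
      also have "\<dots> \<le> ennreal (A + e k)" by (rule le)
      finally have *: "tcost (p k) + ennreal (J j (p k)) \<le> ennreal (A + e k)" .
      then obtain c where c: "tcost (p k) = ennreal c" "0 \<le> c"
        by (cases "tcost (p k)") (auto simp: top_unique)
      then have "c + J j (p k) \<le> A + e k"
        using * J(2)[OF p, of j k] A e(2)[of k] by (simp add: ennreal_le_iff flip: ennreal_plus)
      then have "c \<le> A + \<eta> - J j l" using elim by simp
      moreover have "cost M (p k) = ennreal c"
        using c(1) p[of k] tcost_graph[of "fst (p k)" "snd (p k)"] by simp
      ultimately show ?case using c(2) by (auto intro: ennreal_leI)
    qed
    have "closedin (top_of_set (graph M)) {q \<in> graph M. cost M q \<le> ennreal (A + \<eta> - J j l)}"
      using continuous unfolding basic_assumptions_def by blast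
    then obtain T where T: "closed T" "{q \<in> graph M. cost M q \<le> ennreal (A + \<eta> - J j l)} = graph M \<inter> T"
      unfolding closedin_closed by blast
    have "l \<in> T"
    proof (rule Lim_in_closed_set[OF T(1) _ _ lim])
      show "\<forall>\<^sub>F k in sequentially. p k \<in> T"
        using ev by eventually_elim (use T(2) p in auto)
    qed simp
    then have "cost M l \<le> ennreal (A + \<eta> - J j l)" using T(2) l by auto
    moreover have "0 \<le> A + \<eta> - J j l"
      using eventually_happens'[OF _ ev] by auto
    ultimately have "tcost l + ennreal (J j l) \<le> ennreal (A + \<eta> - J j l) + ennreal (J j l)"
      using l tcost_graph[of "fst l" "snd l"] by (simp add: add_right_mono)
    also have "\<dots> = ennreal A + ennreal \<eta>"
      using \<open>0 \<le> A + \<eta> - J j l\<close> J(2)[OF l] A \<eta> by (simp flip: ennreal_plus)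
    finally show "tcost l + ennreal (J j l) \<le> ennreal A + ennreal \<eta>" .
  qed
  have "(\<integral>\<^sup>+y. ennreal (g y + m) \<partial>total_ker M l) = (\<integral>\<^sup>+y. (SUP j. ennreal (h j y)) \<partial>total_ker M l)"
  proof (intro nn_integral_cong)
    fix y
    obtain j0 :: nat where "g y + m \<le> real j0" using real_arch_simple by blast
    then have "h j0 y = g y + m" by (simp add: h_def)
    then show "ennreal (g y + m) = (SUP j. ennreal (h j y))"
      using h(3)[of _ y] by (intro antisym SUP_least ennreal_leI) (auto intro!: SUP_upper2[of j0])
  qed
  also have "\<dots> = (SUP j. \<integral>\<^sup>+y. ennreal (h j y) \<partial>total_ker M l)"
    by (rule nn_integral_monotone_convergence_SUP)
       (auto simp: incseq_def le_fun_def h_def measurable_cong_sets[OF sets_total_ker refl] intro!: ennreal_leI)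
  also have "\<dots> = (SUP j. ennreal (J j l))" by (simp only: J(1)[OF l])
  finally have "one_step g m l = (SUP j. tcost l + ennreal (J j l))"
    unfolding one_step_def by (simp only: ennreal_SUP_add_right[OF UNIV_not_empty])
  also have "\<dots> \<le> ennreal A" by (rule SUP_least) (rule bound)
  finally show ?thesis .
qed

text \<open>Near-minimizers along a convergent sequence of states have bounded cost and so lie in a
  compact set; a cluster point yields an action at the limit state whose one-step value does not
  exceed the level.\<close>

lemma closed_S_le: "closed {x. S g x \<le> a}"
  unfolding closed_sequential_limits
proof (intro allI impI)
  fix X x assume "(\<forall>k. X k \<in> {x. S g x \<le> a}) \<and> X \<longlonglongrightarrow> x"
  then have X: "\<And>k. S g (X k) \<le> a" and lim: "X \<longlonglongrightarrow> x" by auto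
  define e :: "nat \<Rightarrow> real" where "e k = 1 / real (Suc k)" for k
  have e: "0 < e k" "e k \<le> 1" for k by (auto simp: e_def)
  have e0: "e \<longlonglongrightarrow> 0" unfolding e_def by (rule LIMSEQ_Suc[OF lim_1_over_n])
  have A: "0 \<le> a + m" using X[of 0] S_ge_neg[of "X 0"] by simp
  have "\<exists>u. (X k, u) \<in> graph M \<and> one_step g m (X k, u) \<le> ennreal (a + m + e k)" for k
  proof (rule ccontr)
    assume "\<nexists>u. (X k, u) \<in> graph M \<and> one_step g m (X k, u) \<le> ennreal (a + m + e k)"
    then have "ennreal (a + m + e k) \<le> one_step g m (X k, u)" if "(X k, u) \<in> graph M" for u
      using that by (meson linear)
    then have "a + e k \<le> S g (X k)"
      using A e(1)[of k] by (intro S_ge) (auto simp: less_eq_ennreal.rep_eq add_ac)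
    with X[of k] e(1)[of k] show False by simp
  qed
  then obtain u where u: "\<And>k. (X k, u k) \<in> graph M" "\<And>k. one_step g m (X k, u k) \<le> ennreal (a + m + e k)" by metis
  have "compact {p \<in> graph M. fst p \<in> insert x (range X) \<and> cost M p \<le> ennreal (a + m + 1)}"
    using K_inf_compact compact_insert_range[OF lim] unfolding K_inf_compact_cost_def by blast
  then have "seq_compact {p \<in> graph M. fst p \<in> insert x (range X) \<and> cost M p \<le> ennreal (a + m + 1)}"
    by (simp add: compact_eq_seq_compact_metric)
  moreover have "(X k, u k) \<in> {p \<in> graph M. fst p \<in> insert x (range X) \<and> cost M p \<le> ennreal (a + m + 1)}" for k
  proof -
    have "tcost (X k, u k) \<le> one_step g m (X k, u k)" by (simp add: one_step_def)
    also note u(2)[of k]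
    also have "ennreal (a + m + e k) \<le> ennreal (a + m + 1)" using e(2)[of k] by (intro ennreal_leI) simp
    finally show ?thesis using u(1)[of k] by (simp add: tcost_graph)
  qed
  ultimately obtain l r where l: "l \<in> graph M" and r: "strict_mono r" "((\<lambda>k. (X k, u k)) \<circ> r) \<longlonglongrightarrow> l"
    unfolding seq_compact_def by (metis (no_types, lifting) mem_Collect_eq)
  have "(X \<circ> r) \<longlonglongrightarrow> fst l" using tendsto_fst[OF r(2)] by (simp add: o_def)
  with LIMSEQ_subseq_LIMSEQ[OF lim r(1)] have "fst l = x" by (rule LIMSEQ_unique[symmetric])
  have "one_step g m l \<le> ennreal (a + m)"
  proof (rule lsc_one_step[OF _ l r(2)])
    show "(e \<circ> r) \<longlonglongrightarrow> 0" by (rule LIMSEQ_subseq_LIMSEQ[OF e0 r(1)])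
  qed (use u e A in \<open>auto intro: less_imp_le\<close>)
  then have "enn2ereal (one_step g m l) \<le> ereal (a + m)"
    using A by (simp add: less_eq_ennreal.rep_eq)
  moreover have "ereal (S g (fst l) + m) \<le> enn2ereal (one_step g m l)"
    using S_le[of "fst l" "snd l"] l by simp
  then have "ereal (S g x + m) \<le> enn2ereal (one_step g m l)"
    using \<open>fst l = x\<close> by simp
  ultimately show "x \<in> {x. S g x \<le> a}" by (auto dest: order.trans)
qed

end

end

section \<open>One-step bounds for the value iteration\<close>

context rvi_mdp
begin

lemma V_C_nonneg: "0 \<le> V x + C"
  using C_bounds(3)[of x] by simp

lemma V_one_step_finite:
  assumes "integrable (total_ker M (x, u)) V" "tcost (x, u) = ennreal c" "0 \<le> c" "(x, u) \<in> graph M"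
  shows "V x \<le> c - b + (\<integral>y. V y \<partial>total_ker M (x, u))"
    and "u = f x \<Longrightarrow> V x = c - b + (\<integral>y. V y \<partial>total_ker M (x, u))"
proof -
  interpret prob_space "total_ker M (x, u)" by (rule prob_total_ker)
  have "(\<integral>\<^sup>+y. Y y \<partial>total_ker M (x, u)) = ennreal (\<integral>y. V y + C \<partial>total_ker M (x, u))"
    unfolding Y_def using assms(1) V_C_nonneg by (intro nn_integral_eq_integral) auto
  also have "(\<integral>y. V y + C \<partial>total_ker M (x, u)) = (\<integral>y. V y \<partial>total_ker M (x, u)) + C"
    using assms(1) by (simp add: prob_space)
  finally have eq: "(\<integral>\<^sup>+y. Y y \<partial>total_ker M (x, u)) = ennreal ((\<integral>y. V y \<partial>total_ker M (x, u)) + C)" .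
  have "0 \<le> (\<integral>y. V y + C \<partial>total_ker M (x, u))"
    using V_C_nonneg by (intro integral_nonneg_AE) auto
  then have nn: "0 \<le> (\<integral>y. V y \<partial>total_ker M (x, u)) + C" using assms(1) by (simp add: prob_space)
  have Vx: "0 \<le> V x + C" using C_bounds(3)[of x] by simp
  show "V x \<le> c - b + (\<integral>y. V y \<partial>total_ker M (x, u))"
    using Y_le[OF assms(4), unfolded eq assms(2)] nn Vx b(1) assms(3) unfolding Y_def
    by (simp add: ennreal_le_iff flip: ennreal_plus)
  show "V x = c - b + (\<integral>y. V y \<partial>total_ker M (x, u))" if "u = f x"
    using Y_eq[of x, folded that, unfolded eq assms(2)] nn Vx b(1) assms(3) unfolding Y_def
    by (simp flip: ennreal_plus)
qed

lemma V_integrable_opt: "integrable (policy_kernel opt x) V"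
proof -
  interpret prob_space "policy_kernel opt x" by (rule opt.prob_P)
  have "integrable (policy_kernel opt x) (\<lambda>y. V y + C)"
    using nn_integral_Y_opt_finite[of x] V_C_nonneg unfolding Y_def
    by (intro integrableI_nonneg) (auto simp: measurable_cong_sets[OF opt.sets_P refl])
  from Bochner_Integration.integrable_diff[OF this integrable_const[of C]] show ?thesis by simp
qed

lemma V_integrable_\<nu>: "integrable \<nu> V" and integral_\<nu>_V: "(\<integral>y. V y \<partial>\<nu>) = b"
proof -
  interpret prob_space \<nu> by (rule opt.prob_\<nu>)
  have nn: "0 \<le> V y + C" for y using C_bounds(3)[of y] by simp
  have int: "integrable \<nu> (\<lambda>y. V y + C)"
    using nn_integral_\<nu>_Y nn unfolding Y_def
    by (intro integrableI_nonneg) (auto simp: measurable_cong_sets[OF opt.sets_\<nu> refl])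
  from Bochner_Integration.integrable_diff[OF this integrable_const[of C]] show V: "integrable \<nu> V" by simp
  have "ennreal (\<integral>y. V y + C \<partial>\<nu>) = ennreal (C + b)"
    using nn_integral_eq_integral[OF int] nn nn_integral_\<nu>_Y by (simp add: Y_def)
  moreover have "0 \<le> (\<integral>y. V y + C \<partial>\<nu>)" using nn by (intro integral_nonneg_AE) auto
  ultimately have "(\<integral>y. V y + C \<partial>\<nu>) = C + b" using C_bounds(1) b by (simp del: ennreal_plus)
  then show "(\<integral>y. V y \<partial>\<nu>) = b" using V prob_space by simp
qed

lemma admissible_value_bdd: "admissible_value g \<Longrightarrow> \<exists>m. \<forall>x. - m \<le> g x"
proof -
  assume "admissible_value g"
  then obtain l where "\<And>x. l \<le> g x"
    by (auto simp: admissible_value_def lsc_bdd_below_def bdd_below_def)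
  then have "\<forall>x. - (- l) \<le> g x" by simp
  then show ?thesis ..
qed

lemma tcost_opt_finite: obtains c where "tcost (x, f x) = ennreal c" "0 \<le> c" "c \<le> V x + C + b"
proof -
  have "tcost (x, f x) \<le> Y x + ennreal b" unfolding Y_eq by simp
  also have "\<dots> = ennreal (V x + C + b)" using C_bounds(3)[of x] b by (simp add: Y_def flip: ennreal_plus)
  finally have le: "tcost (x, f x) \<le> ennreal (V x + C + b)" .
  then obtain c where c: "tcost (x, f x) = ennreal c" "0 \<le> c"
    by (cases "tcost (x, f x)") (auto simp: top_unique)
  with le C_bounds(3)[of x] b have "c \<le> V x + C + b" by (simp add: ennreal_le_iff del: ennreal_plus)
  with c that show thesis by blast
qed

text \<open>The optimal action is a candidate in the infimum for \<open>S g\<close> and is exact for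
  \<open>V\<close>, so the running cost cancels.\<close>

lemma S_le_V_add:
  assumes g: "admissible_value g"
  shows "S g x - b - V x \<le> (\<integral>y. g y - V y \<partial>policy_kernel opt x)"
proof -
  obtain m where m: "\<And>x. - m \<le> g x" using admissible_value_bdd[OF g] by auto
  obtain c where c: "tcost (x, f x) = ennreal c" "0 \<le> c" using tcost_opt_finite by metis
  have "V x = c - b + (\<integral>y. V y \<partial>policy_kernel opt x)"
    using V_one_step_finite(2)[OF _ c f_graph refl] V_integrable_opt[of x] by (simp add: policy_kernel_opt)
  moreover have "S g x \<le> c + (\<integral>y. g y \<partial>policy_kernel opt x)"
    using S_le_opt[OF g m, of x] c by simp
  ultimately show ?thesis
    using g_integrable_opt[OF g m, of x] V_integrable_opt[of x] by simp
qed

text \<open>The growth bound comes from evaluating at the optimal action, where the optimality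
  equation controls both the cost and the integral of \<open>V\<close> by
  \<open>V x\<close>.\<close>

lemma admissible_step:
  assumes g: "admissible_value g"
  shows "admissible_value (\<lambda>x. S g x - b)"
proof -
  obtain m where m: "\<And>x. - m \<le> g x" using admissible_value_bdd[OF g] by auto
  obtain c where c: "0 \<le> c" "\<And>x. g x \<le> c * (1 + (V x + C))"
    using g by (auto simp: admissible_value_def)
  have "closed {x. S g x - b \<le> a}" for a
    using closed_S_le[OF g m, of "a + b"] by (simp add: algebra_simps)
  moreover have "bdd_below (range (\<lambda>x. S g x - b))"
  proof (rule bdd_belowI2)
    show "- m - b \<le> S g x - b" for x using S_ge_neg[OF g m, of x] by simp
  qed
  moreover have "S g x - b \<le> (1 + c + c * b) * (1 + (V x + C))" for x
  proof -
    interpret prob_space "policy_kernel opt x" by (rule opt.prob_P)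
    obtain k where k: "tcost (x, f x) = ennreal k" "0 \<le> k" "k \<le> V x + C + b" using tcost_opt_finite by metis
    have V: "V x = k - b + (\<integral>y. V y \<partial>policy_kernel opt x)"
      using V_one_step_finite(2)[OF _ k(1,2) f_graph refl] V_integrable_opt[of x] by (simp add: policy_kernel_opt)
    have "S g x \<le> k + (\<integral>y. g y \<partial>policy_kernel opt x)"
      using S_le_opt[OF g m, of x] k by simp
    also have "(\<integral>y. g y \<partial>policy_kernel opt x) \<le> (\<integral>y. c * (1 + (V y + C)) \<partial>policy_kernel opt x)"
      using V_integrable_opt[of x] by (intro integral_mono g_integrable_opt[OF g m] c(2)) simp
    also have "\<dots> = c * (1 + ((\<integral>y. V y \<partial>policy_kernel opt x) + C))"
      using V_integrable_opt[of x] prob_space by simp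
    also have "\<dots> \<le> c * (1 + (V x + b + C))"
      using V k c(1) by (intro mult_left_mono) auto
    finally have "S g x - b \<le> V x + C + c * (1 + (V x + b + C))" using k(3) by simp
    also have "\<dots> \<le> (1 + c + c * b) * (1 + (V x + C))"
    proof -
      have "0 \<le> c * b * (V x + C)" using c(1) b C_bounds(3)[of x] by simp
      then show ?thesis by (simp add: algebra_simps)
    qed
    finally show ?thesis .
  qed
  then have "\<exists>c\<ge>0. \<forall>x. S g x - b \<le> c * (1 + (V x + C))"
    using c(1) b by (intro exI[of _ "1 + c + c * b"]) simp
  ultimately show ?thesis
    by (simp add: admissible_value_def lsc_bdd_below_def)
qed

text \<open>\<open>V\<close> lies between \<open>- C\<close> and a bound that is affine in the
  absolute value of \<open>g\<close>, obtained by dividing by \<open>1 - a\<close>.\<close>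

lemma V_integrable_of_le:
  assumes int: "integrable (total_ker M p) g" and a1: "0 < 1 - a" and ge: "\<And>y. (1 - a) * V y + q \<le> g y"
  shows "integrable (total_ker M p) V"
proof -
  interpret prob_space "total_ker M p" by (rule prob_total_ker)
  show ?thesis
    proof (rule Bochner_Integration.integrable_bound)
      show "integrable (total_ker M p) (\<lambda>y. (\<bar>g y\<bar> + \<bar>q\<bar>) / (1 - a) + \<bar>C\<bar>)"
        using int by simp
      have "\<bar>V y\<bar> \<le> (\<bar>g y\<bar> + \<bar>q\<bar>) / (1 - a) + \<bar>C\<bar>" for y
      proof -
        have "V y * (1 - a) \<le> \<bar>g y\<bar> + \<bar>q\<bar>" using ge[of y] by (simp add: algebra_simps abs_if split: if_splits)
        then have "V y \<le> (\<bar>g y\<bar> + \<bar>q\<bar>) / (1 - a)" using a1 by (simp add: pos_le_divide_eq)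
        moreover have "0 \<le> (\<bar>g y\<bar> + \<bar>q\<bar>) / (1 - a)" using a1 by simp
        ultimately show ?thesis using C_bounds(3)[of y] by (simp add: abs_if)
      qed
      then show "AE y in total_ker M p. norm (V y) \<le> norm ((\<bar>g y\<bar> + \<bar>q\<bar>) / (1 - a) + \<bar>C\<bar>)"
        by (auto intro!: AE_I2 order.trans[OF _ abs_ge_self])
    qed (simp add: measurable_cong_sets[OF sets_total_ker refl])
qed

text \<open>The coefficient \<open>1 - a < 1\<close> of \<open>V\<close> leaves a multiple of the running cost to spare.\<close>

lemma step_lower:
  assumes g: "admissible_value g" and a: "0 \<le> a" "a \<le> 1" and ge: "\<And>y. (1 - a) * V y + q \<le> g y"
    and l: "\<And>u. (x, u) \<in> graph M \<Longrightarrow> ereal l \<le> enn2ereal (tcost (x, u))"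
  shows "(1 - a) * V x + q + a * (l - b) \<le> S g x - b"
proof -
  obtain m where m: "\<And>x. - m \<le> g x" using admissible_value_bdd[OF g] by auto
  have "(1 - a) * V x + q + a * (l - b) + b \<le> S g x"
  proof (rule S_geI[OF g m])
    fix u c assume xu: "(x, u) \<in> graph M" and c: "tcost (x, u) = ennreal c" "1 \<le> c"
      and int: "integrable (total_ker M (x, u)) g"
    interpret prob_space "total_ker M (x, u)" by (rule prob_total_ker)
    have "l \<le> c" using l[OF xu] c by simp
    then have al: "a * l \<le> a * c" using a by (intro mult_left_mono)
    show "(1 - a) * V x + q + a * (l - b) + b \<le> c + (\<integral>y. g y \<partial>total_ker M (x, u))"
    \<comment> \<open>For \<open>a = 1\<close> the function \<open>V\<close> has disappeared from
      the lower bound, so its integrability cannot be inferred from that of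
      \<open>g\<close>.\<close>
    proof (cases "a = 1")
      case True
      have "(\<integral>y. q \<partial>total_ker M (x, u)) \<le> (\<integral>y. g y \<partial>total_ker M (x, u))"
        using ge True by (intro integral_mono int) auto
      then show ?thesis using True \<open>l \<le> c\<close> by (simp add: prob_space)
    next
      case False
      with a have a1: "0 < 1 - a" by simp
      have int_V: "integrable (total_ker M (x, u)) V" by (rule V_integrable_of_le[OF int a1 ge])
      have "V x \<le> c - b + (\<integral>y. V y \<partial>total_ker M (x, u))"
        using V_one_step_finite(1)[OF int_V c(1) _ xu] c(2) by simp
      then have "(1 - a) * V x \<le> (1 - a) * (c - b + (\<integral>y. V y \<partial>total_ker M (x, u)))"
        using a1 by (intro mult_left_mono) auto
      moreover have "(\<integral>y. (1 - a) * V y + q \<partial>total_ker M (x, u)) \<le> (\<integral>y. g y \<partial>total_ker M (x, u))"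
        using int_V by (intro integral_mono int ge) simp
      then have "(1 - a) * (\<integral>y. V y \<partial>total_ker M (x, u)) + q \<le> (\<integral>y. g y \<partial>total_ker M (x, u))"
        using int_V by (simp add: prob_space)
      ultimately show ?thesis using al by (simp add: algebra_simps)
    qed
  qed
  then show ?thesis by simp
qed

text \<open>Off \<open>B\<close> the gain is the surplus \<open>a * \<epsilon>\<close> of the
  running cost. On \<open>B\<close> the minorization passes on a fraction \<delta> of the \<nu>-mean
  of the gap between \<open>g\<close> and its lower bound; while \<open>q \<le> r - a * C\<close>
  this mean is at least \<open>a * C\<close>, and \<open>\<delta> * C\<close> covers
  \<open>b + \<epsilon>\<close>.\<close>

lemma step_lower_drift:
  assumes g: "admissible_value g" and a: "0 < a" "a < 1" and ge: "\<And>y. (1 - a) * V y + q \<le> g y"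
    and g_\<nu>: "integrable \<nu> g" "r + b \<le> (\<integral>y. g y \<partial>\<nu>)" and q: "q \<le> r - a * C"
  shows "(1 - a) * V x + q + a * \<epsilon> \<le> S g x - b"
proof (cases "x \<in> B")
  case False
  have "(1 - a) * V x + q + a * ((b + \<epsilon>) - b) \<le> S g x - b"
  proof (rule step_lower[OF g _ _ ge])
    fix u assume xu: "(x, u) \<in> graph M"
    have "ennreal (b + \<epsilon>) \<le> tcost (x, u)"
      using \<epsilon>(2)[OF xu False] \<epsilon>(1) b by (simp add: tcost_graph[OF xu])
    then show "ereal (b + \<epsilon>) \<le> enn2ereal (tcost (x, u))"
      using b \<epsilon>(1) by (simp add: less_eq_ennreal.rep_eq del: ennreal_plus)
  qed (use a in auto)
  then show ?thesis by simp
next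
  case True
  obtain m where m: "\<And>x. - m \<le> g x" using admissible_value_bdd[OF g] by auto
  have "(1 - a) * V x + q + a * \<epsilon> + b \<le> S g x"
  proof (rule S_geI[OF g m])
    fix u c assume xu: "(x, u) \<in> graph M" and c: "tcost (x, u) = ennreal c" "1 \<le> c"
      and int: "integrable (total_ker M (x, u)) g"
    interpret prob_space "total_ker M (x, u)" by (rule prob_total_ker)
    interpret N: prob_space \<nu> by (rule opt.prob_\<nu>)
    interpret K: taboo_kernel "\<lambda>_. total_ker M (x, u)" B \<delta> \<nu> by (rule taboo_constant[OF True xu])
    have a1: "0 < 1 - a" using a by simp
    have int_V: "integrable (total_ker M (x, u)) V" by (rule V_integrable_of_le[OF int a1 ge])
    \<comment> \<open>The gap is nonnegative, so dropping the taboo part of its integral leaves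
      \<delta> times its \<nu>-mean as a lower bound.\<close>
    let ?R = "\<lambda>y. g y - ((1 - a) * V y + q)"
    have R_int: "integrable (total_ker M (x, u)) ?R" "integrable \<nu> ?R"
      using int int_V g_\<nu>(1) V_integrable_\<nu> by simp_all
    have "0 \<le> (\<integral>y. ?R y \<partial>K.taboo x)" using ge by (intro integral_nonneg_AE) auto
    then have "\<delta> * (\<integral>y. ?R y \<partial>\<nu>) \<le> (\<integral>y. ?R y \<partial>total_ker M (x, u))"
      using K.integral_P[OF R_int, of x] True \<delta> by (simp add: K.regen_def)
    moreover have "(\<integral>y. ?R y \<partial>\<nu>) = (\<integral>y. g y \<partial>\<nu>) - ((1 - a) * b + q)"
      using g_\<nu>(1) V_integrable_\<nu> N.prob_space by (simp add: integral_\<nu>_V)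
    moreover have "(\<integral>y. ?R y \<partial>total_ker M (x, u))
        = (\<integral>y. g y \<partial>total_ker M (x, u)) - ((1 - a) * (\<integral>y. V y \<partial>total_ker M (x, u)) + q)"
      using int int_V prob_space by simp
    ultimately have R: "\<delta> * ((\<integral>y. g y \<partial>\<nu>) - ((1 - a) * b + q))
        \<le> (\<integral>y. g y \<partial>total_ker M (x, u)) - ((1 - a) * (\<integral>y. V y \<partial>total_ker M (x, u)) + q)"
      by simp
    have "a * (b + \<epsilon>) \<le> a * (\<delta> * C)" using a C_bounds(2) by (intro mult_left_mono) auto
    also have "\<dots> = \<delta> * (a * C)" by simp
    also have "\<dots> \<le> \<delta> * ((\<integral>y. g y \<partial>\<nu>) - ((1 - a) * b + q))"
    proof (intro mult_left_mono)
      have "0 \<le> a * b" using a b by simp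
      then show "a * C \<le> (\<integral>y. g y \<partial>\<nu>) - ((1 - a) * b + q)"
        using g_\<nu>(2) q by (simp add: algebra_simps)
    qed (use \<delta> in simp)
    finally have D: "a * (b + \<epsilon>) \<le> \<delta> * ((\<integral>y. g y \<partial>\<nu>) - ((1 - a) * b + q))" .
    have "V x \<le> c - b + (\<integral>y. V y \<partial>total_ker M (x, u))"
      using V_one_step_finite(1)[OF int_V c(1) _ xu] c(2) by simp
    then have "(1 - a) * V x \<le> (1 - a) * (c - b + (\<integral>y. V y \<partial>total_ker M (x, u)))"
      using a1 by (intro mult_left_mono) auto
    moreover have "0 \<le> a * c" using a c by simp
    ultimately show "(1 - a) * V x + q + a * \<epsilon> + b \<le> c + (\<integral>y. g y \<partial>total_ker M (x, u))"
      using R D by (simp add: algebra_simps)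
  qed
  then show ?thesis by simp
qed

end

section \<open>Convergence of the value iteration\<close>

lemma ex_small_coefficient:
  fixes s e :: real
  assumes "0 \<le> s" "0 < e"
  obtains a where "0 < a" "a < 1" "a * s \<le> e"
proof
  let ?a = "min (1/2) (e / (s + 1))"
  show "0 < ?a" "?a < 1" using assms by auto
  have "?a * s \<le> e / (s + 1) * (s + 1)" using assms by (intro mult_mono) auto
  then show "?a * s \<le> e" using assms by simp
qed

text \<open>The summability assumption is supplied by invariance of \<pi> in the first two cases of
  the theorem and by the lower bound of the cost in the third.\<close>

locale value_iteration = rvi_mdp +
  fixes V\<^sub>0 :: "'a \<Rightarrow> real"
  assumes V\<^sub>0: "admissible_value V\<^sub>0"
    and Y_summable: "(\<Sum>k. \<integral>\<^sup>+x. (opt.T ^^ k) Y x \<partial>\<nu>) < \<infinity>"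
begin

text \<open>Subtracting the constant \<beta> instead of a functional of the iterate gives one
  sequence for all three normalizations; the relative iterates are recovered in
  \<open>rvi_eq\<close>.\<close>

primrec F :: "nat \<Rightarrow> 'a \<Rightarrow> real" where
  "F 0 = V\<^sub>0"
| "F (Suc n) = (\<lambda>x. S (F n) x - b)"

lemma F_admissible: "admissible_value (F n)"
  by (induction n) (auto intro: V\<^sub>0 admissible_step)

lemma F_integrable_opt: "integrable (policy_kernel opt x) (F n)"
  using admissible_value_bdd[OF F_admissible[of n]] g_integrable_opt[OF F_admissible] by metis

lemma F_integrable_\<nu>: "integrable \<nu> (F n)"
proof -
  interpret prob_space \<nu> by (rule opt.prob_\<nu>)
  obtain m where m: "\<And>x. - m \<le> F n x" using admissible_value_bdd[OF F_admissible] by blast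
  obtain c where c: "0 \<le> c" "\<And>x. F n x \<le> c * (1 + (V x + C))"
    using F_admissible[of n] by (auto simp: admissible_value_def)
  have [measurable]: "F n \<in> borel_measurable borel" by (rule g_measurable[OF F_admissible m])
  show ?thesis
  proof (rule Bochner_Integration.integrable_bound)
    show "integrable \<nu> (\<lambda>x. c * (1 + (V x + C)) + \<bar>m\<bar>)" using V_integrable_\<nu> by simp
    show "AE x in \<nu>. norm (F n x) \<le> norm (c * (1 + (V x + C)) + \<bar>m\<bar>)"
    proof (rule AE_I2)
      fix x
      have "0 \<le> c * (1 + (V x + C))" using c(1) V_C_nonneg[of x] by simp
      then show "norm (F n x) \<le> norm (c * (1 + (V x + C)) + \<bar>m\<bar>)" using m[of x] c(2)[of x] by simp
    qed
  qed (simp add: measurable_cong_sets[OF opt.sets_\<nu> refl])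
qed

text \<open>Read from right to left, the iterated optimality equation bounds the remainder by
  \<open>Y x\<close> plus the savings of a cycle.\<close>

lemma Tn_Y_finite: "(opt.T ^^ n) Y x < \<infinity>"
proof -
  note [measurable] = excess_cost_measurable[OF opt_stationary] saved_cost_measurable[OF opt_stationary]
  have "(opt.T ^^ n) Y x \<le> (\<Sum>k<n. (opt.T ^^ k) (\<lambda>x. excess_cost opt x + ennreal \<kappa> * opt.regen x) x) + (opt.T ^^ n) Y x"
    by simp
  also have "\<dots> = Y x + (\<Sum>k<n. (opt.T ^^ k) (saved_cost opt) x)"
    by (rule opt.iterate_eq[symmetric]) (use Y_step_opt in auto)
  also have "\<dots> \<le> Y x + total_saved opt x"
    unfolding total_saved_def by (intro add_left_mono sum_le_suminf) auto
  also have "\<dots> < \<infinity>" using total_saved_finite[OF opt_stationary] Y_finite by simp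
  finally show ?thesis .
qed

definition c\<^sub>1 :: real where
  "c\<^sub>1 = (SOME c. 0 \<le> c \<and> (\<forall>x. V\<^sub>0 x \<le> c * (1 + (V x + C))))"

lemma c\<^sub>1: "0 \<le> c\<^sub>1" "V\<^sub>0 x \<le> c\<^sub>1 * (1 + (V x + C))"
proof -
  have "\<exists>c. 0 \<le> c \<and> (\<forall>x. V\<^sub>0 x \<le> c * (1 + (V x + C)))"
    using V\<^sub>0 by (auto simp: admissible_value_def)
  from someI_ex[OF this] show "0 \<le> c\<^sub>1" "V\<^sub>0 x \<le> c\<^sub>1 * (1 + (V x + C))"
    by (auto simp: c\<^sub>1_def)
qed

text \<open>Dominates the positive part of \<open>V\<^sub>0 - V\<close>: the growth bound
  contributes the multiple of \<open>Y\<close>, and \<open>C\<close> accounts for negative values of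
  \<open>V\<close>. The factor 1 is written out for the sake of \<open>Tn_cmult\<close>.\<close>

definition Z :: "'a \<Rightarrow> ennreal" where
  "Z x = ennreal c\<^sub>1 * Y x + ennreal (c\<^sub>1 + C) * 1"

lemma Z_measurable[measurable]: "Z \<in> borel_measurable borel"
  unfolding Z_def[abs_def] by measurable

lemma Tn_Z: "(opt.T ^^ n) Z x = ennreal c\<^sub>1 * (opt.T ^^ n) Y x + ennreal (c\<^sub>1 + C) * (opt.T ^^ n) (\<lambda>_. 1) x"
  unfolding Z_def[abs_def]
  by (rule trans[OF fun_cong[OF opt.Tn_add] arg_cong2[where f="(+)", OF fun_cong[OF opt.Tn_cmult] fun_cong[OF opt.Tn_cmult]]])
    measurable

lemma Tn_one_le: "(opt.T ^^ n) (\<lambda>_. 1) x \<le> 1"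
  using opt.regen_sum[of x n] by (metis add.commute le_iff_add)

lemma Tn_Z_finite: "(opt.T ^^ n) Z x < \<infinity>"
proof -
  have "(opt.T ^^ n) (\<lambda>_. 1) x < \<top>" using Tn_one_le[of n x] by (auto intro: le_less_trans)
  then show ?thesis
    using Tn_Y_finite[of n x] unfolding Tn_Z by (simp add: ennreal_mult_less_top)
qed

lemma Tn_Z_tendsto_0: "(\<lambda>n. (opt.T ^^ n) Z x) \<longlonglongrightarrow> 0"
proof -
  have "(\<lambda>n. (opt.T ^^ n) Z x) \<longlonglongrightarrow> ennreal c\<^sub>1 * 0 + ennreal (c\<^sub>1 + C) * 0"
    unfolding Tn_Z by (intro tendsto_add ennreal_tendsto_cmult Tn_Y_tendsto_0 opt_T_one_tendsto_0) auto
  then show ?thesis by simp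
qed

sublocale D: taboo_subinvariant "policy_kernel (dirac_policy f)" B \<delta> \<nu> "\<lambda>n x. F n x - V x" Z
proof
  show "integrable (policy_kernel opt x) (\<lambda>x. F n x - V x)" for n x
    using F_integrable_opt V_integrable_opt by simp
  show "integrable \<nu> (\<lambda>x. F n x - V x)" for n
    using F_integrable_\<nu> V_integrable_\<nu> by simp
  show "F (Suc n) x - V x \<le> (\<integral>y. F n y - V y \<partial>policy_kernel opt x)" for n x
    using S_le_V_add[OF F_admissible[of n], of x] by simp
  show "(opt.T ^^ n) Z x < \<infinity>" for n x by (rule Tn_Z_finite)
  fix x
  have "ennreal (F 0 x - V x) \<le> ennreal (c\<^sub>1 * (V x + C) + (c\<^sub>1 + C))"
    using c\<^sub>1(2)[of x] C_bounds(3)[of x] by (intro ennreal_leI) (simp add: algebra_simps)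
  also have "\<dots> = Z x"
    using c\<^sub>1(1) V_C_nonneg[of x] C_bounds(1) by (simp add: Z_def Y_def ennreal_plus ennreal_mult)
  finally show "ennreal (F 0 x - V x) \<le> Z x" .
qed simp

lemma Z_summable: "(\<Sum>k. \<integral>\<^sup>+x. (opt.T ^^ k) Z x \<partial>\<nu>) < \<infinity>"
proof -
  have "(\<Sum>k. \<integral>\<^sup>+x. (opt.T ^^ k) Z x \<partial>\<nu>) = ennreal c\<^sub>1 * (\<Sum>k. \<integral>\<^sup>+x. (opt.T ^^ k) Y x \<partial>\<nu>)
      + ennreal (c\<^sub>1 + C) * (\<Sum>k. \<integral>\<^sup>+x. (opt.T ^^ k) (\<lambda>_. 1) x \<partial>\<nu>)"
    unfolding Tn_Z by (simp add: nn_integral_add nn_integral_cmult suminf_add[symmetric])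
  also have "\<dots> < \<infinity>"
    using Y_summable suminf_nn_integral_\<nu>_one by (auto simp: ennreal_mult_less_top)
  finally show ?thesis .
qed

text \<open>
  The hypothesis \<open>low\<close> is what the cases of the theorem have in common: it holds with \<open>a = 0\<close> in the
  first two of them.
\<close>

lemma F_converges:
  assumes low: "\<And>a. 0 < a \<Longrightarrow> a < 1 \<Longrightarrow> \<exists>q. \<forall>\<^sub>F n in sequentially. \<forall>x. (1 - a) * V x + q \<le> F n x"
  shows "\<exists>r. (\<forall>x. (\<lambda>n. F n x) \<longlonglongrightarrow> V x + r) \<and> (\<lambda>n. \<integral>x. F n x \<partial>\<nu>) \<longlonglongrightarrow> b + r
    \<and> (\<lambda>n. INF x. F n x) \<longlonglongrightarrow> (INF x. V x) + r"
proof -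
  interpret N: prob_space \<nu> by (rule opt.prob_\<nu>)
  let ?d = "\<lambda>n. \<integral>x. F n x - V x \<partial>\<nu>"
  have d: "?d n = (\<integral>x. F n x \<partial>\<nu>) - b" for n
    using F_integrable_\<nu> V_integrable_\<nu> by (simp add: integral_\<nu>_V)
  \<comment> \<open>The eventual lower bound with \<open>a = 1/2\<close> covers all but finitely
    many of the averages.\<close>
  have "\<exists>l. \<forall>n. l \<le> ?d n"
  proof -
    obtain q n0 where q: "\<And>n x. n0 \<le> n \<Longrightarrow> (1 - 1/2) * V x + q \<le> F n x"
      using low[of "1/2"] by (auto simp: eventually_sequentially)
    have "(1 - 1/2) * b + q - b \<le> ?d n" if "n0 \<le> n" for n
    proof -
      have "(\<integral>x. (1 - 1/2) * V x + q \<partial>\<nu>) \<le> (\<integral>x. F n x \<partial>\<nu>)"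
        using V_integrable_\<nu> by (intro integral_mono F_integrable_\<nu> q that) simp
      also have "(\<integral>x. (1 - 1/2) * V x + q \<partial>\<nu>) = (1 - 1/2) * b + q"
        using V_integrable_\<nu> N.prob_space by (simp add: integral_\<nu>_V)
      finally show ?thesis by (simp add: d)
    qed
    moreover have "Min (?d ` {..n0}) \<le> ?d n" if "n < n0" for n
      using that by (intro Min_le) auto
    ultimately have "min (Min (?d ` {..n0})) ((1 - 1/2) * b + q - b) \<le> ?d n" for n
      by (cases "n < n0") (simp_all add: min_le_iff_disj)
    then show ?thesis by blast
  qed
  then obtain l where l: "\<And>n. l \<le> ?d n" by blast
  obtain r where r: "?d \<longlonglongrightarrow> r"
    using D.averages_converge[OF Z_summable opt_T_one_tendsto_0 suminf_nn_integral_\<nu>_one l]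
    by (auto simp: convergent_def)
  have upper: "\<forall>\<^sub>F n in sequentially. F n x \<le> V x + r + e" if "0 < e" for e x
  proof -
    have "\<forall>\<^sub>F n in sequentially. F n x - V x \<le> r + e"
      by (rule D.eventually_le_limit[OF r Tn_Z_tendsto_0 opt_T_one_tendsto_0 that])
    then show ?thesis by (rule eventually_mono) simp
  qed
  \<comment> \<open>From an arbitrary starting constant \<open>q\<close> the bound rises by
    \<open>a * \<epsilon>\<close> per step until it reaches \<open>r - e - a * C\<close>, the level
    up to which the drift is available. The index from which it holds is common to all
    \<open>x\<close>.\<close>
  have lower: "\<forall>\<^sub>F n in sequentially. \<forall>x. (1 - a) * V x + (r - e - a * C) \<le> F n x"
    if a: "0 < a" "a < 1" and e: "0 < e" for a e
  proof -
    obtain q where "\<forall>\<^sub>F n in sequentially. \<forall>x. (1 - a) * V x + q \<le> F n x" using low[OF a] by blast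
    moreover have "\<forall>\<^sub>F n in sequentially. r - e < ?d n" using e by (intro order_tendstoD[OF r]) simp
    ultimately have "\<forall>\<^sub>F n in sequentially. (\<forall>x. (1 - a) * V x + q \<le> F n x) \<and> r - e < ?d n"
      by (rule eventually_conj)
    then obtain n0 where n0: "\<And>n x. n0 \<le> n \<Longrightarrow> (1 - a) * V x + q \<le> F n x" "\<And>n. n0 \<le> n \<Longrightarrow> r - e < ?d n"
      by (auto simp: eventually_sequentially)
    have step: "(1 - a) * V x + min (q + real k * (a * \<epsilon>)) (r - e - a * C) \<le> F (n0 + k) x" for k x
    proof (induction k arbitrary: x)
      case 0
      have "(1 - a) * V x + q \<le> F n0 x" by (rule n0) simp
      then show ?case by (simp add: min_def)
    next
      case (Suc k)
      let ?q = "min (q + real k * (a * \<epsilon>)) (r - e - a * C)"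
      have "(1 - a) * V x + ?q + a * \<epsilon> \<le> S (F (n0 + k)) x - b"
      proof (rule step_lower_drift[OF F_admissible a Suc.IH F_integrable_\<nu>])
        show "r - e + b \<le> (\<integral>x. F (n0 + k) x \<partial>\<nu>)" using n0(2)[of "n0 + k"] by (simp add: d)
      qed simp
      moreover have "min (q + real (Suc k) * (a * \<epsilon>)) (r - e - a * C) \<le> ?q + a * \<epsilon>"
      proof -
        have "0 < a * \<epsilon>" using a \<epsilon>(1) by simp
        moreover have "real (Suc k) * (a * \<epsilon>) = real k * (a * \<epsilon>) + a * \<epsilon>" by (simp add: distrib_right)
        ultimately show ?thesis by (auto simp: min_def)
      qed
      ultimately show ?case by simp
    qed
    obtain k0 :: nat where "(r - e - a * C - q) / (a * \<epsilon>) \<le> real k0" using real_arch_simple by blast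
    then have k0: "r - e - a * C \<le> q + real k0 * (a * \<epsilon>)"
      using a \<epsilon>(1) by (simp add: pos_divide_le_eq)
    have "(1 - a) * V x + (r - e - a * C) \<le> F n x" if "n0 + k0 \<le> n" for n x
    proof -
      have "real k0 * (a * \<epsilon>) \<le> real (n - n0) * (a * \<epsilon>)"
        using that a \<epsilon>(1) by (intro mult_right_mono) auto
      with k0 have "min (q + real (n - n0) * (a * \<epsilon>)) (r - e - a * C) = r - e - a * C" by (simp add: min_def)
      with step[of x "n - n0"] that show ?thesis by simp
    qed
    then show ?thesis by (auto simp: eventually_sequentially)
  qed
  have pt: "(\<lambda>n. F n x) \<longlonglongrightarrow> V x + r" for x
  proof (rule tendstoI)
    fix e :: real assume e: "0 < e"
    \<comment> \<open>The lower bound misses \<open>V x + r\<close> by \<open>a * (V x + C)\<close>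
      plus \<open>e / 2\<close>, hence the choice of \<open>a\<close> according to
      \<open>x\<close>.\<close>
    obtain a where a: "0 < a" "a < 1" and ae: "a * (V x + C) \<le> e / 4"
      using ex_small_coefficient[OF V_C_nonneg[of x], of "e / 4"] e by auto
    have e2: "0 < e / 2" using e by simp
    show "\<forall>\<^sub>F n in sequentially. dist (F n x) (V x + r) < e"
      using upper[OF e2, of x] lower[OF a e2]
    proof eventually_elim
      case (elim n)
      then have "(1 - a) * V x + (r - e / 2 - a * C) \<le> F n x" by blast
      then have "V x + r - e / 2 - a * (V x + C) \<le> F n x" by (simp add: algebra_simps)
      with ae elim(1) e show ?case by (simp add: dist_real_def abs_less_iff)
    qed
  qed
  have bdd_V: "bdd_below (range V)" using V_ge(2) by (intro bdd_belowI2[of _ "- C\<^sub>0"])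
  have bdd_F: "bdd_below (range (F n))" for n
    using admissible_value_bdd[OF F_admissible[of n]] by (auto simp: bdd_below_def)
  let ?v = "INF x. V x"
  \<comment> \<open>From above one near-minimizer of \<open>V\<close> suffices. From below the bound
    uniform in the state is needed, with \<open>a\<close> fitted to the infimum of \<open>V\<close>
    instead of a value \<open>V x\<close>.\<close>
  have "(\<lambda>n. INF x. F n x) \<longlonglongrightarrow> ?v + r"
  proof (rule tendstoI)
    fix e :: real assume e: "0 < e"
    obtain a where a: "0 < a" "a < 1" and ae: "a * (\<bar>?v\<bar> + C) \<le> e / 4"
      using ex_small_coefficient[of "\<bar>?v\<bar> + C" "e / 4"] C_bounds(1) e by auto
    have "a * ?v \<le> a * \<bar>?v\<bar>" using a by (intro mult_left_mono) auto
    with ae have ae': "a * (?v + C) \<le> e / 4" by (simp add: algebra_simps)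
    have e2: "0 < e / 2" and e4: "0 < e / 4" using e by simp_all
    obtain x where x: "V x < ?v + e / 4"
      using cINF_less_iff[OF UNIV_not_empty bdd_V, of "?v + e / 4"] e by auto
    show "\<forall>\<^sub>F n in sequentially. dist (INF x. F n x) (?v + r) < e"
      using upper[OF e4, of x] lower[OF a e2]
    proof eventually_elim
      case (elim n)
      have "(INF x. F n x) \<le> F n x" by (rule cINF_lower[OF bdd_F]) simp
      then have 1: "(INF x. F n x) < ?v + r + e" using elim(1) x e by simp
      have "(1 - a) * ?v + (r - e / 2 - a * C) \<le> (INF x. F n x)"
      proof (rule cINF_greatest)
        fix y
        have "(1 - a) * ?v \<le> (1 - a) * V y"
          using a by (intro mult_left_mono cINF_lower[OF bdd_V]) auto
        moreover have "(1 - a) * V y + (r - e / 2 - a * C) \<le> F n y" using elim(2) by blast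
        ultimately show "(1 - a) * ?v + (r - e / 2 - a * C) \<le> F n y" by simp
      qed simp
      then have "?v + r - e / 2 - a * (?v + C) \<le> (INF x. F n x)" by (simp add: algebra_simps)
      with 1 ae' e show ?case by (simp add: dist_real_def abs_less_iff)
    qed
  qed
  moreover have "(\<lambda>n. \<integral>x. F n x \<partial>\<nu>) \<longlonglongrightarrow> b + r"
    using tendsto_add[OF tendsto_const[of b] r] by (simp add: d)
  ultimately show ?thesis using pt by blast
qed

end

section \<open>Relative value iteration as shifted value iteration\<close>

lemma INF_ereal_shift:
  fixes g :: "'a \<Rightarrow> real"
  assumes bdd: "bdd_below (range g)"
  shows "(INF y. ereal (g y + s)) = ereal ((INF y. g y) + s)"
proof -
  obtain l where "\<And>y. l \<le> g y" using bdd by (auto simp: bdd_below_def)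
  then have bdd': "bdd_below (range (\<lambda>y. g y + s))" by (intro bdd_belowI2[of _ "l + s"]) simp
  have "(INF y. g y + s) = (INF y. g y) + s"
  proof (rule antisym)
    have "(INF y. g y + s) - s \<le> (INF y. g y)"
    proof (rule cINF_greatest)
      fix y show "(INF y. g y + s) - s \<le> g y"
        using cINF_lower[OF bdd', of y] by simp
    qed simp
    then show "(INF y. g y + s) \<le> (INF y. g y) + s" by simp
    show "(INF y. g y) + s \<le> (INF y. g y + s)"
      by (rule cINF_greatest) (auto intro: cINF_lower[OF bdd])
  qed
  then show ?thesis
    using ereal_Inf'[OF bdd'] by (simp add: image_comp)
qed

lemma eint_integrable:
  fixes g :: "'a \<Rightarrow> real"
  assumes "integrable N g"
  shows "eint N (\<lambda>x. ereal (g x)) = ereal (\<integral>x. g x \<partial>N)"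
proof -
  have "(\<integral>\<^sup>+x. ennreal (g x) \<partial>N) \<noteq> \<top>" "(\<integral>\<^sup>+x. ennreal (- g x) \<partial>N) \<noteq> \<top>"
    using assms by (auto simp: real_integrable_def)
  then show ?thesis
    unfolding eint_def real_lebesgue_integral_def[OF assms] uminus_ereal.simps e2ennreal_ereal
    by (cases "\<integral>\<^sup>+x. ennreal (g x) \<partial>N"; cases "\<integral>\<^sup>+x. ennreal (- g x) \<partial>N") simp_all
qed

context value_iteration
begin

text \<open>Lowering \<open>m\<close> by \<open>s\<close> compensates the shift of the function, so
  the one-step values of both functions coincide.\<close>

lemma bellman_shift: "bellman M (\<lambda>y. ereal (F n y + s)) x = ereal (S (F n) x + s)"
proof -
  let ?g = "\<lambda>y. F n y + s"
  obtain m where m: "\<And>x. - m \<le> F n x" using admissible_value_bdd[OF F_admissible] by blast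
  then have m': "- (m - s) \<le> ?g x" for x using m[of x] by simp
  have g: "admissible_value ?g"
  proof -
    obtain c where c: "0 \<le> c" "\<And>x. F n x \<le> c * (1 + (V x + C))"
      using F_admissible[of n] by (auto simp: admissible_value_def)
    have "?g x \<le> (c + \<bar>s\<bar>) * (1 + (V x + C))" for x
    proof -
      have "\<bar>s\<bar> * 1 \<le> \<bar>s\<bar> * (1 + (V x + C))" using V_C_nonneg[of x] by (intro mult_left_mono) auto
      with c(2)[of x] show ?thesis by (simp add: distrib_right)
    qed
    moreover have "closed {x. F n x \<le> a - s}" for a
      using F_admissible[of n] by (simp add: admissible_value_def lsc_bdd_below_def)
    then have "closed {x. F n x + s \<le> a}" for a by (simp add: le_diff_eq)
    moreover have "bdd_below (range ?g)" using m' by (intro bdd_belowI2[of _ "- (m - s)"]) simp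
    moreover have "0 \<le> c + \<bar>s\<bar>" using c(1) by simp
    ultimately show ?thesis
      unfolding admissible_value_def lsc_bdd_below_def by blast
  qed
  have eq: "one_step ?g (m - s) p = one_step (F n) m p" for p by (simp add: one_step_def)
  have "S ?g x = S (F n) x + s"
  proof (rule antisym)
    have "S ?g x - s \<le> S (F n) x"
    proof (rule S_ge[OF F_admissible m])
      fix u assume "(x, u) \<in> graph M"
      from S_le[OF g m' this] show "ereal (S ?g x - s + m) \<le> enn2ereal (one_step (F n) m (x, u))"
        unfolding eq by (simp add: algebra_simps)
    qed
    then show "S ?g x \<le> S (F n) x + s" by simp
    show "S (F n) x + s \<le> S ?g x"
    proof (rule S_ge[OF g m'])
      fix u assume "(x, u) \<in> graph M"
      from S_le[OF F_admissible m this] show "ereal (S (F n) x + s + (m - s)) \<le> enn2ereal (one_step ?g (m - s) (x, u))"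
        unfolding eq by simp
    qed
  qed
  then show ?thesis by (simp add: bellman_eq[OF g m'])
qed

text \<open>Both \<rho> and the Bellman operator commute with adding constants, so the shift
  accumulated earlier cancels and the new one depends on \<open>R n\<close> only. The formula starts
  at \<open>Suc n\<close>; the initial function carries no shift.\<close>

lemma rvi_eq:
  assumes \<rho>: "\<And>n s. \<rho> (\<lambda>y. ereal (F n y + s)) = ereal (R n + s)"
  shows "rvi M \<rho> V\<^sub>0 (Suc n) = (\<lambda>x. ereal (F (Suc n) x + (b - R n)))"
proof (induction n)
  case 0
  show ?case
    using bellman_shift[of 0 0] \<rho>[of 0 0] by (simp add: fun_eq_iff)
next
  case (Suc n)
  show ?case
    unfolding rvi.simps(2)[of _ _ _ "Suc n"] Suc bellman_shift \<rho> by (simp add: fun_eq_iff)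
qed

text \<open>The unknown \<open>r\<close> enters the limit of \<open>F n x\<close> and that of
  \<open>R n\<close> alike, and drops out of the difference.\<close>

lemma rvi_tendsto:
  assumes \<rho>: "\<And>n s. \<rho> (\<lambda>y. ereal (F n y + s)) = ereal (R n + s)"
    and F: "(\<lambda>n. F n x) \<longlonglongrightarrow> V x + r" and R: "R \<longlonglongrightarrow> l + r" and l: "\<rho> (\<lambda>y. ereal (V y)) = ereal l"
  shows "(\<lambda>n. rvi M \<rho> V\<^sub>0 n x) \<longlonglongrightarrow> normalized_at M \<rho> V x"
proof -
  have "(\<lambda>n. F (Suc n) x + (b - R n)) \<longlonglongrightarrow> (V x + r) + (b - (l + r))"
    by (intro tendsto_intros LIMSEQ_Suc[OF F] R)
  then have "(\<lambda>n. rvi M \<rho> V\<^sub>0 (Suc n) x) \<longlonglongrightarrow> ereal (V x + (b - l))"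
    unfolding rvi_eq[of \<rho> R, OF \<rho>] by (simp add: algebra_simps)
  then have "(\<lambda>n. rvi M \<rho> V\<^sub>0 n x) \<longlonglongrightarrow> ereal (V x + (b - l))"
    by (rule LIMSEQ_imp_Suc)
  moreover have "normalized_at M \<rho> V x = ereal (V x + (b - l))"
    using b by (simp add: normalized_at_def l)
  ultimately show ?thesis by (simp only:)
qed

lemma rvi_converges:
  assumes low: "\<And>a. 0 < a \<Longrightarrow> a < 1 \<Longrightarrow> \<exists>q. \<forall>\<^sub>F n in sequentially. \<forall>x. (1 - a) * V x + q \<le> F n x"
  shows "(\<lambda>n. rvi M (\<lambda>g. eint \<nu> g) V\<^sub>0 n x) \<longlonglongrightarrow> ereal (V x)"
    and "(\<lambda>n. rvi M (\<lambda>g. INF y. g y) V\<^sub>0 n x) \<longlonglongrightarrow> normalized_at M (\<lambda>g. INF y. g y) V x"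
    and "(\<lambda>n. rvi M (\<lambda>g. g z) V\<^sub>0 n x) \<longlonglongrightarrow> normalized_at M (\<lambda>g. g z) V x"
proof -
  interpret N: prob_space \<nu> by (rule opt.prob_\<nu>)
  obtain r where r: "\<And>x. (\<lambda>n. F n x) \<longlonglongrightarrow> V x + r" "(\<lambda>n. \<integral>x. F n x \<partial>\<nu>) \<longlonglongrightarrow> b + r"
      "(\<lambda>n. INF x. F n x) \<longlonglongrightarrow> (INF x. V x) + r"
    using F_converges[OF low] by blast
  have V\<nu>: "eint \<nu> (\<lambda>y. ereal (V y)) = ereal b"
    by (simp only: eint_integrable[OF V_integrable_\<nu>] integral_\<nu>_V)
  have "(\<lambda>n. rvi M (\<lambda>g. eint \<nu> g) V\<^sub>0 n x) \<longlonglongrightarrow> normalized_at M (\<lambda>g. eint \<nu> g) V x"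
  proof (rule rvi_tendsto[where \<rho>="\<lambda>g. eint \<nu> g" and R="\<lambda>n. \<integral>y. F n y \<partial>\<nu>", OF _ r(1) r(2) V\<nu>])
    fix n s
    have "eint \<nu> (\<lambda>y. ereal (F n y + s)) = ereal (\<integral>y. F n y + s \<partial>\<nu>)"
      using F_integrable_\<nu> by (intro eint_integrable) simp
    then show "eint \<nu> (\<lambda>y. ereal (F n y + s)) = ereal ((\<integral>y. F n y \<partial>\<nu>) + s)"
      using F_integrable_\<nu> N.prob_space by simp
  qed
  moreover have "normalized_at M (\<lambda>g. eint \<nu> g) V x = ereal (V x)"
    using b by (simp add: normalized_at_def V\<nu>)
  ultimately show "(\<lambda>n. rvi M (\<lambda>g. eint \<nu> g) V\<^sub>0 n x) \<longlonglongrightarrow> ereal (V x)" by simp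
  have bdd_F: "bdd_below (range (F n))" for n
    using admissible_value_bdd[OF F_admissible[of n]] by (auto simp: bdd_below_def)
  have bdd_V: "bdd_below (range V)" using V_ge(2) by (intro bdd_belowI2[of _ "- C\<^sub>0"])
  show "(\<lambda>n. rvi M (\<lambda>g. INF y. g y) V\<^sub>0 n x) \<longlonglongrightarrow> normalized_at M (\<lambda>g. INF y. g y) V x"
    by (rule rvi_tendsto[where \<rho>="\<lambda>g. INF y. g y" and R="\<lambda>n. INF y. F n y", OF INF_ereal_shift[OF bdd_F] r(1) r(3)])
      (use INF_ereal_shift[OF bdd_V, of 0] in simp)
  show "(\<lambda>n. rvi M (\<lambda>g. g z) V\<^sub>0 n x) \<longlonglongrightarrow> normalized_at M (\<lambda>g. g z) V x"
    by (rule rvi_tendsto[where \<rho>="\<lambda>g. g z" and R="\<lambda>n. F n z", OF _ r(1) r(1)]) simp_all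
qed

text \<open>By \<open>step_lower\<close> with \<open>a = 0\<close>, the bound by
  \<open>V - k\<close> is preserved; lowering the coefficient of \<open>V\<close> afterwards costs
  only the constant \<open>a * C\<close>.\<close>

lemma lower_of_ge_V:
  assumes k: "\<And>x. V x - k \<le> V\<^sub>0 x" and a: "0 < a" "a < 1"
  shows "\<exists>q. \<forall>\<^sub>F n in sequentially. \<forall>x. (1 - a) * V x + q \<le> F n x"
proof -
  have Fk: "V x - k \<le> F n x" for n x
  proof (induction n arbitrary: x)
    case (Suc n)
    have "(1 - 0) * V x + (- k) + 0 * (0 - b) \<le> S (F n) x - b"
      by (rule step_lower[OF F_admissible]) (use Suc in \<open>auto simp: zero_ereal_def[symmetric]\<close>)
    then show ?case by simp
  qed (use k in simp)
  have "(1 - a) * V x + (- k - a * C) \<le> F n x" for n x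
  proof -
    have "0 \<le> a * (V x + C)" using a V_C_nonneg[of x] by simp
    then show ?thesis using Fk[of x n] by (simp add: algebra_simps)
  qed
  then show ?thesis by (auto intro!: exI[of _ "- k - a * C"])
qed

text \<open>With the bound on the cost as surplus, \<open>step_lower\<close> raises the coefficient
  of \<open>V\<close> from \<open>1 - (1 - \<eta>)^n\<close> to
  \<open>1 - (1 - \<eta>)^(n+1)\<close>. It tends to 1, while the constants lost on the way form a
  geometric series.\<close>

lemma lower_of_cost:
  assumes \<theta>: "0 < \<theta>" "\<And>x u. (x, u) \<in> graph M \<Longrightarrow> ereal (\<theta> * V x - \<theta>') \<le> enn2ereal (tcost (x, u))"
    and a: "0 < a" "a < 1"
  shows "\<exists>q. \<forall>\<^sub>F n in sequentially. \<forall>x. (1 - a) * V x + q \<le> F n x"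
proof -
  obtain m where m: "\<And>x. - m \<le> V\<^sub>0 x" using admissible_value_bdd[OF V\<^sub>0] by blast
  \<comment> \<open>\<open>\<eta>\<close> replaces \<theta> by a value below 1; the term
    \<open>\<theta> * C\<close> in \<open>t\<close> pays for the smaller coefficient where
    \<open>V\<close> is negative.\<close>
  define \<eta> t where "\<eta> = min \<theta> (1/2)" and "t = \<bar>\<theta>'\<bar> + \<theta> * C"
  have \<eta>: "0 < \<eta>" "\<eta> < 1" "\<eta> \<le> \<theta>" using \<theta>(1) by (auto simp: \<eta>_def)
  have t: "0 \<le> t + b" using \<theta>(1) C_bounds(1) b by (simp add: t_def)
  have cost: "ereal (\<eta> * V x - t) \<le> enn2ereal (tcost (x, u))" if xu: "(x, u) \<in> graph M" for x u
  proof -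
    have "0 \<le> (\<theta> - \<eta>) * (V x + C)" "0 \<le> \<eta> * C" using \<eta> V_C_nonneg[of x] C_bounds(1) by auto
    then have "\<eta> * V x - t \<le> \<theta> * V x - \<theta>'" by (simp add: t_def algebra_simps)
    then have "ereal (\<eta> * V x - t) \<le> ereal (\<theta> * V x - \<theta>')" by simp
    then show ?thesis using \<theta>(2)[OF xu] by (rule order.trans)
  qed
  let ?a = "\<lambda>n. (1 - \<eta>) ^ n"
  have a01: "0 \<le> ?a n" "?a n \<le> 1" for n using \<eta> by (auto intro: power_le_one)
  have Fn: "(1 - ?a n) * V x + (- m - (\<Sum>i<n. ?a i) * (t + b)) \<le> F n x" for n x
  proof (induction n arbitrary: x)
    case (Suc n)
    have "(1 - ?a n) * V x + (- m - (\<Sum>i<n. ?a i) * (t + b)) + ?a n * (\<eta> * V x - t - b) \<le> S (F n) x - b"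
      by (rule step_lower[OF F_admissible a01 Suc cost])
    then show ?case by (simp add: algebra_simps)
  qed (use m in simp)
  have sum_a: "(\<Sum>i<n. ?a i) \<le> 1 / \<eta>" for n
    using \<eta> a01 by (subst sum_gp_strict) (auto intro!: divide_right_mono)
  have "?a \<longlonglongrightarrow> 0" using \<eta> by (intro LIMSEQ_power_zero) auto
  then have "\<forall>\<^sub>F n in sequentially. ?a n < a" using a by (intro order_tendstoD) auto
  then have "\<forall>\<^sub>F n in sequentially. \<forall>x. (1 - a) * V x + (- m - 1 / \<eta> * (t + b) - C) \<le> F n x"
  proof eventually_elim
    case (elim n)
    show ?case
    proof
      fix x
      have "(\<Sum>i<n. ?a i) * (t + b) \<le> 1 / \<eta> * (t + b)" using sum_a t by (rule mult_right_mono)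
      moreover have "0 \<le> (a - ?a n) * (V x + C)" using elim V_C_nonneg[of x] by simp
      moreover have "(a - ?a n) * C \<le> 1 * C" using a a01[of n] C_bounds(1) by (intro mult_right_mono) auto
      ultimately show "(1 - a) * V x + (- m - 1 / \<eta> * (t + b) - C) \<le> F n x"
        using Fn[of n x] by (simp add: algebra_simps)
    qed
  qed
  then show ?thesis by blast
qed

end

section \<open>Constants from the standing assumptions and reduction of the three cases\<close>

theorem theorem5p1:
  fixes M :: "('x::polish_space, 'u::polish_space) mdp"
    and B :: "'x set" and \<delta> :: real and \<nu> :: "'x measure"
    and eX :: "'x \<Rightarrow> 'xs::polish_space" and eU :: "'u \<Rightarrow> 'us::polish_space"
    and V :: "'x \<Rightarrow> real" and v\<^sub>s :: "'x \<Rightarrow> 'u" and \<pi> :: "'x measure"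
    and V\<^sub>0 :: "'x \<Rightarrow> real" and xhat :: 'x
  defines "W \<equiv> rvi M (\<lambda>f. eint \<nu> f) V\<^sub>0"
    and "W_check \<equiv> rvi M (\<lambda>f. INF y. f y) V\<^sub>0"
    and "W_tilde \<equiv> rvi M (\<lambda>f. f xhat) V\<^sub>0"
  assumes "basic_mdp M" and "basic_assumptions M"
    and "A0 M B \<delta> \<nu>" and "A1 M eX eU" and "A2 M B \<delta> \<nu>"
    and V_star: "\<And>x. ereal (V x) = V_star M B \<delta> \<nu> x"
    and "V \<in> lsc_bdd_below" and "solves_acoe M V"
    and "minimizing_selector M V v\<^sub>s" and "optimal M (stationary (dirac_policy v\<^sub>s))"
    and "invariant_prob M (dirac_policy v\<^sub>s) \<pi>"
    and "xhat \<in> B"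
    and "case_a V \<pi> V\<^sub>0 \<or> case_b V \<pi> V\<^sub>0 \<or> case_c M V V\<^sub>0"
  shows "(AE x in \<pi>. (\<lambda>n. W n x) \<longlonglongrightarrow> ereal (V x)
            \<and> (\<lambda>n. W_check n x) \<longlonglongrightarrow> normalized_at M (\<lambda>f. INF y. f y) V x
            \<and> (\<lambda>n. W_tilde n x) \<longlonglongrightarrow> normalized_at M (\<lambda>f. f xhat) V x)
       \<and> (case_c M V V\<^sub>0 \<longrightarrow> (\<forall>x. (\<lambda>n. W n x) \<longlonglongrightarrow> ereal (V x)
            \<and> (\<lambda>n. W_check n x) \<longlonglongrightarrow> normalized_at M (\<lambda>f. INF y. f y) V x
            \<and> (\<lambda>n. W_tilde n x) \<longlonglongrightarrow> normalized_at M (\<lambda>f. f xhat) V x))"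
proof -
  note A0 = \<open>A0 M B \<delta> \<nu>\<close>[unfolded A0_def]
  note basic = \<open>basic_mdp M\<close> and cont = \<open>basic_assumptions M\<close>
  have beta_less: "beta M < (INF p\<in>{p \<in> graph M. fst p \<notin> B}. cost M p)" using A0 by blast
  then have "beta M \<noteq> \<top>" by (metis not_top_less)
  then obtain b where b: "0 \<le> b" "beta M = ennreal b" by (cases "beta M") auto
  \<comment> \<open>A level strictly between \<beta> and the infimum of the cost off
    \<open>B\<close> provides a finite gap \<epsilon> even if that infimum is infinite.\<close>
  obtain t where t: "beta M < t" "t < (INF p\<in>{p \<in> graph M. fst p \<notin> B}. cost M p)"
    using dense[OF beta_less] by blast
  then have "t \<noteq> \<top>" by (metis not_top_less)
  then obtain t' where t': "0 \<le> t'" "t = ennreal t'" by (cases t) auto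
  define \<epsilon> where "\<epsilon> = t' - b"
  have \<epsilon>: "0 < \<epsilon>" using t(1) b t' by (simp add: \<epsilon>_def ennreal_less_iff)
  have cost_off_B: "beta M + ennreal \<epsilon> \<le> cost M (x, u)" if "(x, u) \<in> graph M" "x \<notin> B" for x u
  proof -
    have "beta M + ennreal \<epsilon> = t" using b \<epsilon> t' by (simp add: \<epsilon>_def flip: ennreal_plus)
    also have "t \<le> (INF p\<in>{p \<in> graph M. fst p \<notin> B}. cost M p)" using t(2) by simp
    also have "\<dots> \<le> cost M (x, u)" using that by (intro INF_lower) simp
    finally show ?thesis .
  qed
  \<comment> \<open>Since \<open>xhat\<close> lies in \<open>B\<close>, the last clause of
    \<open>A0\<close> puts \<delta> strictly below the probability of \<open>B\<close> under an
    action at \<open>xhat\<close>.\<close>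
  have \<delta>: "0 < \<delta>" "\<delta> < 1"
  proof -
    show "0 < \<delta>" using A0 by blast
    obtain u where u: "u \<in> actions M xhat" using basic unfolding basic_mdp_def by (meson ex_in_conv)
    then have xu: "(xhat, u) \<in> graph M" by (simp add: graph_def)
    have "ennreal \<delta> < (INF p\<in>{p \<in> graph M. fst p \<in> B}. emeasure (ker M p) B)" using A0 by blast
    also have "\<dots> \<le> emeasure (ker M (xhat, u)) B" using xu \<open>xhat \<in> B\<close> by (intro INF_lower) simp
    also have "\<dots> \<le> 1"
    proof -
      have "ker M (xhat, u) \<in> space (prob_algebra borel)"
        using basic xu by (auto simp: basic_mdp_def space_restrict_space dest: measurable_space)
      then have "prob_space (ker M (xhat, u))" by (simp add: space_prob_algebra)
      then show ?thesis by (rule prob_space.measure_le_1)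
    qed
    finally show "\<delta> < 1" using \<open>0 < \<delta>\<close> by (simp add: ennreal_less_one_iff)
  qed
  have "closed (graph M)"
    unfolding graph_def using cont by (intro closed_graph_of_usc) (auto simp: basic_assumptions_def)
  then have graph: "graph M \<in> sets borel" by (rule borel_closed)
  obtain l where l: "\<And>x. l \<le> V x"
    using \<open>V \<in> lsc_bdd_below\<close> by (auto simp: lsc_bdd_below_def bdd_below_def)
  define C\<^sub>0 where "C\<^sub>0 = \<bar>l\<bar>"
  have C\<^sub>0: "0 \<le> C\<^sub>0" "- C\<^sub>0 \<le> V x" for x using l[of x] by (auto simp: C\<^sub>0_def)
  have V_meas: "V \<in> borel_measurable borel"
    using \<open>V \<in> lsc_bdd_below\<close> by (auto simp: lsc_bdd_below_def borel_measurable_iff_le)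
  \<comment> \<open>Intersecting with a closed cylinder over a compact set of states merges the two
    alternatives of \<open>A1\<close>.\<close>
  have K_inf: "K_inf_compact_cost M"
  proof -
    have "K_inf_compact_cost M" if c: "inf_compact_cost M"
      unfolding K_inf_compact_cost_def
    proof (intro allI impI)
      fix K :: "'x set" and \<kappa> :: real assume "compact K"
      have "compact ({p \<in> graph M. cost M p \<le> ennreal \<kappa>} \<inter> (K \<times> UNIV))"
        using c by (intro compact_Int_closed closed_Times compact_imp_closed[OF \<open>compact K\<close>] closed_UNIV)
          (auto simp: inf_compact_cost_def)
      moreover have "{p \<in> graph M. cost M p \<le> ennreal \<kappa>} \<inter> (K \<times> UNIV) = {p \<in> graph M. fst p \<in> K \<and> cost M p \<le> ennreal \<kappa>}"
        by auto
      ultimately show "compact {p \<in> graph M. fst p \<in> K \<and> cost M p \<le> ennreal \<kappa>}" by simp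
    qed
    then show ?thesis using \<open>A1 M eX eU\<close> by (auto simp: A1_def)
  qed
  define C where "C = C\<^sub>0 + (b + \<epsilon>) / \<delta>"
  interpret rvi_mdp M B \<delta> \<nu> V v\<^sub>s \<epsilon> C\<^sub>0 b C
  proof unfold_locales
    show "ennreal \<delta> * emeasure \<nu> A \<le> emeasure (ker M (x, u)) A"
      if "A \<in> sets borel" "x \<in> B" "(x, u) \<in> graph M" for A x u
      using A0 that by (fastforce simp: indicator_def)
    show "beta M < \<infinity>" using b by simp
    show "B \<in> sets borel" "\<nu> \<in> space (prob_algebra borel)" "emeasure \<nu> B = 1" using A0 by blast+
  qed (fact basic graph \<delta> \<epsilon> cost_off_B V_star V_meas C\<^sub>0 \<open>solves_acoe M V\<close>
      \<open>minimizing_selector M V v\<^sub>s\<close> b C_def cont K_inf)+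
  have abs_V: "\<bar>V x\<bar> \<le> (V x + C) + C" for x using C_bounds(1) C_bounds(3)[of x] by (auto simp: abs_if)
  \<comment> \<open>The weight given by 1 plus the absolute value of \<open>V\<close> is exchanged
    for \<open>1 + (V + C)\<close>, at the price of the factor \<open>1 + C\<close>.\<close>
  have V0_O: "admissible_value V\<^sub>0" if "V\<^sub>0 \<in> lsc_bdd_below" "V\<^sub>0 \<in> big_O V"
  proof -
    have "weighted_norm V V\<^sub>0 < \<infinity>" using that by (simp add: big_O_def)
    moreover have "0 \<le> weighted_norm V V\<^sub>0"
      unfolding weighted_norm_def by (rule SUP_upper2[of undefined]) auto
    ultimately obtain k where k: "weighted_norm V V\<^sub>0 = ereal k" "0 \<le> k" by (cases "weighted_norm V V\<^sub>0") auto
    have "V\<^sub>0 x \<le> (k * (1 + C)) * (1 + (V x + C))" for x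
    proof -
      have "ereal (\<bar>V\<^sub>0 x\<bar> / (1 + \<bar>V x\<bar>)) \<le> ereal k"
        unfolding k(1)[symmetric] weighted_norm_def by (rule SUP_upper) simp
      then have "\<bar>V\<^sub>0 x\<bar> \<le> k * (1 + \<bar>V x\<bar>)" by (simp add: pos_divide_le_eq)
      also have "\<dots> \<le> k * ((1 + C) * (1 + (V x + C)))"
      proof (rule mult_left_mono[OF _ k(2)])
        have "0 \<le> C * (V x + C)" using C_bounds(1) V_C_nonneg[of x] by simp
        then show "1 + \<bar>V x\<bar> \<le> (1 + C) * (1 + (V x + C))" using abs_V[of x] by (simp add: algebra_simps)
      qed
      finally show ?thesis by (simp add: mult.assoc)
    qed
    then show ?thesis
      using that(1) k(2) C_bounds(1) by (auto simp: admissible_value_def intro!: exI[of _ "k * (1 + C)"])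
  qed
  have cost_c: "\<exists>\<theta> \<theta>'. 0 < \<theta> \<and> (\<forall>x u. (x, u) \<in> graph M \<longrightarrow> ereal (\<theta> * V x - \<theta>') \<le> enn2ereal (tcost (x, u)))"
    if c: "case_c M V V\<^sub>0"
  proof -
    obtain \<theta> \<theta>' where \<theta>: "0 < \<theta>" "\<And>x. ereal (\<theta> * V x - \<theta>') \<le> (INF u\<in>actions M x. enn2ereal (cost M (x, u)))"
      using c unfolding case_c_def by blast
    have "ereal (\<theta> * V x - \<theta>') \<le> enn2ereal (tcost (x, u))" if xu: "(x, u) \<in> graph M" for x u
    proof -
      have "(INF u\<in>actions M x. enn2ereal (cost M (x, u))) \<le> enn2ereal (cost M (x, u))"
        using xu by (intro INF_lower) (simp add: graph_iff)
      with \<theta>(2)[of x] show ?thesis by (simp add: tcost_graph[OF xu])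
    qed
    with \<theta>(1) show ?thesis by blast
  qed
  have summable_\<pi>: "(\<Sum>k. \<integral>\<^sup>+x. (opt.T ^^ k) Y x \<partial>\<nu>) < \<infinity>" if "eint \<pi> (\<lambda>x. ereal (V x)) < \<infinity>"
  proof (rule suminf_nn_integral_\<nu>_of_invariant[OF \<open>invariant_prob M (dirac_policy v\<^sub>s) \<pi>\<close> Y_measurable])
    have \<pi>: "prob_space \<pi>" "sets \<pi> = sets borel"
      using \<open>invariant_prob M (dirac_policy v\<^sub>s) \<pi>\<close> by (auto simp: invariant_prob_def space_prob_algebra)
    have "eint \<pi> (\<lambda>x. ereal (V x)) + ereal C = enn2ereal (\<integral>\<^sup>+x. Y x \<partial>\<pi>)"
      unfolding Y_def by (rule eint_add_const[OF \<pi>(1) _ C_bounds(3)]) (simp add: measurable_cong_sets[OF \<pi>(2) refl])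
    then show "(\<integral>\<^sup>+x. Y x \<partial>\<pi>) < \<infinity>"
      using that by (cases "\<integral>\<^sup>+x. Y x \<partial>\<pi>") auto
  qed
  have V0: "admissible_value V\<^sub>0"
    and summable: "(\<Sum>k. \<integral>\<^sup>+x. (opt.T ^^ k) Y x \<partial>\<nu>) < \<infinity>"
    and cases: "(\<exists>k. \<forall>x. V x - k \<le> V\<^sub>0 x) \<or> case_c M V V\<^sub>0"
  proof -
    consider (a) "case_a V \<pi> V\<^sub>0" | (b) "case_b V \<pi> V\<^sub>0" | (c) "case_c M V V\<^sub>0" using assms by blast
    then have "admissible_value V\<^sub>0 \<and> (\<Sum>k. \<integral>\<^sup>+x. (opt.T ^^ k) Y x \<partial>\<nu>) < \<infinity>
      \<and> ((\<exists>k. \<forall>x. V x - k \<le> V\<^sub>0 x) \<or> case_c M V V\<^sub>0)"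
    proof cases
      case a
      then show ?thesis using V0_O summable_\<pi> by (auto simp: case_a_def V_class_def)
    next
      case b
      then obtain k\<^sub>1 k\<^sub>2 where k: "\<And>x. \<bar>V x\<bar> \<le> k\<^sub>1" "\<And>x. \<bar>V\<^sub>0 x\<bar> \<le> k\<^sub>2"
        by (auto simp: case_b_def bounded_iff)
      have k2: "0 \<le> k\<^sub>2" using k(2)[of undefined] by linarith
      \<comment> \<open>The weight \<open>1 + (V x + C)\<close> is at least 1, so the bound
        \<open>k\<^sub>2\<close> of \<open>V\<^sub>0\<close> itself serves as growth
        constant.\<close>
      have "V\<^sub>0 x \<le> k\<^sub>2 * (1 + (V x + C))" for x
      proof -
        have "k\<^sub>2 * 1 \<le> k\<^sub>2 * (1 + (V x + C))" using k2 V_C_nonneg[of x] by (intro mult_left_mono) auto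
        with k(2)[of x] show ?thesis by (simp add: abs_le_iff)
      qed
      then have "admissible_value V\<^sub>0"
        using b k2 by (auto simp: case_b_def admissible_value_def)
      moreover have "V x - (k\<^sub>1 + k\<^sub>2) \<le> V\<^sub>0 x" for x using k(1)[of x] k(2)[of x] by (auto simp: abs_le_iff)
      ultimately show ?thesis using b summable_\<pi> by (auto simp: case_b_def)
    next
      case c
      then obtain \<theta> \<theta>' where \<theta>: "0 < \<theta>" "\<And>x u. (x, u) \<in> graph M \<Longrightarrow> ereal (\<theta> * V x - \<theta>') \<le> enn2ereal (tcost (x, u))"
        using cost_c by blast
      show ?thesis
        using c V0_O suminf_nn_integral_\<nu>_Y_of_cost[OF \<theta>(1) \<theta>(2)[OF f_graph]] by (auto simp: case_c_def)
    qed
    then show "admissible_value V\<^sub>0" "(\<Sum>k. \<integral>\<^sup>+x. (opt.T ^^ k) Y x \<partial>\<nu>) < \<infinity>"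
      "(\<exists>k. \<forall>x. V x - k \<le> V\<^sub>0 x) \<or> case_c M V V\<^sub>0" by blast+
  qed
  interpret value_iteration M B \<delta> \<nu> V v\<^sub>s \<epsilon> C\<^sub>0 b C V\<^sub>0
    using V0 summable by unfold_locales
  have low: "\<exists>q. \<forall>\<^sub>F n in sequentially. \<forall>x. (1 - a) * V x + q \<le> F n x" if "0 < a" "a < 1" for a
    using cases
  proof
    assume "\<exists>k. \<forall>x. V x - k \<le> V\<^sub>0 x"
    then obtain k where "\<And>x. V x - k \<le> V\<^sub>0 x" by blast
    then show ?thesis using that by (rule lower_of_ge_V)
  next
    assume "case_c M V V\<^sub>0"
    then obtain \<theta> \<theta>' where "0 < \<theta>" "\<And>x u. (x, u) \<in> graph M \<Longrightarrow> ereal (\<theta> * V x - \<theta>') \<le> enn2ereal (tcost (x, u))"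
      using cost_c by blast
    then show ?thesis using that by (rule lower_of_cost)
  qed
  show ?thesis
    unfolding W_def W_check_def W_tilde_def using rvi_converges[OF low] by blast
qed

end
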